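(* Let $\nabla K\in L^\infty(\mathbb{R}^d)$ and let $\Phi$ satisfy additionally $e^{-\Phi}\in L^1(\mathbb{R}^d)$. Let $T>0$ and, for each $\gamma\ge 1$, let $(\mu_t^\gamma)_{t\in[0,T]}$ be a weak solution of the kinetic Vlasov--Fokker--Planck equation \[ \partial_t\mu_t^\gamma + \gamma\, v\cdot \nabla_x\mu_t^\gamma + \gamma \nabla_v\cdot\bigl(\mu_t^\gamma (\mathsf{F}(x,\rho_t^\gamma)-\gamma v)\bigr) = \gamma^2\Delta_v\mu_t^\gamma,\qquad (x,v)\in\mathbb{R}^d\times\mathbb{R}^d, \] with $\rho_t^\gamma=\int_{\mathbb{R}^d}\mu_t^\gamma(\cdot,dv)$ the $x$-marginal of $\mu_t^\gamma$ and $\mathsf{F}(x,\rho)=-\nabla\Phi(x)-(\nabla K\star\rho)(x)$, and suppose this family satisfies \[ \sup_{\gamma \ge 1}\sup_{t\in[0,T]}\left\{\|\nabla_x\mu_t^\gamma\|_{L_H^2} + \iint_{\mathbb{R}^d\times\mathbb{R}^d} |v|^2\, \mu_t^\gamma(dxdv)\right\} <\infty\,. \] If $(\rho_t)_{t\in[0,T]}$ is the unique free-energy-regular solution (in the sense described in the context) of the aggregation-diffusion equation \[ \partial_t\rho_t + \nabla_x\cdot \bigl(\rho_t \mathsf{F}(\cdot,\rho_t)\bigr) = \Delta_x \rho_t, \] then \[ \sup_{t\in[0,T]} d_{\mathrm{BL}}^2(\rho^\gamma_t, \rho_t) \le C\left(\mathrm{Ent}\bigl((\pi^x\circ \Gamma^\gamma)_\#\mu_0^\gamma\,\big|\,\rho_0\bigr)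 + \frac{1}{\gamma^2}\right), \] for some constant $C>0$ independent of $\gamma\ge 1$.
   Context: Setting: $d\ge1$, $\gamma>0$. The external potential satisfies $0\le\Phi\in\mathrm{Lip}_{loc}(\mathbb{R}^d)$ with (A1) there is $c_\Phi>0$ with $|\nabla\Phi(x)|\le c_\Phi(1+|x|)$ for all $x$ and $\nabla\Phi$ globally Lipschitz with constant $\le c_\Phi$; (A2) for every $r\in[1,\infty)$, $\sup_{x}|\nabla\Phi(x)|^r e^{-\Phi(x)}<\infty$. The Hamiltonian is $H(x,v)=\Phi(x)+|v|^2/2$ and $\|\mu\|_{L^p_H}:=\bigl(\iint \mu^p e^{(p-1)H}\,dx\,dv\bigr)^{1/p}$. The coarse-graining map is $\Gamma^\gamma(x,v)=(x+v/\gamma,v)$ and $\pi^x(x,v)=x$; $f_\#\nu$ denotes push-forward. The bounded Lipschitz distance is $d_{\mathrm{BL}}(\mu,\nu)=\sup\{|\langle f,\mu-\nu\rangle|:\ \|f\|_{\mathrm{Lip}}\le1,\ \|f\|_{L^\infty}\le1\}$. The relative entropy is $\mathrm{Ent}(\mu|\nu)=\int (d\mu/d\nu)\log(d\mu/d\nu)\,d\nu$ if $\mu\ll\nu$ and $+\infty$ otherwise. A weak solution of the kinetic equation is a curve $\mu\in\mathcal{C}([0,T];\mathcal{P}_2(\mathbb{R}^d\times\mathbb{R}^d))$ satisfying the equation in the distributional sense against $\mathcal{C}_c^\infty$ test functions. With the free energy $\mathcal{E}(\rho)=\mathrm{Ent}(\rho|\text{Lebesgue})+\int\Phi\,d\rho+\frac12\int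 K\star\rho\,d\rho$, a free-energy-regular solution of the aggregation-diffusion equation with initial datum $\rho_0\in\mathcal{P}_2(\mathbb{R}^d)$, $\mathcal{E}(\rho_0)<\infty$, is a weak (distributional) solution $\rho\in\mathcal{C}([0,T];\mathcal{P}_2(\mathbb{R}^d))$ with $\rho\in L^1((0,T);W^{1,1}(\mathbb{R}^d))$ and $\sup_t\mathcal{E}(\rho_t)+\sup_t\|\mathsf{F}(\cdot,\rho_t)\|_{L^\infty}+\int_0^T\int|\nabla\rho_t|^2/\rho_t\,dx\,dt<\infty$. *)

theory Defs
  imports "HOL-Analysis.Analysis" "HOL-Probability.Probability"
begin

definition pd :: "'b::euclidean_space \<Rightarrow> ('b \<Rightarrow> real) \<Rightarrow> 'b \<Rightarrow> real" where
  "pd e f x = deriv (\<lambda>s. f (x + s *\<^sub>R e)) 0"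

fun iter_pd :: "'b::euclidean_space list \<Rightarrow> ('b \<Rightarrow> real) \<Rightarrow> 'b \<Rightarrow> real" where
  "iter_pd [] f = f"
| "iter_pd (e # es) f = pd e (iter_pd es f)"

definition smooth_fun :: "('b::euclidean_space \<Rightarrow> real) \<Rightarrow> bool" where
  "smooth_fun f \<longleftrightarrow>
     (\<forall>es. set es \<subseteq> Basis \<longrightarrow>
        continuous_on UNIV (iter_pd es f) \<and>
        (\<forall>e\<in>Basis. \<forall>x. (\<lambda>s. iter_pd es f (x + s *\<^sub>R e)) differentiable (at 0)))"

definition test_fun :: "'b set \<Rightarrow> ('b::euclidean_space \<Rightarrow> real) \<Rightarrow> bool" where
  "test_fun U f \<longleftrightarrow> smooth_fun f \<and> compact (closure {x. f x \<noteq> 0}) \<and> closure {x. f x \<noteq> 0} \<subseteq> U"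

definition weak_grad :: "('a::euclidean_space \<Rightarrow> real) \<Rightarrow> ('a \<Rightarrow> 'a) \<Rightarrow> bool" where
  "weak_grad f g \<longleftrightarrow> f \<in> borel_measurable borel \<and> g \<in> borel_measurable borel \<and>
     (\<forall>C. compact C \<longrightarrow> set_integrable lborel C f \<and> set_integrable lborel C g) \<and>
     (\<forall>\<psi>. test_fun UNIV \<psi> \<longrightarrow> (\<forall>b\<in>Basis.
        (\<integral>x. f x * pd b \<psi> x \<partial>lborel) = - (\<integral>x. (g x \<bullet> b) * \<psi> x \<partial>lborel)))"

definition weak_x_grad :: "('a::euclidean_space \<times> 'a \<Rightarrow> real) \<Rightarrow> ('a \<times> 'a \<Rightarrow> 'a) \<Rightarrow> bool" where
  "weak_x_grad f g \<longleftrightarrow> f \<in> borel_measurable borel \<and> g \<in> borel_measurable borel \<and>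
     (\<forall>C. compact C \<longrightarrow> set_integrable lborel C f \<and> set_integrable lborel C g) \<and>
     (\<forall>\<psi>. test_fun UNIV \<psi> \<longrightarrow> (\<forall>b\<in>Basis.
        (\<integral>z. f z * pd (b, 0) \<psi> z \<partial>lborel) = - (\<integral>z. (g z \<bullet> b) * \<psi> z \<partial>lborel)))"

definition P2 :: "'b::euclidean_space measure \<Rightarrow> bool" where
  "P2 \<mu> \<longleftrightarrow> prob_space \<mu> \<and> sets \<mu> = sets borel \<and> (\<integral>\<^sup>+z. ennreal (norm z ^ 2) \<partial>\<mu>) < \<infinity>"

definition couplings :: "'b::euclidean_space measure \<Rightarrow> 'b measure \<Rightarrow> ('b \<times> 'b) measure set" where
  "couplings \<mu> \<nu> = {\<pi>. prob_space \<pi> \<and> sets \<pi> = sets (borel :: ('b \<times> 'b) measure) \<and>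
                       distr \<pi> borel fst = \<mu> \<and> distr \<pi> borel snd = \<nu>}"

definition W2sq :: "'b::euclidean_space measure \<Rightarrow> 'b measure \<Rightarrow> ennreal" where
  "W2sq \<mu> \<nu> = (INF \<pi>\<in>couplings \<mu> \<nu>. \<integral>\<^sup>+p. ennreal (dist (fst p) (snd p) ^ 2) \<partial>\<pi>)"

definition P2_curve :: "real \<Rightarrow> (real \<Rightarrow> 'b::euclidean_space measure) \<Rightarrow> bool" where
  "P2_curve T \<mu> \<longleftrightarrow> (\<forall>t\<in>{0..T}. P2 (\<mu> t)) \<and>
     (\<forall>t\<in>{0..T}. ((\<lambda>s. W2sq (\<mu> s) (\<mu> t)) \<longlongrightarrow> 0) (at t within {0..T}))"

definition xmarg :: "('a::euclidean_space \<times> 'a) measure \<Rightarrow> 'a measure" where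
  "xmarg \<mu> = distr \<mu> borel fst"

definition dBL :: "'b::euclidean_space measure \<Rightarrow> 'b measure \<Rightarrow> real" where
  "dBL \<mu> \<nu> = Sup {\<bar>(\<integral>x. f x \<partial>\<mu>) - (\<integral>x. f x \<partial>\<nu>)\<bar> | f.
                    1-lipschitz_on UNIV f \<and> (\<forall>x. \<bar>f x\<bar> \<le> 1)}"

definition Ent :: "'b measure \<Rightarrow> 'b measure \<Rightarrow> ereal" where
  "Ent \<mu> \<nu> = (if absolutely_continuous \<nu> \<mu> then
      (let f = (\<lambda>x. enn2real (RN_deriv \<nu> \<mu> x)) in
        enn2ereal (\<integral>\<^sup>+x. ennreal (f x * ln (f x)) \<partial>\<nu>)
        - enn2ereal (\<integral>\<^sup>+x. ennreal (- (f x * ln (f x))) \<partial>\<nu>))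
    else \<infinity>)"

definition Gamma :: "real \<Rightarrow> 'a::euclidean_space \<times> 'a \<Rightarrow> 'a \<times> 'a" where
  "Gamma \<gamma> z = (fst z + (1 / \<gamma>) *\<^sub>R snd z, snd z)"

definition pix :: "'a \<times> 'a \<Rightarrow> 'a" where
  "pix z = fst z"

definition Hamil :: "('a::euclidean_space \<Rightarrow> real) \<Rightarrow> 'a \<times> 'a \<Rightarrow> real" where
  "Hamil Phi z = Phi (fst z) + norm (snd z) ^ 2 / 2"

definition Fdrift :: "('a::euclidean_space \<Rightarrow> 'a) \<Rightarrow> ('a \<Rightarrow> 'a) \<Rightarrow> 'a \<Rightarrow> 'a measure \<Rightarrow> 'a" where
  "Fdrift DPhi DK x \<rho> = - DPhi x - (\<integral>y. DK (x - y) \<partial>\<rho>)"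

definition dt_kin :: "(real \<times> ('a::euclidean_space \<times> 'a) \<Rightarrow> real) \<Rightarrow> real \<times> ('a \<times> 'a) \<Rightarrow> real" where
  "dt_kin \<phi> p = pd (1, 0) \<phi> p"

definition gradx_kin :: "(real \<times> ('a::euclidean_space \<times> 'a) \<Rightarrow> real) \<Rightarrow> real \<times> ('a \<times> 'a) \<Rightarrow> 'a" where
  "gradx_kin \<phi> p = (\<Sum>b\<in>Basis. pd (0, (b, 0)) \<phi> p *\<^sub>R b)"

definition gradv_kin :: "(real \<times> ('a::euclidean_space \<times> 'a) \<Rightarrow> real) \<Rightarrow> real \<times> ('a \<times> 'a) \<Rightarrow> 'a" where
  "gradv_kin \<phi> p = (\<Sum>b\<in>Basis. pd (0, (0, b)) \<phi> p *\<^sub>R b)"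

definition lapv_kin :: "(real \<times> ('a::euclidean_space \<times> 'a) \<Rightarrow> real) \<Rightarrow> real \<times> ('a \<times> 'a) \<Rightarrow> real" where
  "lapv_kin \<phi> p = (\<Sum>b\<in>(Basis::'a set). pd (0, (0, b)) (pd (0, (0, b)) \<phi>) p)"

definition kinetic_weak_sol ::
  "('a::euclidean_space \<Rightarrow> 'a) \<Rightarrow> ('a \<Rightarrow> 'a) \<Rightarrow> real \<Rightarrow> real \<Rightarrow> (real \<Rightarrow> ('a \<times> 'a) measure) \<Rightarrow> bool" where
  "kinetic_weak_sol DPhi DK \<gamma> T \<mu> \<longleftrightarrow> P2_curve T \<mu> \<and>
     (\<forall>\<phi>. test_fun ({0<..<T} \<times> UNIV) \<phi> \<longrightarrow>
        (let G = (\<lambda>t z. dt_kin \<phi> (t, z)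
                     + \<gamma> * (snd z \<bullet> gradx_kin \<phi> (t, z))
                     + \<gamma> * ((Fdrift DPhi DK (fst z) (xmarg (\<mu> t)) - \<gamma> *\<^sub>R snd z) \<bullet> gradv_kin \<phi> (t, z))
                     + \<gamma>\<^sup>2 * lapv_kin \<phi> (t, z))
         in (\<forall>t\<in>{0<..<T}. integrable (\<mu> t) (G t)) \<and>
            set_integrable lborel {0<..<T} (\<lambda>t. \<integral>z. G t z \<partial>\<mu> t) \<and>
            (\<integral>t\<in>{0<..<T}. (\<integral>z. G t z \<partial>\<mu> t) \<partial>lborel) = 0))"

definition dt_ad :: "(real \<times> 'a::euclidean_space \<Rightarrow> real) \<Rightarrow> real \<times> 'a \<Rightarrow> real" where
  "dt_ad \<psi> p = pd (1, 0) \<psi> p"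

definition grad_ad :: "(real \<times> 'a::euclidean_space \<Rightarrow> real) \<Rightarrow> real \<times> 'a \<Rightarrow> 'a" where
  "grad_ad \<psi> p = (\<Sum>b\<in>Basis. pd (0, b) \<psi> p *\<^sub>R b)"

definition lap_ad :: "(real \<times> 'a::euclidean_space \<Rightarrow> real) \<Rightarrow> real \<times> 'a \<Rightarrow> real" where
  "lap_ad \<psi> p = (\<Sum>b\<in>(Basis::'a set). pd (0, b) (pd (0, b) \<psi>) p)"

definition free_energy :: "('a::euclidean_space \<Rightarrow> real) \<Rightarrow> ('a \<Rightarrow> real) \<Rightarrow> 'a measure \<Rightarrow> ereal" where
  "free_energy Phi K \<rho> = Ent \<rho> lborel + enn2ereal (\<integral>\<^sup>+x. ennreal (Phi x) \<partial>\<rho>)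
                          + ereal ((1/2) * (\<integral>x. (\<integral>y. K (x - y) \<partial>\<rho>) \<partial>\<rho>))"

definition FER_sol ::
  "('a::euclidean_space \<Rightarrow> real) \<Rightarrow> ('a \<Rightarrow> 'a) \<Rightarrow> ('a \<Rightarrow> real) \<Rightarrow> ('a \<Rightarrow> 'a) \<Rightarrow> real
    \<Rightarrow> 'a measure \<Rightarrow> (real \<Rightarrow> 'a measure) \<Rightarrow> bool" where
  "FER_sol Phi DPhi K DK T \<rho>0 \<rho> \<longleftrightarrow>
     P2 \<rho>0 \<and> free_energy Phi K \<rho>0 < \<infinity> \<and> \<rho> 0 = \<rho>0 \<and> P2_curve T \<rho> \<and>
     (\<forall>\<psi>. test_fun ({0<..<T} \<times> UNIV) \<psi> \<longrightarrow>
        (let G = (\<lambda>t x. dt_ad \<psi> (t, x) + Fdrift DPhi DK x (\<rho> t) \<bullet> grad_ad \<psi> (t, x)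
                        + lap_ad \<psi> (t, x))
         in (\<forall>t\<in>{0<..<T}. integrable (\<rho> t) (G t)) \<and>
            set_integrable lborel {0<..<T} (\<lambda>t. \<integral>x. G t x \<partial>\<rho> t) \<and>
            (\<integral>t\<in>{0<..<T}. (\<integral>x. G t x \<partial>\<rho> t) \<partial>lborel) = 0)) \<and>
     (\<exists>r Dr. (\<lambda>p. r (fst p) (snd p)) \<in> borel_measurable borel \<and>
             (\<lambda>p. Dr (fst p) (snd p)) \<in> borel_measurable borel \<and>
             (AE t in lborel. t \<in> {0<..<T} \<longrightarrow>
                 (\<forall>x. 0 \<le> r t x) \<and> \<rho> t = density lborel (\<lambda>x. ennreal (r t x)) \<and> weak_grad (r t) (Dr t)) \<and>
             (\<integral>\<^sup>+t\<in>{0<..<T}. (\<integral>\<^sup>+x. ennreal (norm (r t x) + norm (Dr t x)) \<partial>lborel) \<partial>lborel) < \<infinity> \<and>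
             (\<integral>\<^sup>+t\<in>{0<..<T}. (\<integral>\<^sup>+x. ennreal (norm (Dr t x) ^ 2 / r t x) \<partial>lborel) \<partial>lborel) < \<infinity>) \<and>
     (\<exists>B. \<forall>t\<in>{0..T}. free_energy Phi K (\<rho> t) \<le> ereal B) \<and>
     (\<exists>B. \<forall>t\<in>{0..T}. AE x in lborel. norm (Fdrift DPhi DK x (\<rho> t)) \<le> B)"

end

theory Submission
  imports Defs
begin

text \<open>
  The drift of a free-energy-regular solution is bounded, hence so is \<open>DPhi\<close>, and all drifts occurring
  below are bounded uniformly. The coarse-grained density, the law of \<open>x + v / \<gamma>\<close> under \<open>mu \<gamma> t\<close>, solves a
  Fokker-Planck equation with unit diffusion whose drift differs from that of \<open>rho\<close> by at most a multiple of
  \<open>|v| / \<gamma> + 1 / \<gamma>\<close> plus the total variation distance of the two densities; the convolution with the merely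
  bounded \<open>DK\<close> is controlled because \<open>mu\<close> has an integrable weak \<open>x\<close>-gradient. Testing both equations with
  the backward heat flow of a bounded function, whose gradient at time distance \<open>s\<close> is of order \<open>1 / sqrt s\<close>,
  gives a weakly singular Volterra inequality for the total variation distance. Hence this distance is bounded
  by its initial value plus \<open>O(1 / \<gamma>)\<close>, and Pinsker's inequality is needed only at time zero.
\<close>

section \<open>Smooth functions\<close>

text \<open>Total variation, and not the weaker \<open>dBL\<close>, is the distance that closes the
  argument: the convolution with a merely bounded \<open>DK\<close> depends Lipschitz continuously
  on the measure in total variation, but not in weaker metrics. The map x + v / \<gamma> removes the
  velocity from the equation exactly: applied to the phase-space drift (\<gamma> v, \<gamma> (F -
  \<gamma> v)) it returns F, and it turns \<open>\<gamma>\<^sup>2\<close> times the velocity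
  Laplacian into the spatial Laplacian. The remaining defect is that F is evaluated at x and not at
  x + v / \<gamma>. For \<open>DPhi\<close> this costs a multiple of |v| / \<gamma>; in the
  convolution the shift is moved from the argument of \<open>DK\<close> to the law of x, where the
  bound on the x-gradient applies. This bound is needed in L1, and the weighted L2 bound yields it
  because exp(-H) times a polynomial in v has finite mass, which rests on integrability of
  exp(-Phi). The heat flow puts all derivatives on the kernel, so the data need only be bounded. An
  exponential weight in time makes the Volterra term a contraction. Squaring the final bound turns 1
  / \<gamma> into \<open>1 / \<gamma>\<^sup>2\<close>.\<close>

definition smooth_on :: "'b::euclidean_space set \<Rightarrow> ('b \<Rightarrow> real) \<Rightarrow> bool" where
  "smooth_on U f \<longleftrightarrow>
     (\<forall>es. set es \<subseteq> Basis \<longrightarrow>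
        continuous_on U (iter_pd es f) \<and>
        (\<forall>e\<in>Basis. \<forall>x\<in>U. (\<lambda>s. iter_pd es f (x + s *\<^sub>R e)) differentiable (at 0)))"

lemma smooth_fun_iff: "smooth_fun f \<longleftrightarrow> smooth_on UNIV f"
  by (simp add: smooth_fun_def smooth_on_def)

lemma eventually_line_in_open:
  fixes x e :: "'b::real_normed_vector"
  assumes "open U" "x \<in> U"
  shows "eventually (\<lambda>s. x + s *\<^sub>R e \<in> U) (nhds 0)"
proof -
  have "((\<lambda>s. x + s *\<^sub>R e) \<longlongrightarrow> x + 0 *\<^sub>R e) (nhds 0)"
    by (intro tendsto_intros filterlim_ident)
  then show ?thesis
    using assms by (auto dest: topological_tendstoD)
qed

lemma pd_eqI: "((\<lambda>s. f (x + s *\<^sub>R e)) has_real_derivative d) (at 0) \<Longrightarrow> pd e f x = d"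
  by (simp add: pd_def DERIV_imp_deriv)

lemma line_DERIV_cong:
  fixes x e :: "'b::euclidean_space"
  assumes "open U" "x \<in> U" "\<And>y. y \<in> U \<Longrightarrow> f y = g y"
  shows "((\<lambda>s. f (x + s *\<^sub>R e)) has_real_derivative d) (at 0) \<longleftrightarrow>
         ((\<lambda>s. g (x + s *\<^sub>R e)) has_real_derivative d) (at 0)"
  using eventually_line_in_open[OF assms(1,2), of e] assms(3)
  by (intro DERIV_cong_ev refl) (auto elim: eventually_mono)

lemma pd_cong:
  assumes "open U" "x \<in> U" "\<And>y. y \<in> U \<Longrightarrow> f y = g y"
  shows "pd e f x = pd e g x"
  unfolding pd_def using eventually_line_in_open[OF assms(1,2), of e] assms(3)
  by (intro deriv_cong_ev refl) (auto elim: eventually_mono)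

text \<open>Smoothness is the greatest predicate that implies continuity and is stable under partial
  derivatives; this coinduction principle replaces explicit formulas for iterated derivatives.\<close>

lemma smooth_on_coinduct:
  assumes U: "open U" and f: "f \<in> S"
    and cont: "\<And>g. g \<in> S \<Longrightarrow> continuous_on U g"
    and der: "\<And>g e. g \<in> S \<Longrightarrow> e \<in> Basis \<Longrightarrow>
      \<exists>h\<in>S. \<forall>x\<in>U. ((\<lambda>s. g (x + s *\<^sub>R e)) has_real_derivative h x) (at 0)"
  shows "smooth_on U f"
  unfolding smooth_on_def
proof (intro allI impI)
  fix es :: "'a list" assume "set es \<subseteq> Basis"
  then have "\<exists>h\<in>S. \<forall>x\<in>U. iter_pd es f x = h x"
  proof (induction es)
    case Nil
    then show ?case using f by auto
  next
    case (Cons e es)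
    then obtain h where h: "h \<in> S" "\<And>x. x \<in> U \<Longrightarrow> iter_pd es f x = h x" by auto
    from der[OF h(1), of e] Cons.prems obtain k where
      k: "k \<in> S" "\<And>x. x \<in> U \<Longrightarrow> ((\<lambda>s. h (x + s *\<^sub>R e)) has_real_derivative k x) (at 0)" by auto
    have "iter_pd (e # es) f x = k x" if "x \<in> U" for x
      using pd_cong[OF U that, of "iter_pd es f" h e] h(2) pd_eqI[OF k(2)[OF that]] by simp
    with k(1) show ?case by blast
  qed
  then obtain h where h: "h \<in> S" "\<And>x. x \<in> U \<Longrightarrow> iter_pd es f x = h x" by auto
  show "continuous_on U (iter_pd es f) \<and>
        (\<forall>e\<in>Basis. \<forall>x\<in>U. (\<lambda>s. iter_pd es f (x + s *\<^sub>R e)) differentiable (at 0))"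
  proof (intro conjI ballI)
    show "continuous_on U (iter_pd es f)"
      using cont[OF h(1)] h(2) by (simp cong: continuous_on_cong)
    fix e :: 'a and x assume "e \<in> Basis" "x \<in> U"
    then obtain d where "((\<lambda>s. h (x + s *\<^sub>R e)) has_real_derivative d) (at 0)"
      using der[OF h(1)] by blast
    then have "((\<lambda>s. iter_pd es f (x + s *\<^sub>R e)) has_real_derivative d) (at 0)"
      using line_DERIV_cong[OF U \<open>x \<in> U\<close>, of "iter_pd es f" h e d] h(2) by blast
    then show "(\<lambda>s. iter_pd es f (x + s *\<^sub>R e)) differentiable (at 0)"
      using real_differentiable_def by blast
  qed
qed

lemma smooth_on_imp_continuous_on: "smooth_on U f \<Longrightarrow> continuous_on U f"
  unfolding smooth_on_def by (drule spec[of _ "[]"]) auto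

lemma iter_pd_append: "iter_pd (es @ es') f = iter_pd es (iter_pd es' f)"
  by (induction es) auto

lemma smooth_on_pd: "smooth_on U f \<Longrightarrow> e \<in> Basis \<Longrightarrow> smooth_on U (pd e f)"
  unfolding smooth_on_def using iter_pd_append[of _ "[e]" f, symmetric] by simp

lemma smooth_on_has_pd:
  assumes "smooth_on U f" "e \<in> Basis" "x \<in> U"
  shows "((\<lambda>s. f (x + s *\<^sub>R e)) has_real_derivative pd e f x) (at 0)"
proof -
  have "(\<lambda>s. f (x + s *\<^sub>R e)) differentiable (at 0)"
    using assms unfolding smooth_on_def by (drule_tac spec[of _ "[]"]) auto
  then show ?thesis
    unfolding pd_def by (simp add: DERIV_deriv_iff_real_differentiable)
qed

text \<open>A partial derivative at a point of the open set reads only nearby values, so agreement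
  on \<open>U\<close> passes to all iterated derivatives. The functions agreeing on \<open>U\<close>
  with some smooth function form the coinduction set.\<close>

lemma smooth_on_cong:
  assumes U: "open U" and f: "smooth_on U f" and eq: "\<And>x. x \<in> U \<Longrightarrow> g x = f x"
  shows "smooth_on U g"
proof (rule smooth_on_coinduct[OF U, where S = "{g. \<exists>f. smooth_on U f \<and> (\<forall>x\<in>U. g x = f x)}"])
  show "g \<in> {g. \<exists>f. smooth_on U f \<and> (\<forall>x\<in>U. g x = f x)}" using assms by auto
next
  fix k assume "k \<in> {g. \<exists>f. smooth_on U f \<and> (\<forall>x\<in>U. g x = f x)}"
  then show "continuous_on U k"
    using smooth_on_imp_continuous_on by (auto cong: continuous_on_cong)
next
  fix k and e :: 'a assume "k \<in> {g. \<exists>f. smooth_on U f \<and> (\<forall>x\<in>U. g x = f x)}" and e: "e \<in> Basis"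
  then obtain f where f: "smooth_on U f" "\<And>x. x \<in> U \<Longrightarrow> k x = f x" by auto
  have "((\<lambda>s. k (x + s *\<^sub>R e)) has_real_derivative pd e f x) (at 0)" if "x \<in> U" for x
    using smooth_on_has_pd[OF f(1) e that] line_DERIV_cong[OF U that, of k f e] f(2) by blast
  then show "\<exists>h\<in>{g. \<exists>f. smooth_on U f \<and> (\<forall>x\<in>U. g x = f x)}.
      \<forall>x\<in>U. ((\<lambda>s. k (x + s *\<^sub>R e)) has_real_derivative h x) (at 0)"
    using smooth_on_pd[OF f(1) e] by (intro bexI[of _ "pd e f"]) auto
qed

text \<open>Serves to glue a test function across the time at which its heat-flow factor becomes
  singular and a vanishing time factor takes over.\<close>

lemma smooth_on_Un:
  assumes "open U" "open V" "smooth_on U f" "smooth_on V f"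
  shows "smooth_on (U \<union> V) f"
  using assms unfolding smooth_on_def by (meson UnE continuous_on_open_Un)

text \<open>An auxiliary family that contains the smooth functions and is stable under partial
  derivatives by the chain and product rules, as \<open>smooth_alg_DERIV\<close> shows. Coinduction
  then yields sums, products and scalar compositions in one stroke.\<close>

inductive_set smooth_alg :: "'b::euclidean_space set \<Rightarrow> ('b \<Rightarrow> real) set" for U where
  base: "smooth_on U f \<Longrightarrow> f \<in> smooth_alg U"
| comp: "open V \<Longrightarrow> smooth_on V (k::real \<Rightarrow> real) \<Longrightarrow> smooth_on U f \<Longrightarrow> f ` U \<subseteq> V
    \<Longrightarrow> (\<lambda>x. k (f x)) \<in> smooth_alg U"
| add: "f \<in> smooth_alg U \<Longrightarrow> g \<in> smooth_alg U \<Longrightarrow> (\<lambda>x. f x + g x) \<in> smooth_alg U"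
| mult: "f \<in> smooth_alg U \<Longrightarrow> g \<in> smooth_alg U \<Longrightarrow> (\<lambda>x. f x * g x) \<in> smooth_alg U"

lemma smooth_on_real_DERIV:
  assumes "smooth_on V (k::real \<Rightarrow> real)" "x \<in> V"
  shows "(k has_real_derivative pd 1 k x) (at x)"
  using smooth_on_has_pd[OF assms(1) _ assms(2), of 1]
    DERIV_shift[of k "pd 1 k x" 0 x] by (simp add: add.commute)

lemma smooth_alg_DERIV:
  assumes "g \<in> smooth_alg U" and e: "e \<in> Basis"
  shows "\<exists>h. h \<in> smooth_alg U \<and> (\<forall>x\<in>U. ((\<lambda>s. g (x + s *\<^sub>R e)) has_real_derivative h x) (at 0))"
  using assms(1)
proof induction
  case (base f)
  show ?case
    using smooth_on_has_pd[OF base e] smooth_alg.base[OF smooth_on_pd[OF base e]]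
    by (intro exI[of _ "pd e f"] conjI ballI)
next
  case (comp V k f)
  show ?case
  proof (intro exI conjI ballI)
    show "(\<lambda>x. pd 1 k (f x) * pd e f x) \<in> smooth_alg U"
      by (rule smooth_alg.mult[OF smooth_alg.comp[OF comp(1) smooth_on_pd[OF comp(2)] comp(3,4)]
            smooth_alg.base[OF smooth_on_pd[OF comp(3) e]]]) simp
    fix x assume x: "x \<in> U"
    then have "f x \<in> V" using comp(4) by auto
    then have "(k has_real_derivative pd 1 k (f x)) (at (f (x + 0 *\<^sub>R e)))"
      using smooth_on_real_DERIV[OF comp(2)] by simp
    from DERIV_chain2[OF this smooth_on_has_pd[OF comp(3) e x]]
    show "((\<lambda>s. k (f (x + s *\<^sub>R e))) has_real_derivative pd 1 k (f x) * pd e f x) (at 0)" .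
  qed
next
  case (add f g)
  from add.IH(1) obtain f' where f': "f' \<in> smooth_alg U"
    "\<forall>x\<in>U. ((\<lambda>s. f (x + s *\<^sub>R e)) has_real_derivative f' x) (at 0)" by (elim exE conjE)
  from add.IH(2) obtain g' where g': "g' \<in> smooth_alg U"
    "\<forall>x\<in>U. ((\<lambda>s. g (x + s *\<^sub>R e)) has_real_derivative g' x) (at 0)" by (elim exE conjE)
  show ?case
    using DERIV_add[OF f'(2)[rule_format] g'(2)[rule_format]] smooth_alg.add[OF f'(1) g'(1)]
    by (intro exI[of _ "\<lambda>x. f' x + g' x"] conjI ballI)
next
  case (mult f g)
  from mult.IH(1) obtain f' where f': "f' \<in> smooth_alg U"
    "\<forall>x\<in>U. ((\<lambda>s. f (x + s *\<^sub>R e)) has_real_derivative f' x) (at 0)" by (elim exE conjE)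
  from mult.IH(2) obtain g' where g': "g' \<in> smooth_alg U"
    "\<forall>x\<in>U. ((\<lambda>s. g (x + s *\<^sub>R e)) has_real_derivative g' x) (at 0)" by (elim exE conjE)
  show ?case
  proof (intro exI conjI ballI)
    show "(\<lambda>x. f' x * g x + g' x * f x) \<in> smooth_alg U"
      by (rule smooth_alg.add[OF smooth_alg.mult[OF f'(1) mult(2)] smooth_alg.mult[OF g'(1) mult(1)]])
    fix x assume x: "x \<in> U"
    show "((\<lambda>s. f (x + s *\<^sub>R e) * g (x + s *\<^sub>R e)) has_real_derivative f' x * g x + g' x * f x) (at 0)"
      using DERIV_mult[OF f'(2)[rule_format, OF x] g'(2)[rule_format, OF x]] by simp
  qed
qed

lemma smooth_alg_imp_smooth_on:
  assumes U: "open U" and f: "f \<in> smooth_alg U"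
  shows "smooth_on U f"
proof (rule smooth_on_coinduct[OF U f])
  fix g assume "g \<in> smooth_alg U"
  then show "continuous_on U g"
  proof induction
    case (comp V k f)
    show ?case
      by (rule continuous_on_compose2[OF smooth_on_imp_continuous_on[OF comp(2)]
            smooth_on_imp_continuous_on[OF comp(3)] comp(4)])
  qed (simp_all add: smooth_on_imp_continuous_on continuous_on_add continuous_on_mult)
qed (use smooth_alg_DERIV in \<open>simp add: Bex_def\<close>)

lemma smooth_on_add:
  "open U \<Longrightarrow> smooth_on U f \<Longrightarrow> smooth_on U g \<Longrightarrow> smooth_on U (\<lambda>x. f x + g x)"
  by (rule smooth_alg_imp_smooth_on[OF _ smooth_alg.add[OF smooth_alg.base smooth_alg.base]])

lemma smooth_on_mult:
  "open U \<Longrightarrow> smooth_on U f \<Longrightarrow> smooth_on U g \<Longrightarrow> smooth_on U (\<lambda>x. f x * g x)"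
  by (rule smooth_alg_imp_smooth_on[OF _ smooth_alg.mult[OF smooth_alg.base smooth_alg.base]])

lemma smooth_on_compose:
  "smooth_on V (k::real \<Rightarrow> real) \<Longrightarrow> open U \<Longrightarrow> open V \<Longrightarrow> smooth_on U f \<Longrightarrow>
    (\<And>x. x \<in> U \<Longrightarrow> f x \<in> V) \<Longrightarrow> smooth_on U (\<lambda>x. k (f x))"
  by (rule smooth_alg_imp_smooth_on[OF _ smooth_alg.comp]) auto

lemma smooth_on_const: "open U \<Longrightarrow> smooth_on U (\<lambda>x. c)"
  by (rule smooth_on_coinduct[where S = "range (\<lambda>c x. c)"])
     (auto intro!: derivative_eq_intros)

lemma smooth_on_linear:
  assumes U: "open U" and l: "bounded_linear (l :: 'b::euclidean_space \<Rightarrow> real)"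
  shows "smooth_on U l"
proof (rule smooth_on_coinduct[OF U, where S = "insert l (range (\<lambda>c x. c))"])
  interpret bounded_linear l by fact
  show "continuous_on U g" if "g \<in> insert l (range (\<lambda>c x. c))" for g
    using that linear_continuous_on[OF l] by auto
  show "\<exists>h\<in>insert l (range (\<lambda>c x. c)). \<forall>x\<in>U. ((\<lambda>s. g (x + s *\<^sub>R e)) has_real_derivative h x) (at 0)"
    if "g \<in> insert l (range (\<lambda>c x. c))" for g e
    using that
  proof (rule insertE)
    assume "g = l"
    then show ?thesis
      by (intro bexI[of _ "\<lambda>x. l e"]) (auto simp: add scaleR intro!: derivative_eq_intros)
  next
    assume "g \<in> range (\<lambda>c x. c)"
    then show ?thesis by (intro bexI[of _ "\<lambda>x. 0"]) auto
  qed
qed auto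

lemma smooth_on_minus:
  "open U \<Longrightarrow> smooth_on U f \<Longrightarrow> smooth_on U (\<lambda>x. - f x)"
  using smooth_on_mult[OF _ smooth_on_const[of U "-1"], of f] by simp

lemma smooth_on_diff:
  "open U \<Longrightarrow> smooth_on U f \<Longrightarrow> smooth_on U g \<Longrightarrow> smooth_on U (\<lambda>x. f x - g x)"
  using smooth_on_add[OF _ _ smooth_on_minus[of U g], of f] by simp

lemma smooth_on_sum:
  "open U \<Longrightarrow> (\<And>i. i \<in> I \<Longrightarrow> smooth_on U (f i)) \<Longrightarrow> smooth_on U (\<lambda>x. \<Sum>i\<in>I. f i x)"
  by (induction I rule: infinite_finite_induct) (auto intro: smooth_on_const smooth_on_add)

lemma smooth_on_power:
  "open U \<Longrightarrow> smooth_on U f \<Longrightarrow> smooth_on U (\<lambda>x. f x ^ n)"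
  by (induction n) (auto intro: smooth_on_const smooth_on_mult)

text \<open>Coinduction in one variable, where it suffices to exhibit a small family closed under
  differentiation: \<open>exp\<close> alone, all multiples of real powers, or the functions
  \<open>flat\<close>.\<close>

lemma smooth_on_scalar_family:
  fixes F :: "(real \<Rightarrow> real) set"
  assumes "open V" "k \<in> F"
    and "\<And>f. f \<in> F \<Longrightarrow> \<exists>g\<in>F. \<forall>x\<in>V. (f has_real_derivative g x) (at x)"
  shows "smooth_on V k"
proof (rule smooth_on_coinduct[OF assms(1,2)])
  fix g assume "g \<in> F"
  then show "continuous_on V g"
    using assms(3) by (meson DERIV_isCont continuous_at_imp_continuous_on)
  fix e :: real assume "e \<in> Basis"
  then have "e = 1" by simp
  then show "\<exists>h\<in>F. \<forall>x\<in>V. ((\<lambda>s. g (x + s *\<^sub>R e)) has_real_derivative h x) (at 0)"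
    using assms(3)[OF \<open>g \<in> F\<close>] DERIV_shift[of g _ 0] by (simp add: add.commute)
qed

lemma smooth_on_exp: "smooth_on UNIV (exp::real \<Rightarrow> real)"
  by (rule smooth_on_scalar_family[where F="{exp}"]) (auto intro: DERIV_exp)

lemma smooth_on_powr: "smooth_on {0<..} (\<lambda>x::real. x powr a)"
proof (rule smooth_on_scalar_family[where F="{\<lambda>x. c * x powr b | c b. True}"])
  fix f :: "real \<Rightarrow> real" assume "f \<in> {\<lambda>x. c * x powr b | c b. True}"
  then obtain c b where f: "f = (\<lambda>x. c * x powr b)" by auto
  have "(f has_real_derivative (c * b) * x powr (b - 1)) (at x)" if "x > 0" for x
    unfolding f using that by (auto intro!: derivative_eq_intros simp: powr_diff)
  then show "\<exists>g\<in>{\<lambda>x. c * x powr b |c b. True}. \<forall>x\<in>{0<..}. (f has_real_derivative g x) (at x)"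
    by (intro bexI[of _ "\<lambda>x. (c*b) * x powr (b-1)"]) auto
next
  show "(\<lambda>x. x powr a) \<in> {\<lambda>x. c * x powr b | c b. True}"
    by (rule CollectI, rule exI[of _ 1], rule exI[of _ a]) simp
qed simp

lemma smooth_on_inverse: "smooth_on {0<..} (inverse :: real \<Rightarrow> real)"
  by (rule smooth_on_cong[OF _ smooth_on_powr[of "-1"]]) (auto simp: powr_minus)

text \<open>Differentiation under the integral sign reproduces the same form with \<open>k\<close>
  replaced by its partial derivative, so the integrals of smooth kernels over the fixed box are the
  coinduction set. The factor \<open>f\<close> does not involve the parameter and may be merely
  continuous.\<close>

lemma smooth_on_integral_param:
  fixes k :: "'b::euclidean_space \<times> 'c::euclidean_space \<Rightarrow> real" and f :: "'c \<Rightarrow> real"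
  assumes U: "open U" and f: "continuous_on (cbox a b) f" and k: "smooth_on (U \<times> UNIV) k"
  shows "smooth_on U (\<lambda>p. integral (cbox a b) (\<lambda>z. f z * k (p, z)))"
    and "e \<in> Basis \<Longrightarrow> p \<in> U \<Longrightarrow> ((\<lambda>s. integral (cbox a b) (\<lambda>z. f z * k (p + s *\<^sub>R e, z)))
      has_real_derivative integral (cbox a b) (\<lambda>z. f z * pd (e, 0) k (p, z))) (at 0)"
proof -
  let ?I = "\<lambda>k p. integral (cbox a b) (\<lambda>z. f z * k (p, z))"
  have cont2: "continuous_on (U \<times> cbox a b) (\<lambda>(p, z). f z * k (p, z))"
    if k: "smooth_on (U \<times> UNIV) k" for k
    using smooth_on_imp_continuous_on[OF k] f
    by (auto simp: split_beta intro!: continuous_intros continuous_on_compose2[OF f]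
        elim: continuous_on_subset)
  have der: "((\<lambda>s. ?I k (p + s *\<^sub>R e)) has_real_derivative ?I (pd (e,0) k) p) (at 0)"
    if k: "smooth_on (U \<times> UNIV) k" and e: "e \<in> Basis" and p: "p \<in> U" for k e p
  proof -
    have e0: "(e, 0) \<in> Basis" using e by (auto simp: Basis_prod_def)
    \<comment> \<open>Basis vectors have norm one, so the line through \<open>p\<close> stays in
      \<open>U\<close> for parameters in (-d, d); the Leibniz rule is applied on this open
      interval.\<close>
    obtain d where d: "d > 0" "ball p d \<subseteq> U" using U p openE by blast
    have ne: "norm e = 1" using e by simp
    have inU: "p + s *\<^sub>R e \<in> U" if "s \<in> {-d<..<d}" for s
      using that d(2) ne by (auto simp: dist_norm subset_iff)
    have inner: "((\<lambda>s. f z * k (p + s *\<^sub>R e, z)) has_real_derivative f z * pd (e,0) k (p + s *\<^sub>R e, z))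
        (at s within {-d<..<d})" if s: "s \<in> {-d<..<d}" for s z
    proof -
      have "((\<lambda>r. k ((p + s *\<^sub>R e, z) + r *\<^sub>R (e,0))) has_real_derivative pd (e,0) k (p + s *\<^sub>R e, z)) (at 0)"
        by (rule smooth_on_has_pd[OF k e0]) (simp add: inU[OF s])
      then have "((\<lambda>r. k (p + (r + s) *\<^sub>R e, z)) has_real_derivative pd (e,0) k (p + s *\<^sub>R e, z)) (at 0)"
        by (simp add: algebra_simps)
      then have "((\<lambda>r. k (p + r *\<^sub>R e, z)) has_real_derivative pd (e,0) k (p + s *\<^sub>R e, z)) (at s)"
        using DERIV_shift[of "\<lambda>r. k (p + r *\<^sub>R e, z)" _ 0 s] by simp
      from DERIV_cmult[OF this, of "f z"] show ?thesis
        by (rule has_field_derivative_at_within)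
    qed
    have cs: "continuous_on ({-d<..<d} \<times> cbox a b) (\<lambda>(s, z). f z * g (p + s *\<^sub>R e, z))"
      if g: "smooth_on (U \<times> UNIV) g" for g
    proof -
      have "continuous_on ({-d<..<d} \<times> cbox a b) (\<lambda>w. (\<lambda>(p, z). f z * g (p, z)) (p + fst w *\<^sub>R e, snd w))"
        by (rule continuous_on_compose2[OF cont2[OF g]]) (auto intro!: continuous_intros inU)
      then show ?thesis by (simp add: split_beta)
    qed
    have "((\<lambda>s. integral (cbox a b) (\<lambda>z. f z * k (p + s *\<^sub>R e, z))) has_real_derivative
      integral (cbox a b) (\<lambda>z. f z * pd (e,0) k (p + 0 *\<^sub>R e, z))) (at 0 within {-d<..<d})"
    proof (rule leibniz_rule_field_derivative)
      show "(\<lambda>z. f z * k (p + s *\<^sub>R e, z)) integrable_on cbox a b" if "s \<in> {-d<..<d}" for s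
      proof (rule integrable_continuous)
        have "continuous_on (cbox a b) (\<lambda>w. (\<lambda>(p, z). f z * k (p, z)) (p + s *\<^sub>R e, w))"
          by (rule continuous_on_compose2[OF cont2[OF k]]) (auto intro!: continuous_intros inU that)
        then show "continuous_on (cbox a b) (\<lambda>z. f z * k (p + s *\<^sub>R e, z))" by simp
      qed
      show "continuous_on ({-d<..<d} \<times> cbox a b) (\<lambda>(s, z). f z * pd (e,0) k (p + s *\<^sub>R e, z))"
        by (rule cs[OF smooth_on_pd[OF k e0]])
    qed (use inner d in auto)
    moreover have "at (0::real) within {-d<..<d} = at 0"
      by (rule at_within_open) (use d in auto)
    ultimately show ?thesis by (simp only: scaleR_zero_left add_0_right)
  qed
  show "smooth_on U (?I k)"
  proof (rule smooth_on_coinduct[OF U, where S = "?I ` {k. smooth_on (U \<times> UNIV) k}"])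
    show "?I k \<in> ?I ` {k. smooth_on (U \<times> UNIV) k}" using k by blast
  next
    fix g assume "g \<in> ?I ` {k. smooth_on (U \<times> UNIV) k}"
    then show "continuous_on U g"
      using integral_continuous_on_param[OF cont2] by auto
  next
    fix g and e :: 'b assume "g \<in> ?I ` {k. smooth_on (U \<times> UNIV) k}" and e: "e \<in> Basis"
    then obtain k where k: "smooth_on (U \<times> UNIV) k" "g = ?I k" by auto
    have "(e, 0) \<in> (Basis :: ('b \<times> 'c) set)" using e by (auto simp: Basis_prod_def)
    then show "\<exists>h\<in>?I ` {k. smooth_on (U \<times> UNIV) k}.
        \<forall>x\<in>U. ((\<lambda>s. g (x + s *\<^sub>R e)) has_real_derivative h x) (at 0)"
      using der[OF k(1) e] k(2) smooth_on_pd[OF k(1)] by (intro bexI[of _ "?I (pd (e,0) k)"]) auto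
  qed
  show "e \<in> Basis \<Longrightarrow> p \<in> U \<Longrightarrow> ((\<lambda>s. ?I k (p + s *\<^sub>R e)) has_real_derivative ?I (pd (e,0) k) p) (at 0)"
    by (rule der[OF k])
qed

lemma smooth_on_fst:
  fixes g :: "'b::euclidean_space \<Rightarrow> real"
  assumes U: "open U" and g: "smooth_on U g"
  shows "smooth_on (U \<times> (UNIV :: 'c::euclidean_space set)) (\<lambda>w. g (fst w))"
proof (rule smooth_on_coinduct[where S = "{\<lambda>w. g (fst w) | g. smooth_on U g}"])
  fix k :: "'b \<times> 'c \<Rightarrow> real" assume "k \<in> {\<lambda>w. g (fst w) | g. smooth_on U g}"
  then obtain g where g: "smooth_on U g" "k = (\<lambda>w. g (fst w))" by auto
  show "continuous_on (U \<times> UNIV) k" unfolding g(2)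
    by (rule continuous_on_compose2[OF smooth_on_imp_continuous_on[OF g(1)]]) (auto intro: continuous_intros)
  fix e :: "'b \<times> 'c" assume "e \<in> Basis"
  then consider b where "b \<in> Basis" "e = (b, 0)" | b where "e = (0, b)"
    by (auto simp: Basis_prod_def)
  then show "\<exists>h\<in>{\<lambda>w. g (fst w) | g. smooth_on U g}.
      \<forall>x\<in>U \<times> UNIV. ((\<lambda>s. k (x + s *\<^sub>R e)) has_real_derivative h x) (at 0)"
  proof cases
    case (1 b)
    have "\<forall>x\<in>U \<times> UNIV. ((\<lambda>s. k (x + s *\<^sub>R e)) has_real_derivative pd b g (fst x)) (at 0)"
      using smooth_on_has_pd[OF g(1) 1(1)] by (auto simp: g(2) 1(2))
    then show ?thesis using smooth_on_pd[OF g(1) 1(1)]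
      by (intro bexI[of _ "\<lambda>w. pd b g (fst w)"] CollectI exI[of _ "pd b g"]) simp_all
  next
    case (2 b)
    have "smooth_on U (\<lambda>_. 0)" using U by (rule smooth_on_const)
    then show ?thesis
      by (intro bexI[of _ "\<lambda>w. (\<lambda>_. 0) (fst w)"]) (auto simp: g(2) 2)
  qed
qed (use g U in \<open>auto intro: open_Times\<close>)

section \<open>Smooth steps and cutoffs\<close>

text \<open>For \<open>p = 1\<close> this is the classical function exp(-1/x), extended by 0. The
  polynomial in y = 1/x makes the family closed under differentiation: the derivative replaces p by
  y^2 (p - p').\<close>

definition flat :: "real poly \<Rightarrow> real \<Rightarrow> real" where
  "flat p x = (if x > 0 then poly p (inverse x) * exp (- inverse x) else 0)"

lemma flat_tendsto_0: "(flat p \<longlongrightarrow> 0) (at_right 0)"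
proof -
  have "((\<lambda>y. \<Sum>i\<le>degree p. coeff p i * (y ^ i / exp y)) \<longlongrightarrow> (\<Sum>i\<le>degree p. coeff p i * 0)) at_top"
    by (intro tendsto_sum tendsto_mult tendsto_const tendsto_power_div_exp_0)
  then have "((\<lambda>y. poly p y * exp (- y)) \<longlongrightarrow> 0) at_top"
    by (simp add: poly_altdef sum_distrib_right exp_minus divide_inverse mult.assoc)
  from filterlim_compose[OF this filterlim_inverse_at_top_right]
  have "((\<lambda>x. poly p (inverse x) * exp (- inverse x)) \<longlongrightarrow> 0) (at_right 0)" .
  then show ?thesis
    by (rule Lim_transform_eventually) (auto simp: flat_def eventually_at_filter)
qed

lemma flat_has_derivative:
  "(flat p has_real_derivative flat ([:0, 0, 1:] * (p - pderiv p)) x) (at x)"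
proof (cases x "0::real" rule: linorder_cases)
  case less
  have "((\<lambda>_. 0) has_real_derivative 0) (at x)" by simp
  then show ?thesis using less
    by (rule_tac has_field_derivative_transform_within_open[where S="{..<0}"])
       (auto simp: flat_def)
next
  case greater
  have "((\<lambda>x. poly p (inverse x) * exp (- inverse x)) has_real_derivative
      flat ([:0, 0, 1:] * (p - pderiv p)) x) (at x)"
    using greater
    by (auto intro!: derivative_eq_intros simp: flat_def field_simps power2_eq_square)
  then show ?thesis using greater
    by (rule_tac has_field_derivative_transform_within_open[where S="{0<..}"])
       (auto simp: flat_def)
next
  case equal
  \<comment> \<open>Dividing by \<open>h\<close> multiplies the polynomial in 1/h by its variable,
    which is \<open>pCons 0 p\<close>; the difference quotient at 0 is thus again a member of the
    family.\<close>
  have "((\<lambda>h. flat p h / h) \<longlongrightarrow> 0) (at_right 0)"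
    using flat_tendsto_0[of "pCons 0 p"]
    by (rule Lim_transform_eventually) (auto simp: flat_def eventually_at_filter divide_inverse)
  moreover have "((\<lambda>h. flat p h / h) \<longlongrightarrow> 0) (at_left 0)"
    by (rule Lim_transform_eventually[OF tendsto_const]) (auto simp: flat_def eventually_at_filter)
  ultimately have "((\<lambda>h. flat p h / h) \<longlongrightarrow> 0) (at 0)"
    by (simp add: filterlim_split_at)
  then show ?thesis unfolding equal DERIV_def by (simp add: flat_def)
qed

lemma smooth_flat: "smooth_on UNIV (flat p)"
  by (rule smooth_on_scalar_family[where F="range flat"]) (auto intro: flat_has_derivative)

definition smooth_step :: "real \<Rightarrow> real" where
  "smooth_step x = flat 1 x / (flat 1 x + flat 1 (1 - x))"

lemma flat_1_nonneg: "flat 1 x \<ge> 0" and flat_1_pos: "x > 0 \<Longrightarrow> flat 1 x > 0"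
  by (auto simp: flat_def)

text \<open>At least one of x and 1 - x is positive; this makes the quotient in
  \<open>smooth_step\<close> smooth on the whole line.\<close>

lemma flat_1_sum_pos: "flat 1 x + flat 1 (1 - x) > 0"
  using flat_1_nonneg[of x] flat_1_nonneg[of "1 - x"] flat_1_pos[of x] flat_1_pos[of "1 - x"]
  by (cases "x > 0") auto

lemma smooth_on_smooth_step: "smooth_on UNIV smooth_step"
proof -
  have r: "smooth_on UNIV (\<lambda>x::real. flat 1 (1 - x))"
    by (rule smooth_on_compose[OF smooth_flat])
       (auto intro!: smooth_on_diff[OF _ smooth_on_const smooth_on_linear[OF _ bounded_linear_ident]])
  have "smooth_on UNIV (\<lambda>x. inverse (flat 1 x + flat 1 (1 - x)))"
    by (rule smooth_on_compose[OF smooth_on_inverse])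
       (auto intro!: smooth_on_add smooth_flat r flat_1_sum_pos)
  from smooth_on_mult[OF _ smooth_flat this] show ?thesis
    unfolding smooth_step_def divide_inverse by auto
qed

lemma smooth_step_bounds: "0 \<le> smooth_step x" "smooth_step x \<le> 1"
  using flat_1_sum_pos[of x] flat_1_nonneg[of x] flat_1_nonneg[of "1-x"]
  by (auto simp: smooth_step_def)

lemma smooth_step_0: "x \<le> 0 \<Longrightarrow> smooth_step x = 0"
  by (simp add: smooth_step_def flat_def)

lemma smooth_step_1: "x \<ge> 1 \<Longrightarrow> smooth_step x = 1"
  using flat_1_sum_pos[of x] by (simp add: smooth_step_def flat_def)

text \<open>Constancy on the open half-lines makes the derivative vanish there, and continuity of
  the derivative adds the end points 0 and 1.\<close>

lemma pd_eq_0_outside: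
  fixes f :: "real \<Rightarrow> real"
  assumes f: "smooth_on UNIV f" and l: "\<And>x. x < 0 \<Longrightarrow> f x = c" and r: "\<And>x. x > 1 \<Longrightarrow> f x = d"
    and x: "x \<le> 0 \<or> x \<ge> 1"
  shows "pd 1 f x = 0"
proof -
  have *: "pd 1 f x = 0" if "open U" "x \<in> U" "\<And>x. x \<in> U \<Longrightarrow> f x = c" for U x c
    using pd_cong[OF that(1,2), of f "\<lambda>_. c" 1] pd_eqI[of "\<lambda>_. c" x 1 0] that(3) by simp
  have "closed {x. pd 1 f x = 0}"
    using smooth_on_imp_continuous_on[OF smooth_on_pd[OF f, of 1]]
    by (intro closed_Collect_eq) auto
  moreover have "{..<0} \<subseteq> {x. pd 1 f x = 0}" "{1<..} \<subseteq> {x. pd 1 f x = 0}"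
    using *[of "{..<0}" _ c] *[of "{1<..}" _ d] l r by auto
  ultimately have "closure {..<0} \<subseteq> {x. pd 1 f x = 0}" "closure {1<..} \<subseteq> {x. pd 1 f x = 0}"
    by (metis closure_minimal)+
  then show ?thesis using x by (auto simp: closure_lessThan closure_greaterThan)
qed

lemma bounded_if_eq_0_outside:
  fixes f :: "real \<Rightarrow> real"
  assumes f: "smooth_on UNIV f" and "\<And>x. x \<le> 0 \<or> x \<ge> 1 \<Longrightarrow> f x = 0"
  shows "\<exists>M. \<forall>x. \<bar>f x\<bar> \<le> M"
proof -
  have "compact (f ` {0..1})"
    using smooth_on_imp_continuous_on[OF f] 
    by (intro compact_continuous_image) (auto intro: continuous_on_subset)
  then obtain M where "\<forall>x\<in>{0..1}. \<bar>f x\<bar> \<le> M"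
    by (auto dest!: compact_imp_bounded simp: bounded_iff)
  then have M: "\<And>x. x \<in> {0..1} \<Longrightarrow> \<bar>f x\<bar> \<le> M" by blast
  from M[of 0] have "M \<ge> 0" by auto
  then have "\<bar>f x\<bar> \<le> M" for x using M[of x] assms(2)[of x] by (cases "x \<in> {0..1}") auto
  then show ?thesis by blast
qed

definition smooth_step' :: "real \<Rightarrow> real" where "smooth_step' = pd 1 smooth_step"
definition smooth_step'' :: "real \<Rightarrow> real" where "smooth_step'' = pd 1 smooth_step'"

lemma smooth_on_smooth_step': "smooth_on UNIV smooth_step'"
  unfolding smooth_step'_def by (rule smooth_on_pd[OF smooth_on_smooth_step]) simp

lemma smooth_on_smooth_step'': "smooth_on UNIV smooth_step''"
  unfolding smooth_step''_def by (rule smooth_on_pd[OF smooth_on_smooth_step']) simp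

lemma DERIV_smooth_step: "(smooth_step has_real_derivative smooth_step' x) (at x)"
  unfolding smooth_step'_def by (rule smooth_on_real_DERIV[OF smooth_on_smooth_step]) simp

lemma DERIV_smooth_step': "(smooth_step' has_real_derivative smooth_step'' x) (at x)"
  unfolding smooth_step''_def by (rule smooth_on_real_DERIV[OF smooth_on_smooth_step']) simp

lemma smooth_step'_0: "x \<le> 0 \<or> x \<ge> 1 \<Longrightarrow> smooth_step' x = 0"
  unfolding smooth_step'_def
  by (rule pd_eq_0_outside[OF smooth_on_smooth_step]) (auto simp: smooth_step_0 smooth_step_1)

lemma smooth_step''_0: "x \<le> 0 \<or> x \<ge> 1 \<Longrightarrow> smooth_step'' x = 0"
  unfolding smooth_step''_def
  by (rule pd_eq_0_outside[OF smooth_on_smooth_step']) (auto simp: smooth_step'_0)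

lemma smooth_step_derivs_bounded:
  obtains M where "M \<ge> 0" "\<And>x. \<bar>smooth_step' x\<bar> \<le> M" "\<And>x. \<bar>smooth_step'' x\<bar> \<le> M"
proof -
  obtain M1 where M1: "\<And>x. \<bar>smooth_step' x\<bar> \<le> M1"
    using bounded_if_eq_0_outside[OF smooth_on_smooth_step' smooth_step'_0] by blast
  obtain M2 where M2: "\<And>x. \<bar>smooth_step'' x\<bar> \<le> M2"
    using bounded_if_eq_0_outside[OF smooth_on_smooth_step'' smooth_step''_0] by blast
  show thesis
  proof
    show "max M1 M2 \<ge> 0" using M1[of 0] by linarith
    show "\<bar>smooth_step' x\<bar> \<le> max M1 M2" "\<bar>smooth_step'' x\<bar> \<le> max M1 M2" for x
      using M1[of x] M2[of x] by auto
  qed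
qed

section \<open>Spatial cutoffs, with derivative bounds uniform in the radius\<close>

definition cutoff :: "real \<Rightarrow> 'b::euclidean_space \<Rightarrow> real" where
  "cutoff n z = 1 - smooth_step ((norm z)\<^sup>2 / n\<^sup>2 - 1)"

lemma cutoff_bounds: "0 \<le> cutoff n z" "cutoff n z \<le> 1"
  using smooth_step_bounds by (auto simp: cutoff_def)

lemma cutoff_1: "n > 0 \<Longrightarrow> norm z \<le> n \<Longrightarrow> cutoff n z = 1"
  by (auto simp: cutoff_def power_mono intro!: smooth_step_0)

lemma cutoff_0: "n > 0 \<Longrightarrow> norm z \<ge> 2 * n \<Longrightarrow> cutoff n z = 0"
proof -
  assume n: "n > 0" "norm z \<ge> 2 * n"
  then have "(norm z)\<^sup>2 \<ge> (2 * n)\<^sup>2" by (intro power_mono) auto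
  moreover have "(2 * n)\<^sup>2 \<ge> 2 * n\<^sup>2" by (simp add: power2_eq_square)
  ultimately have "(norm z)\<^sup>2 \<ge> 2 * n\<^sup>2" by linarith
  then show ?thesis using n by (auto simp: cutoff_def smooth_step_1 field_simps)
qed

lemma eventually_cutoff_1: "eventually (\<lambda>n. cutoff (real n) z = 1) sequentially"
  using eventually_gt_at_top[of "0::nat"] eventually_ge_at_top[of "nat \<lceil>norm z\<rceil>"]
  by eventually_elim (auto intro!: cutoff_1 simp: nat_le_iff ceiling_le_iff)

lemma norm_sq_sum: "(norm (z::'b::euclidean_space))\<^sup>2 = (\<Sum>b\<in>Basis. (z \<bullet> b)\<^sup>2)"
  unfolding power2_norm_eq_inner euclidean_inner[of z z] by (simp add: power2_eq_square)

lemma smooth_on_inner_of_components: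
  fixes L :: "'c::euclidean_space \<Rightarrow> 'b::euclidean_space"
  assumes U: "open U" and L: "\<And>b. b \<in> Basis \<Longrightarrow> smooth_on U (\<lambda>p. L p \<bullet> b)"
  shows "smooth_on U (\<lambda>p. L p \<bullet> h)"
  by (subst euclidean_inner) (intro smooth_on_sum smooth_on_mult smooth_on_const U L)

lemma smooth_on_norm_sq_of_components:
  fixes L :: "'c::euclidean_space \<Rightarrow> 'b::euclidean_space"
  assumes U: "open U" and L: "\<And>b. b \<in> Basis \<Longrightarrow> smooth_on U (\<lambda>p. L p \<bullet> b)"
  shows "smooth_on U (\<lambda>p. (norm (L p))\<^sup>2)"
  unfolding norm_sq_sum by (intro smooth_on_sum smooth_on_power U L)

lemma smooth_on_cutoff:
  fixes L :: "'c::euclidean_space \<Rightarrow> 'b::euclidean_space"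
  assumes U: "open U" and L: "\<And>b. b \<in> Basis \<Longrightarrow> smooth_on U (\<lambda>p. L p \<bullet> b)"
  shows "smooth_on U (\<lambda>p. cutoff n (L p))"
  unfolding cutoff_def divide_inverse
  by (intro smooth_on_diff smooth_on_const U smooth_on_compose[OF smooth_on_smooth_step]
      smooth_on_mult smooth_on_norm_sq_of_components L) auto

lemma smooth_on_cutoff_linear:
  fixes L :: "'c::euclidean_space \<Rightarrow> 'b::euclidean_space"
  assumes "open U" "bounded_linear L"
  shows "smooth_on U (\<lambda>p. cutoff n (L p))"
  by (intro smooth_on_cutoff assms smooth_on_linear bounded_linear_inner_left_comp)

text \<open>\<open>cutoff1\<close> and \<open>cutoff2\<close> are the first and the twice iterated
  derivative of \<open>cutoff n\<close> in the direction \<open>e\<close>; mixed second derivatives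
  do not occur in the generators below. The squared norm in \<open>cutoff\<close> keeps both
  formulas valid at the origin.\<close>

definition cutoff1 :: "real \<Rightarrow> 'b::euclidean_space \<Rightarrow> 'b \<Rightarrow> real" where
  "cutoff1 n z e = - smooth_step' ((norm z)\<^sup>2 / n\<^sup>2 - 1) * (2 * (z \<bullet> e) / n\<^sup>2)"

definition cutoff2 :: "real \<Rightarrow> 'b::euclidean_space \<Rightarrow> 'b \<Rightarrow> real" where
  "cutoff2 n z e = - smooth_step'' ((norm z)\<^sup>2 / n\<^sup>2 - 1) * (2 * (z \<bullet> e) / n\<^sup>2)\<^sup>2
     - smooth_step' ((norm z)\<^sup>2 / n\<^sup>2 - 1) * (2 * (e \<bullet> e) / n\<^sup>2)"

lemma DERIV_norm_sq_line:
  "((\<lambda>s. (norm (z + s *\<^sub>R e))\<^sup>2) has_real_derivative 2 * (z \<bullet> e)) (at 0)"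
proof -
  have "(\<lambda>s. (norm (z + s *\<^sub>R e))\<^sup>2) = (\<lambda>s. (norm z)\<^sup>2 + 2 * s * (z \<bullet> e) + s\<^sup>2 * (norm e)\<^sup>2)"
    unfolding power2_norm_eq_inner
    by (simp add: inner_simps inner_commute[of e z] algebra_simps power2_eq_square)
  then show ?thesis by (auto intro!: derivative_eq_intros)
qed

lemma DERIV_cutoff_arg:
  "((\<lambda>s. (norm (z + s *\<^sub>R e))\<^sup>2 / n\<^sup>2 - 1) has_real_derivative 2 * (z \<bullet> e) / n\<^sup>2) (at 0)"
  using DERIV_diff[OF DERIV_cdivide[OF DERIV_norm_sq_line[of z e], of "n\<^sup>2"] DERIV_const[of 1]]
  by simp

lemma DERIV_cutoff: "((\<lambda>s. cutoff n (z + s *\<^sub>R e)) has_real_derivative cutoff1 n z e) (at 0)"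
proof -
  have "((\<lambda>s. smooth_step ((norm (z + s *\<^sub>R e))\<^sup>2 / n\<^sup>2 - 1)) has_real_derivative
     smooth_step' ((norm z)\<^sup>2 / n\<^sup>2 - 1) * (2 * (z \<bullet> e) / n\<^sup>2)) (at 0)"
    by (rule DERIV_chain2[OF _ DERIV_cutoff_arg]) (simp add: DERIV_smooth_step)
  from DERIV_diff[OF DERIV_const[of 1] this] show ?thesis
    by (simp add: cutoff_def cutoff1_def)
qed

lemma DERIV_cutoff1: "((\<lambda>s. cutoff1 n (z + s *\<^sub>R e) e) has_real_derivative cutoff2 n z e) (at 0)"
proof -
  have "((\<lambda>s. smooth_step' ((norm (z + s *\<^sub>R e))\<^sup>2 / n\<^sup>2 - 1)) has_real_derivative
     smooth_step'' ((norm z)\<^sup>2 / n\<^sup>2 - 1) * (2 * (z \<bullet> e) / n\<^sup>2)) (at 0)"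
    by (rule DERIV_chain2[OF _ DERIV_cutoff_arg]) (simp add: DERIV_smooth_step')
  moreover have "((\<lambda>s. 2 * ((z + s *\<^sub>R e) \<bullet> e) / n\<^sup>2) has_real_derivative 2 * (e \<bullet> e) / n\<^sup>2) (at 0)"
  proof -
    have "(\<lambda>s. 2 * ((z + s *\<^sub>R e) \<bullet> e) / n\<^sup>2) = (\<lambda>s. (2 * (z \<bullet> e) + s * (2 * (e \<bullet> e))) / n\<^sup>2)"
      by (simp add: inner_simps algebra_simps)
    moreover have "((\<lambda>s. 2 * (z \<bullet> e) + s * (2 * (e \<bullet> e))) has_real_derivative 2 * (e \<bullet> e)) (at 0)"
      by (auto intro!: derivative_eq_intros)
    ultimately show ?thesis using DERIV_cdivide by fastforce
  qed
  ultimately have "((\<lambda>s. smooth_step' ((norm (z + s *\<^sub>R e))\<^sup>2 / n\<^sup>2 - 1) * (2 * ((z + s *\<^sub>R e) \<bullet> e) / n\<^sup>2))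
     has_real_derivative smooth_step'' ((norm z)\<^sup>2 / n\<^sup>2 - 1) * (2 * (z \<bullet> e) / n\<^sup>2) * (2 * (z \<bullet> e) / n\<^sup>2)
       + 2 * (e \<bullet> e) / n\<^sup>2 * smooth_step' ((norm z)\<^sup>2 / n\<^sup>2 - 1)) (at 0)"
    using DERIV_mult by fastforce
  note D = DERIV_minus[OF this]
  show ?thesis
    by (rule DERIV_cong[OF D[folded mult_minus_left, folded cutoff1_def]])
       (simp add: cutoff2_def power2_eq_square mult_ac)
qed

lemma cutoff_derivs_0:
  assumes "n > 0" "norm z \<le> n" shows "cutoff1 n z e = 0" "cutoff2 n z e = 0"
proof -
  have "(norm z)\<^sup>2 / n\<^sup>2 - 1 \<le> 0" using assms by (simp add: power_mono)
  then show "cutoff1 n z e = 0" "cutoff2 n z e = 0"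
    by (simp_all add: cutoff1_def cutoff2_def smooth_step'_0 smooth_step''_0)
qed

text \<open>The derivatives of the step vanish unless |z|^2 < 2 n^2, and there the inner derivative
  2 (z . e) / n^2 is bounded. Uniformity in n is what dominated convergence needs; convergence
  itself comes from the derivatives being 0 on the ball of radius n.\<close>

lemma cutoff_derivs_bounded:
  obtains C where "C \<ge> 0"
    "\<And>(n::real) (z::'b::euclidean_space) e. n \<ge> 1 \<Longrightarrow> norm e \<le> 1 \<Longrightarrow> \<bar>cutoff1 n z e\<bar> \<le> C"
    "\<And>(n::real) (z::'b::euclidean_space) e. n \<ge> 1 \<Longrightarrow> norm e \<le> 1 \<Longrightarrow> \<bar>cutoff2 n z e\<bar> \<le> C"
proof -
  obtain M where M: "M \<ge> 0" "\<And>x. \<bar>smooth_step' x\<bar> \<le> M" "\<And>x. \<bar>smooth_step'' x\<bar> \<le> M"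
    by (rule smooth_step_derivs_bounded) blast
  have small: "\<bar>2 * (z \<bullet> e) / n\<^sup>2\<bar> \<le> 4" if "n \<ge> 1" "norm e \<le> 1" "(norm z)\<^sup>2 / n\<^sup>2 - 1 < 1"
    for n and z e :: 'b
  proof -
    from that have "(norm z)\<^sup>2 < 2 * n\<^sup>2" by (simp add: field_simps)
    also have "\<dots> \<le> (2 * n)\<^sup>2" by (simp add: power2_eq_square)
    finally have "(norm z)\<^sup>2 < (2 * n)\<^sup>2" .
    from power2_less_imp_less[OF this] have z: "norm z \<le> 2 * n" using that(1) by simp
    have "\<bar>z \<bullet> e\<bar> \<le> norm z * norm e" by (rule Cauchy_Schwarz_ineq2)
    also have "\<dots> \<le> (2 * n) * 1" using z that by (intro mult_mono) auto
    also have "\<dots> \<le> 2 * n\<^sup>2" using mult_left_mono[OF that(1), of n] that(1)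
      unfolding power2_eq_square by linarith
    finally have "2 * \<bar>z \<bullet> e\<bar> \<le> 4 * n\<^sup>2" by simp
    then show ?thesis using that(1) by (simp add: abs_mult divide_le_eq)
  qed
  show thesis
  proof
    \<comment> \<open>The summand 16 M stems from the square of the inner derivative, which is at
      most 4 in modulus, and 2 M from the derivative 2 (e . e) / n^2 of that factor.\<close>
    show "16 * M + 2 * M \<ge> 0" using M by simp
    fix n :: real and z e :: 'b assume n: "n \<ge> 1" "norm e \<le> 1"
    let ?r = "(norm z)\<^sup>2 / n\<^sup>2 - 1"
    have arith: "\<bar>u\<bar> \<le> M * 16 \<Longrightarrow> \<bar>v\<bar> \<le> M * 2 \<Longrightarrow> \<bar>- u - v\<bar> \<le> 16 * M + 2 * M" for u v
      by linarith
    have n2: "n\<^sup>2 \<ge> 1" using n by simp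
    have "\<bar>smooth_step' ?r * (2 * (z \<bullet> e) / n\<^sup>2)\<bar> \<le> M * 4"
    proof (cases "?r < 1")
      case True
      then show ?thesis using small[OF n True] M(1) M(2)[of ?r]
        unfolding abs_mult[of "smooth_step' ?r"] by (intro mult_mono) auto
    qed (use M smooth_step'_0 in auto)
    then show "\<bar>cutoff1 n z e\<bar> \<le> 16 * M + 2 * M"
      unfolding cutoff1_def using M(1) by (simp add: abs_mult)
    have "\<bar>smooth_step'' ?r * (2 * (z \<bullet> e) / n\<^sup>2)\<^sup>2\<bar> \<le> M * 16"
    proof (cases "?r < 1")
      case True
      have "\<bar>2 * (z \<bullet> e) / n\<^sup>2\<bar>\<^sup>2 \<le> 4\<^sup>2"
        by (intro power_mono small[OF n True]) simp
      then have "(2 * (z \<bullet> e) / n\<^sup>2)\<^sup>2 \<le> 16"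
        unfolding power2_abs by simp
      then show ?thesis using M(1) M(3)[of ?r]
        unfolding abs_mult[of "smooth_step'' ?r"] by (intro mult_mono) auto
    qed (use M smooth_step''_0 in auto)
    moreover have "\<bar>smooth_step' ?r * (2 * (e \<bullet> e) / n\<^sup>2)\<bar> \<le> M * 2"
    proof -
      have "(norm e)\<^sup>2 \<le> 1" using n(2) by (simp add: power_le_one)
      then have "\<bar>2 * (e \<bullet> e) / n\<^sup>2\<bar> \<le> 2" using n2
        by (simp add: power2_norm_eq_inner[symmetric] divide_le_eq)
      then show ?thesis using M(1) M(2)[of ?r]
        unfolding abs_mult[of "smooth_step' ?r"] by (intro mult_mono) auto
    qed
    ultimately show "\<bar>cutoff2 n z e\<bar> \<le> 16 * M + 2 * M"
      unfolding cutoff2_def mult_minus_left by (rule arith)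
  qed
qed

section \<open>The heat kernel\<close>

text \<open>The heat kernel at time \<tau>, written as a product of centred normal densities of
  variance 2 \<tau> so that its mass factorises over the coordinates; \<open>hk_eq\<close> supplies
  the closed form for differentiation.\<close>

definition hk :: "real \<Rightarrow> 'a::euclidean_space \<Rightarrow> real" where
  "hk \<tau> y = (\<Prod>b\<in>Basis. normal_density 0 (sqrt (2 * \<tau>)) (y \<bullet> b))"

definition hk1 :: "real \<Rightarrow> 'a::euclidean_space \<Rightarrow> 'a \<Rightarrow> real" where
  "hk1 \<tau> y h = - (y \<bullet> h) / (2 * \<tau>) * hk \<tau> y"

definition hk2 :: "real \<Rightarrow> 'a::euclidean_space \<Rightarrow> 'a \<Rightarrow> 'a \<Rightarrow> real" where
  "hk2 \<tau> y h k = ((y \<bullet> h) * (y \<bullet> k) / (4 * \<tau>\<^sup>2) - (h \<bullet> k) / (2 * \<tau>)) * hk \<tau> y"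

text \<open>The time derivative of \<open>hk\<close>. It is at the same time the trace of
  \<open>hk2\<close>, and this pointwise heat equation is what \<open>trace_Y\<close>
  exploits.\<close>

definition hkT :: "real \<Rightarrow> 'a::euclidean_space \<Rightarrow> real" where
  "hkT \<tau> y = ((norm y)\<^sup>2 / (4 * \<tau>\<^sup>2) - DIM('a) / (2 * \<tau>)) * hk \<tau> y"

lemma hk_eq:
  assumes "\<tau> > 0"
  shows "hk \<tau> (y::'a::euclidean_space) =
    (4 * pi * \<tau>) powr (- (DIM('a) / 2)) * exp (- ((norm y)\<^sup>2 * inverse (4 * \<tau>)))"
proof -
  have "normal_density 0 (sqrt (2 * \<tau>)) x = 1 / sqrt (4 * pi * \<tau>) * exp (- x\<^sup>2 / (4 * \<tau>))" for x
    using assms by (simp add: normal_density_def mult_ac)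
  then have "hk \<tau> y = (\<Prod>b\<in>(Basis::'a set). 1 / sqrt (4 * pi * \<tau>)) * (\<Prod>b\<in>Basis. exp (- (y \<bullet> b)\<^sup>2 / (4 * \<tau>)))"
    by (simp only: hk_def prod.distrib)
  also have "(\<Prod>b\<in>Basis. exp (- (y \<bullet> b)\<^sup>2 / (4 * \<tau>))) = exp (- ((norm y)\<^sup>2 * inverse (4 * \<tau>)))"
  proof -
    have "- ((norm y)\<^sup>2 * inverse (4 * \<tau>)) = (\<Sum>b\<in>Basis. - (y \<bullet> b)\<^sup>2 / (4 * \<tau>))"
      by (simp only: norm_sq_sum sum_negf[symmetric] sum_distrib_right divide_inverse mult_minus_left)
    then show ?thesis by (simp only: exp_sum[OF finite_Basis])
  qed
  also have "(\<Prod>b\<in>(Basis::'a set). 1 / sqrt (4 * pi * \<tau>)) = (4 * pi * \<tau>) powr (- (DIM('a) / 2))"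
  proof -
    have *: "1 / sqrt x = x powr (- (1 / 2))" if "x > 0" for x
      unfolding powr_minus by (subst powr_half_sqrt) (use that in \<open>auto simp: divide_inverse\<close>)
    have "(1 / sqrt x) ^ n = x powr (- (n / 2))" if "x > 0" for x n
      using powr_realpow[of "x powr (- (1 / 2))" n] that *[OF that] powr_powr[of x "- (1 / 2)" "real n"]
      by simp
    from this[of "4 * pi * \<tau>" "DIM('a)"] show ?thesis
      using assms by (simp only: prod_constant) simp
  qed
  finally show ?thesis .
qed

lemma hk_pos: "\<tau> > 0 \<Longrightarrow> hk \<tau> y > 0"
  by (simp add: hk_eq)

lemma continuous_on_hk:
  assumes "\<tau> > 0" shows "continuous_on S (hk \<tau> :: 'a::euclidean_space \<Rightarrow> real)"
proof -
  have "hk \<tau> = (\<lambda>y::'a. (4 * pi * \<tau>) powr (- (DIM('a) / 2)) * exp (- ((norm y)\<^sup>2 * inverse (4 * \<tau>))))"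
    using assms by (intro ext hk_eq)
  then show ?thesis by (simp only:) (intro continuous_intros)
qed

lemma borel_measurable_hk [measurable]: "\<tau> > 0 \<Longrightarrow> hk \<tau> \<in> borel_measurable borel"
  by (intro borel_measurable_continuous_onI continuous_on_hk)

lemma has_bochner_integral_hk:
  fixes y :: "'a::euclidean_space"
  assumes t: "\<tau> > 0"
  shows "has_bochner_integral lborel (\<lambda>z. hk \<tau> (y - z)) 1"
proof (rule has_bochner_integral_nn_integral)
  have 1: "(\<integral>\<^sup>+x. ennreal (normal_density m (sqrt (2 * \<tau>)) x) \<partial>lborel) = 1" for m
    using t by (subst nn_integral_eq_integral[OF integrable_normal_density]) (auto simp: integral_normal_density)
  have "hk \<tau> (y - z) = (\<Prod>b\<in>Basis. normal_density (y \<bullet> b) (sqrt (2 * \<tau>)) (z \<bullet> b))" for z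
    by (simp add: hk_def normal_density_def inner_simps power2_commute)
  then have "(\<integral>\<^sup>+z. ennreal (hk \<tau> (y - z)) \<partial>lborel) =
      (\<integral>\<^sup>+z. (\<Prod>b\<in>Basis. ennreal (normal_density (y \<bullet> b) (sqrt (2 * \<tau>)) (z \<bullet> b))) \<partial>lborel)"
    using t by (simp add: prod_ennreal normal_density_nonneg)
  also have "\<dots> = 1"
    by (subst nn_integral_lborel_prod) (auto simp: 1)
  finally show "(\<integral>\<^sup>+z. ennreal (hk \<tau> (y - z)) \<partial>lborel) = ennreal 1" by simp
  have "hk \<tau> \<in> borel_measurable borel" using t by (rule borel_measurable_hk)
  then show "(\<lambda>z. hk \<tau> (y - z)) \<in> borel_measurable lborel" by measurable
qed (use hk_pos[OF t] in \<open>auto intro!: AE_I2 less_imp_le\<close>)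

text \<open>As the heat kernel has mass one, every estimate on the flow or its derivatives reduces
  to a pointwise comparison of kernels. The comparison kernel may be taken at a time other than that
  of the flow.\<close>

lemma integral_hk_bound:
  fixes y :: "'a::euclidean_space"
  assumes t: "\<tau> > 0" and k: "continuous_on (cbox a b) k" and c: "c \<ge> 0"
    and bd: "\<And>z. z \<in> cbox a b \<Longrightarrow> \<bar>k z\<bar> \<le> c * hk \<tau> (y - z)"
  shows "\<bar>integral (cbox a b) k\<bar> \<le> c"
proof -
  have i: "integrable lborel (\<lambda>z. hk \<tau> (y - z))" and i1: "(\<integral>z. hk \<tau> (y - z) \<partial>lborel) = 1"
    using has_bochner_integral_hk[OF t, of y] by (auto simp: has_bochner_integral_iff)
  have si: "set_integrable lborel (cbox a b) (\<lambda>z. hk \<tau> (y - z))"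
    unfolding set_integrable_def by (rule integrable_mult_indicator[OF _ i]) simp
  have "\<bar>integral (cbox a b) k\<bar> \<le> integral (cbox a b) (\<lambda>z. c * hk \<tau> (y - z))"
    using integral_norm_bound_integral[OF integrable_continuous[OF k], of "\<lambda>z. c * hk \<tau> (y - z)"] bd
      integrable_on_mult_right[OF set_borel_integral_eq_integral(1)[OF si], of c] by auto
  also have "\<dots> = c * (LINT z:cbox a b|lborel. hk \<tau> (y - z))"
    by (simp add: set_borel_integral_eq_integral(2)[OF si])
  also have "(LINT z:cbox a b|lborel. hk \<tau> (y - z)) \<le> (\<integral>z. hk \<tau> (y - z) \<partial>lborel)"
    unfolding set_lebesgue_integral_def
    by (rule integral_mono[OF si[unfolded set_integrable_def] i])
       (auto simp: indicator_def less_imp_le hk_pos[OF t])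
  finally show ?thesis using c i1 by (simp add: mult_left_le mult_left_mono)
qed

definition hkC :: "'a::euclidean_space itself \<Rightarrow> real" where
  "hkC _ = 2 powr (DIM('a) / 2)"

lemma hkC_pos: "hkC TYPE('a::euclidean_space) > 0"
  by (simp add: hkC_def)

text \<open>Half of the Gaussian exponent belongs to the kernel at twice the time; the other half is
  kept to absorb polynomial factors. The constant \<open>hkC\<close> compensates for the changed
  normalisation.\<close>

lemma hk_double:
  assumes t: "\<tau> > 0"
  shows "hk \<tau> (w::'a::euclidean_space) =
    hkC TYPE('a) * exp (- ((norm w)\<^sup>2 / (8 * \<tau>))) * hk (2 * \<tau>) w"
proof -
  have "4 * pi * (2 * \<tau>) = 2 * (4 * pi * \<tau>)" by simp
  then have "(4 * pi * (2 * \<tau>)) powr (- (DIM('a) / 2)) = 2 powr (- (DIM('a)/2)) * (4 * pi * \<tau>) powr (- (DIM('a) / 2))"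
    using t by (simp only: powr_mult)
  moreover have "hkC TYPE('a) * 2 powr (- (DIM('a)/2)) = 1"
    by (simp add: hkC_def powr_add[symmetric])
  moreover have "exp (- ((norm w)\<^sup>2 * inverse (4 * \<tau>))) =
      exp (- ((norm w)\<^sup>2 / (8 * \<tau>))) * exp (- ((norm w)\<^sup>2 * inverse (4 * (2 * \<tau>))))"
    using t by (simp add: exp_add[symmetric] field_simps)
  ultimately show ?thesis
    using t by (simp add: hk_eq mult_ac)
qed

text \<open>With u = |w| / sqrt (8 \<tau>) the three claims amount to u^k exp(-u^2) <= 1 for k = 0,
  1, 2, each a consequence of 1 + x <= exp x.\<close>

lemma hk_bounds:
  assumes t: "\<tau> > 0"
  shows "hk \<tau> (w::'a::euclidean_space) \<le> hkC TYPE('a) * hk (2 * \<tau>) w"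
    and "norm w * hk \<tau> w \<le> sqrt (8 * \<tau>) * hkC TYPE('a) * hk (2 * \<tau>) w"
    and "(norm w)\<^sup>2 * hk \<tau> w \<le> 8 * \<tau> * hkC TYPE('a) * hk (2 * \<tau>) w"
proof -
  let ?u = "norm w / sqrt (8 * \<tau>)"
  have u2: "?u\<^sup>2 = (norm w)\<^sup>2 / (8 * \<tau>)" using t by (simp add: power_divide)
  have e: "exp (- ?u\<^sup>2) \<le> 1" by simp
  have *: "r * exp (- x) \<le> 1" if "r \<le> 1 + x" for r x :: real
    using order_trans[OF that exp_ge_add_one_self[of x]] by (simp add: exp_minus divide_inverse[symmetric])
  have e2: "?u\<^sup>2 * exp (- ?u\<^sup>2) \<le> 1"
    by (rule *) simp
  have "r \<le> 1 + r\<^sup>2" for r :: real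
    using sum_squares_bound[of 1 r] zero_le_power2[of r]
    unfolding one_power2 by (cases "r \<ge> 0") linarith+
  then have e1: "?u * exp (- ?u\<^sup>2) \<le> 1"
    by (rule *)
  have pos: "hkC TYPE('a) * hk (2 * \<tau>) w \<ge> 0"
    using hkC_pos[where 'a='a] hk_pos[of "2*\<tau>" w] t by simp
  have d: "hk \<tau> w = exp (- ?u\<^sup>2) * (hkC TYPE('a) * hk (2 * \<tau>) w)"
    unfolding u2 by (subst hk_double[OF t]) simp
  show "hk \<tau> w \<le> hkC TYPE('a) * hk (2 * \<tau>) w"
    unfolding d using mult_right_mono[OF e pos] by simp
  have "norm w * hk \<tau> w = sqrt (8 * \<tau>) * ((?u * exp (- ?u\<^sup>2)) * (hkC TYPE('a) * hk (2 * \<tau>) w))"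
    unfolding d using t by simp
  also have "\<dots> \<le> sqrt (8 * \<tau>) * (1 * (hkC TYPE('a) * hk (2 * \<tau>) w))"
    using t by (intro mult_left_mono mult_right_mono e1 pos) auto
  finally show "norm w * hk \<tau> w \<le> sqrt (8 * \<tau>) * hkC TYPE('a) * hk (2 * \<tau>) w" by simp
  have "(norm w)\<^sup>2 * hk \<tau> w = (8 * \<tau>) * ((?u\<^sup>2 * exp (- ?u\<^sup>2)) * (hkC TYPE('a) * hk (2 * \<tau>) w))"
    unfolding d u2 using t by simp
  also have "\<dots> \<le> (8 * \<tau>) * (1 * (hkC TYPE('a) * hk (2 * \<tau>) w))"
    using t by (intro mult_left_mono mult_right_mono e2 pos) auto
  finally show "(norm w)\<^sup>2 * hk \<tau> w \<le> 8 * \<tau> * hkC TYPE('a) * hk (2 * \<tau>) w" by simp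
qed

lemma DERIV_hk_line:
  fixes y :: "'a::euclidean_space"
  assumes t: "\<tau> > 0"
  shows "((\<lambda>s. hk \<tau> (y + s *\<^sub>R h)) has_real_derivative hk1 \<tau> y h) (at 0)"
proof -
  note D = DERIV_norm_sq_line[of y h]
  have "((\<lambda>s. exp (- ((norm (y + s *\<^sub>R h))\<^sup>2 * inverse (4 * \<tau>)))) has_real_derivative
      exp (- ((norm y)\<^sup>2 * inverse (4 * \<tau>))) * (- (2 * (y \<bullet> h) * inverse (4 * \<tau>)))) (at 0)"
    using DERIV_chain2[OF DERIV_exp DERIV_minus[OF DERIV_cmult_right[OF D, of "inverse (4 * \<tau>)"]]] by simp
  from DERIV_cmult[OF this, of "(4 * pi * \<tau>) powr (- (DIM('a) / 2))"] show ?thesis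
    unfolding hk_eq[OF t] hk1_def using t by (simp add: field_simps)
qed

lemma DERIV_hk1_line:
  assumes t: "\<tau> > 0"
  shows "((\<lambda>s. hk1 \<tau> (y + s *\<^sub>R k) h) has_real_derivative hk2 \<tau> y h k) (at 0)"
proof -
  have "((\<lambda>s. - ((y + s *\<^sub>R k) \<bullet> h) / (2 * \<tau>)) has_real_derivative - (k \<bullet> h) / (2 * \<tau>)) (at 0)"
    using t by (auto intro!: derivative_eq_intros simp: inner_simps)
  from DERIV_mult[OF this DERIV_hk_line[OF t, of y k]]
  show ?thesis unfolding hk1_def hk2_def using t
    by (simp add: field_simps inner_commute power2_eq_square)
qed

lemma DERIV_hk_time:
  fixes y :: "'a::euclidean_space"
  assumes t: "\<tau> > 0"
  shows "((\<lambda>s. hk s y) has_real_derivative hkT \<tau> y) (at \<tau>)"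
proof -
  let ?d = "- (real DIM('a) / 2)" and ?N = "(norm y)\<^sup>2"
  have 1: "((\<lambda>s. (4 * pi * s) powr r) has_real_derivative r * (4 * pi * \<tau>) powr r / \<tau>) (at \<tau>)" for r
    using t by (auto intro!: derivative_eq_intros simp: powr_diff field_simps)
  have 2: "((\<lambda>s. exp (- (?N * inverse (4 * s)))) has_real_derivative
      exp (- (?N * inverse (4 * \<tau>))) * (?N / (4 * \<tau>\<^sup>2))) (at \<tau>)"
    using t by (auto intro!: derivative_eq_intros simp: field_simps power2_eq_square)
  have "((\<lambda>s. (4 * pi * s) powr ?d * exp (- (?N * inverse (4 * s)))) has_real_derivative
      hkT \<tau> y) (at \<tau>)"
    by (rule DERIV_cong[OF DERIV_mult[OF 1 2]])
       (use t in \<open>simp add: hkT_def hk_eq field_simps\<close>)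
  then show ?thesis
    by (rule has_field_derivative_transform_within_open[where S="{0<..}"]) (use t in \<open>auto simp: hk_eq\<close>)
qed

text \<open>Time and space argument both depend on the parameter, so the same lemma serves lines in
  space, variation of the time and the full space-time test function.\<close>

lemma smooth_on_hk:
  fixes L :: "'c::euclidean_space \<Rightarrow> 'a::euclidean_space"
  assumes U: "open U" and \<tau>: "smooth_on U \<tau>" "\<And>p. p \<in> U \<Longrightarrow> \<tau> p > 0"
    and L: "\<And>b. b \<in> Basis \<Longrightarrow> smooth_on U (\<lambda>p. L p \<bullet> b)"
  shows "smooth_on U (\<lambda>p. hk (\<tau> p) (L p))"
proof (rule smooth_on_cong[OF U _ hk_eq[OF \<tau>(2)]])
  have m: "smooth_on U (\<lambda>p. c * \<tau> p)" for c
    by (rule smooth_on_mult[OF U smooth_on_const[OF U] \<tau>(1)])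
  have 1: "smooth_on U (\<lambda>p. (4 * pi * \<tau> p) powr (- (DIM('a) / 2)))"
    by (rule smooth_on_compose[OF smooth_on_powr U _ m]) (use \<tau>(2) in auto)
  have 2: "smooth_on U (\<lambda>p. inverse (4 * \<tau> p))"
    by (rule smooth_on_compose[OF smooth_on_inverse U _ m]) (use \<tau>(2) in auto)
  have 3: "smooth_on U (\<lambda>p. - ((norm (L p))\<^sup>2 * inverse (4 * \<tau> p)))"
    by (rule smooth_on_minus[OF U smooth_on_mult[OF U smooth_on_norm_sq_of_components[OF U L] 2]])
  show "smooth_on U (\<lambda>x. (4 * pi * \<tau> x) powr (- (DIM('a) / 2)) * exp (- ((norm (L x))\<^sup>2 * inverse (4 * \<tau> x))))"
    by (rule smooth_on_mult[OF U 1 smooth_on_compose[OF smooth_on_exp U open_UNIV 3]]) simp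
qed

lemma smooth_on_hk1:
  fixes L :: "'c::euclidean_space \<Rightarrow> 'a::euclidean_space"
  assumes U: "open U" and t: "\<tau> > 0"
    and L: "\<And>b. b \<in> Basis \<Longrightarrow> smooth_on U (\<lambda>p. L p \<bullet> b)"
  shows "smooth_on U (\<lambda>p. hk1 \<tau> (L p) h)"
  unfolding hk1_def divide_inverse
  by (rule smooth_on_mult[OF U smooth_on_mult[OF U smooth_on_minus[OF U
        smooth_on_inner_of_components[OF U L]] smooth_on_const[OF U]]
        smooth_on_hk[OF U smooth_on_const[OF U] t L]])

section \<open>The heat flow of a test function\<close>

lemma lipschitz_of_line_derivative:
  fixes u :: "'b::euclidean_space \<Rightarrow> real"
  assumes D: "\<And>y h. ((\<lambda>s. u (y + s *\<^sub>R h)) has_real_derivative D y h) (at 0)"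
    and bd: "\<And>y h. \<bar>D y h\<bar> \<le> C * norm h"
  shows "\<bar>u x - u y\<bar> \<le> C * norm (x - y)"
proof -
  have "((\<lambda>s. u (y + s *\<^sub>R (x - y))) has_real_derivative D (y + r *\<^sub>R (x - y)) (x - y)) (at r)" for r
    using D[of "y + r *\<^sub>R (x - y)" "x - y"]
      DERIV_shift[of "\<lambda>s. u (y + s *\<^sub>R (x - y))" "D (y + r *\<^sub>R (x - y)) (x - y)" 0 r]
    by (simp add: algebra_simps)
  then have "norm (u (y + 1 *\<^sub>R (x - y)) - u (y + 0 *\<^sub>R (x - y))) \<le> C * norm (x - y) * norm (1 - 0 :: real)"
    by (intro field_differentiable_bound[where S=UNIV and f' = "\<lambda>r. D (y + r *\<^sub>R (x - y)) (x - y)"])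
       (use bd in \<open>auto intro: has_field_derivative_at_within\<close>)
  then show ?thesis by simp
qed

text \<open>\<open>flowC1\<close> and \<open>flowCT\<close> are the constants of the gradient bound
  of order 1 / sqrt \<tau> and of the time-derivative bound of order 1 / \<tau>. They arise by
  inserting \<open>hk_bounds\<close> into \<open>hk1\<close> and \<open>hkT\<close>: sqrt (8 \<tau>)
  / (2 \<tau>) = sqrt 2 / sqrt \<tau>, and 8 / 4 = 2.\<close>

definition flowC1 :: "'a::euclidean_space itself \<Rightarrow> real" where
  "flowC1 a = sqrt 2 * hkC a"

definition flowCT :: "'a::euclidean_space itself \<Rightarrow> real" where
  "flowCT a = (2 + DIM('a) / 2) * hkC a"

lemma flowC1_pos: "flowC1 TYPE('a::euclidean_space) > 0"
  by (simp add: flowC1_def hkC_pos)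

text \<open>Support in a box turns the convolution with the heat kernel into an integral over a
  compact set, where differentiation under the integral applies. Continuity of \<open>f\<close>
  suffices since no derivative falls on it; bounded measurable functions are reached through
  \<open>tv_bound_extend\<close>.\<close>

locale heat_flow =
  fixes f :: "'a::euclidean_space \<Rightarrow> real" and lo hi :: 'a
  assumes f_cont: "continuous_on UNIV f"
    and f_bound: "\<bar>f z\<bar> \<le> 1"
    and f_outside: "z \<notin> cbox lo hi \<Longrightarrow> f z = 0"
begin

text \<open>The heat semigroup applied to \<open>f\<close>; in \<open>P1\<close>,
  \<open>flow_hessian\<close> and \<open>PT\<close> the derivatives fall on the kernel.\<close>

definition P :: "real \<Rightarrow> 'a \<Rightarrow> real" where
  "P \<tau> y = integral (cbox lo hi) (\<lambda>z. f z * hk \<tau> (y - z))"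
definition P1 :: "real \<Rightarrow> 'a \<Rightarrow> 'a \<Rightarrow> real" where
  "P1 \<tau> y h = integral (cbox lo hi) (\<lambda>z. f z * hk1 \<tau> (y - z) h)"
definition flow_hessian :: "real \<Rightarrow> 'a \<Rightarrow> 'a \<Rightarrow> 'a \<Rightarrow> real" where
  "flow_hessian \<tau> y h k = integral (cbox lo hi) (\<lambda>z. f z * hk2 \<tau> (y - z) h k)"
definition PT :: "real \<Rightarrow> 'a \<Rightarrow> real" where
  "PT \<tau> y = integral (cbox lo hi) (\<lambda>z. f z * hkT \<tau> (y - z))"
definition gradP :: "real \<Rightarrow> 'a \<Rightarrow> 'a" where
  "gradP \<tau> y = (\<Sum>b\<in>Basis. P1 \<tau> y b *\<^sub>R b)"

lemma f_cont_on: "continuous_on S f"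
  using f_cont continuous_on_subset by blast

lemma smooth_on_P:
  fixes L :: "'c::euclidean_space \<Rightarrow> 'a"
  assumes U: "open U" and \<tau>: "smooth_on U \<tau>" "\<And>p. p \<in> U \<Longrightarrow> \<tau> p > 0"
    and L: "\<And>b. b \<in> Basis \<Longrightarrow> smooth_on U (\<lambda>p. L p \<bullet> b)"
  shows "smooth_on U (\<lambda>p. P (\<tau> p) (L p))"
proof -
  have U': "open (U \<times> (UNIV :: 'a set))" using U by (auto intro: open_Times)
  have snd: "bounded_linear (\<lambda>w::'c \<times> 'a. snd w \<bullet> e)" for e
    by (intro bounded_linear_inner_left_comp bounded_linear_snd)
  have comp: "smooth_on (U \<times> UNIV) (\<lambda>w. (L (fst w) - snd w) \<bullet> e)" if "e \<in> Basis" for e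
    unfolding inner_diff_left
    by (rule smooth_on_diff[OF U' smooth_on_fst[OF U L[OF that]] smooth_on_linear[OF U' snd]])
  have "smooth_on (U \<times> UNIV) (\<lambda>w. hk (\<tau> (fst w)) (L (fst w) - snd w))"
    by (rule smooth_on_hk[OF U' smooth_on_fst[OF U \<tau>(1)] _ comp]) (use \<tau>(2) in auto)
  from smooth_on_integral_param(1)[OF U f_cont_on this] show ?thesis
    by (simp add: P_def)
qed

text \<open>Specialises the parameter integral to one real parameter, so that lines in space and the
  time variable are treated alike; only the direction (1, 0) of the pair (parameter, z) is
  differentiated.\<close>

lemma DERIV_integral_line:
  fixes k k' :: "real \<Rightarrow> 'a \<Rightarrow> real"
  assumes U: "open U" "s0 \<in> U" and k: "smooth_on (U \<times> UNIV) (\<lambda>w. k (fst w) (snd w))"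
    and D: "\<And>z. ((\<lambda>s. k s z) has_real_derivative k' s0 z) (at s0)"
  shows "((\<lambda>s. integral (cbox lo hi) (\<lambda>z. f z * k s z)) has_real_derivative
    integral (cbox lo hi) (\<lambda>z. f z * k' s0 z)) (at s0)"
proof -
  have 1: "pd (1, 0) (\<lambda>w. k (fst w) (snd w)) (s0, z) = k' s0 z" for z
  proof (rule pd_eqI)
    show "((\<lambda>s. k (fst ((s0, z) + s *\<^sub>R (1, 0))) (snd ((s0, z) + s *\<^sub>R (1, 0)))) has_real_derivative k' s0 z) (at 0)"
      using D[of z] DERIV_shift[of "\<lambda>s. k s z" "k' s0 z" 0 s0] by (simp add: add.commute)
  qed
  have "((\<lambda>s. integral (cbox lo hi) (\<lambda>z. f z * k (s0 + s) z)) has_real_derivative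
    integral (cbox lo hi) (\<lambda>z. f z * k' s0 z)) (at 0)"
    using smooth_on_integral_param(2)[OF U(1) f_cont_on k, of 1 s0] U(2) by (simp add: 1)
  then show ?thesis
    using DERIV_shift[of "\<lambda>s. integral (cbox lo hi) (\<lambda>z. f z * k s z)" _ 0 s0] by (simp add: add.commute)
qed

lemma line_components: "e \<in> Basis \<Longrightarrow>
    smooth_on (UNIV \<times> UNIV) (\<lambda>w. (y + fst w *\<^sub>R h - snd w) \<bullet> e)" for h y :: 'a
proof -
  have "open (UNIV \<times> UNIV :: (real \<times> 'a) set)" by simp
  moreover have "bounded_linear (\<lambda>w::real \<times> 'a. fst w * (h \<bullet> e) - snd w \<bullet> e)"
    by (intro bounded_linear_sub bounded_linear_mult_const bounded_linear_fst bounded_linear_inner_left_comp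
        bounded_linear_snd)
  ultimately have "smooth_on (UNIV \<times> UNIV) (\<lambda>w::real \<times> 'a. y \<bullet> e + (fst w * (h \<bullet> e) - snd w \<bullet> e))"
    by (intro smooth_on_add smooth_on_const smooth_on_linear)
  then show ?thesis by (simp add: inner_simps add_diff_eq)
qed

lemma DERIV_P_line:
  assumes t: "\<tau> > 0"
  shows "((\<lambda>s. P \<tau> (y + s *\<^sub>R h)) has_real_derivative P1 \<tau> y h) (at 0)"
proof -
  have "smooth_on (UNIV \<times> UNIV) (\<lambda>w. hk \<tau> (y + fst w *\<^sub>R h - snd w))"
    by (rule smooth_on_hk[OF _ smooth_on_const]) (use t line_components in auto)
  moreover have "((\<lambda>s. hk \<tau> (y + s *\<^sub>R h - z)) has_real_derivative hk1 \<tau> (y - z) h) (at 0)" for z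
    using DERIV_hk_line[OF t, of "y - z" h] by (simp add: algebra_simps)
  ultimately show ?thesis
    unfolding P_def P1_def
    by (intro DERIV_integral_line[where U=UNIV and k="\<lambda>s z. hk \<tau> (y + s *\<^sub>R h - z)"
          and k'="\<lambda>_ z. hk1 \<tau> (y - z) h"]) auto
qed

lemma DERIV_P1_line:
  assumes t: "\<tau> > 0"
  shows "((\<lambda>s. P1 \<tau> (y + s *\<^sub>R k) h) has_real_derivative flow_hessian \<tau> y h k) (at 0)"
proof -
  have "smooth_on (UNIV \<times> UNIV) (\<lambda>w. hk1 \<tau> (y + fst w *\<^sub>R k - snd w) h)"
    by (rule smooth_on_hk1) (use t line_components in auto)
  moreover have "((\<lambda>s. hk1 \<tau> (y + s *\<^sub>R k - z) h) has_real_derivative hk2 \<tau> (y - z) h k) (at 0)" for z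
    using DERIV_hk1_line[OF t, of "y - z" k h] by (simp add: algebra_simps)
  ultimately show ?thesis
    unfolding P1_def flow_hessian_def
    by (intro DERIV_integral_line[where U=UNIV and k="\<lambda>s z. hk1 \<tau> (y + s *\<^sub>R k - z) h"
          and k'="\<lambda>_ z. hk2 \<tau> (y - z) h k"]) auto
qed

lemma DERIV_P_time:
  assumes t: "\<tau> > 0"
  shows "((\<lambda>s. P s y) has_real_derivative PT \<tau> y) (at \<tau>)"
proof -
  have o: "open ({0<..} \<times> UNIV :: (real \<times> 'a) set)" by (intro open_Times) auto
  have "bounded_linear (\<lambda>w::real \<times> 'a. - (snd w \<bullet> b))" for b
    by (intro bounded_linear_minus bounded_linear_inner_left_comp bounded_linear_snd)
  then have c: "smooth_on ({0<..} \<times> UNIV) (\<lambda>w::real \<times> 'a. (y - snd w) \<bullet> b)" for b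
    using smooth_on_add[OF o smooth_on_const[OF o] smooth_on_linear[OF o], of "\<lambda>w. - (snd w \<bullet> b)" "y \<bullet> b"]
    by (simp add: inner_simps)
  have "smooth_on ({0<..} \<times> UNIV) (\<lambda>w. hk (fst w) (y - snd w))"
    by (rule smooth_on_hk[OF o smooth_on_linear[OF o bounded_linear_fst] _ c]) auto
  moreover have "((\<lambda>s. hk s (y - z)) has_real_derivative hkT \<tau> (y - z)) (at \<tau>)" for z
    by (rule DERIV_hk_time[OF t])
  ultimately show ?thesis
    unfolding P_def PT_def
    by (intro DERIV_integral_line[where U="{0<..}" and k="\<lambda>s z. hk s (y - z)"
          and k'="\<lambda>s z. hkT s (y - z)"]) (use t in auto)
qed

lemma continuous_on_hk_shift: "\<tau> > 0 \<Longrightarrow> continuous_on S (\<lambda>z. hk \<tau> (y - z))"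
  by (rule continuous_on_compose2[OF continuous_on_hk[of \<tau> UNIV]]) (auto intro!: continuous_intros)

lemma continuous_kernels:
  assumes "\<tau> > 0"
  shows "continuous_on (cbox lo hi) (\<lambda>z. f z * hk \<tau> (y - z))"
    and "continuous_on (cbox lo hi) (\<lambda>z. f z * hk1 \<tau> (y - z) h)"
    and "continuous_on (cbox lo hi) (\<lambda>z. f z * hk2 \<tau> (y - z) h k)"
    and "continuous_on (cbox lo hi) (\<lambda>z. f z * hkT \<tau> (y - z))"
  unfolding hk1_def hk2_def hkT_def using assms
  by (auto intro!: continuous_intros f_cont_on continuous_on_hk_shift)

lemma hk_shift_bounds:
  fixes w :: 'a
  assumes "\<tau> > 0" "0 \<le> c" "\<bar>K\<bar> \<le> c * hk \<sigma> w"
  shows "\<bar>f z * K\<bar> \<le> c * hk \<sigma> w"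
  using mult_mono[OF f_bound[of z] assms(3)] by (simp add: abs_mult)

lemma P_bound: "\<tau> > 0 \<Longrightarrow> \<bar>P \<tau> y\<bar> \<le> 1"
  unfolding P_def
  by (rule integral_hk_bound[of \<tau> _ _ _ _ y]) (auto intro!: continuous_kernels hk_shift_bounds[where c=1, simplified] simp: hk_pos less_imp_le)

lemma P1_bound:
  assumes t: "\<tau> > 0"
  shows "\<bar>P1 \<tau> y h\<bar> \<le> flowC1 TYPE('a) / sqrt \<tau> * norm h"
  unfolding P1_def
\<comment> \<open>The comparison kernel has time 2 \<tau>, where \<open>hk_bounds\<close> places it
  after absorbing the factor |y - z|.\<close>
proof (rule integral_hk_bound[of "2 * \<tau>" _ _ _ _ y])
  show c: "0 \<le> flowC1 TYPE('a) / sqrt \<tau> * norm h"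
    using t flowC1_pos[where 'a='a] by simp
  fix z
  let ?w = "y - z"
  have pos: "hk (2 * \<tau>) ?w \<ge> 0" "hk \<tau> ?w \<ge> 0" using t by (auto simp: hk_pos less_imp_le)
  have "\<bar>hk1 \<tau> ?w h\<bar> = \<bar>?w \<bullet> h\<bar> / (2 * \<tau>) * hk \<tau> ?w"
    using t pos by (simp add: hk1_def abs_mult)
  also have "\<dots> \<le> (norm ?w * norm h) / (2 * \<tau>) * hk \<tau> ?w"
    using t pos by (intro mult_right_mono divide_right_mono Cauchy_Schwarz_ineq2) auto
  also have "\<dots> = norm h / (2 * \<tau>) * (norm ?w * hk \<tau> ?w)" by simp
  also have "\<dots> \<le> norm h / (2 * \<tau>) * (sqrt (8 * \<tau>) * hkC TYPE('a) * hk (2 * \<tau>) ?w)"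
    using t by (intro mult_left_mono hk_bounds(2)) auto
  also have "norm h / (2 * \<tau>) * (sqrt (8 * \<tau>) * hkC TYPE('a) * hk (2 * \<tau>) ?w) =
      flowC1 TYPE('a) / sqrt \<tau> * norm h * hk (2 * \<tau>) ?w"
  proof -
    have "sqrt (8 * \<tau>) = 2 * sqrt 2 * sqrt \<tau>" using real_sqrt_mult[of 4 2] by (simp add: real_sqrt_mult)
    moreover have "\<tau> = sqrt \<tau> * sqrt \<tau>" using t by simp
    ultimately have "sqrt (8 * \<tau>) / (2 * \<tau>) = sqrt 2 / sqrt \<tau>"
      using t by (simp add: field_simps)
    then have "norm h * hkC TYPE('a) * hk (2 * \<tau>) ?w * (sqrt (8 * \<tau>) / (2 * \<tau>)) =
      norm h * hkC TYPE('a) * hk (2 * \<tau>) ?w * (sqrt 2 / sqrt \<tau>)" by (simp only:)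
    then show ?thesis by (simp add: flowC1_def mult_ac)
  qed
  finally show "\<bar>f z * hk1 \<tau> ?w h\<bar> \<le> flowC1 TYPE('a) / sqrt \<tau> * norm h * hk (2 * \<tau>) ?w"
    by (rule hk_shift_bounds[OF t c])
qed (use t in \<open>auto intro: continuous_kernels\<close>)

lemma PT_bound:
  assumes t: "\<tau> > 0"
  shows "\<bar>PT \<tau> y\<bar> \<le> flowCT TYPE('a) / \<tau>"
  unfolding PT_def
proof (rule integral_hk_bound[of "2 * \<tau>" _ _ _ _ y])
  show c: "0 \<le> flowCT TYPE('a) / \<tau>"
    using t hkC_pos[where 'a='a] by (simp add: flowCT_def)
  fix z
  let ?w = "y - z"
  have pos: "hk (2 * \<tau>) ?w \<ge> 0" "hk \<tau> ?w \<ge> 0" using t by (auto simp: hk_pos less_imp_le)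
  have "\<bar>hkT \<tau> ?w\<bar> = \<bar>(norm ?w)\<^sup>2 / (4 * \<tau>\<^sup>2) - DIM('a) / (2 * \<tau>)\<bar> * hk \<tau> ?w"
    using pos by (simp add: hkT_def abs_mult)
  also have "\<dots> \<le> ((norm ?w)\<^sup>2 / (4 * \<tau>\<^sup>2) + DIM('a) / (2 * \<tau>)) * hk \<tau> ?w"
    using t pos by (intro mult_right_mono abs_leI) (auto simp: add_increasing diff_le_eq le_diff_eq)
  also have "\<dots> = 1 / (4 * \<tau>\<^sup>2) * ((norm ?w)\<^sup>2 * hk \<tau> ?w) + DIM('a) / (2 * \<tau>) * hk \<tau> ?w"
    by (simp add: field_simps)
  also have "\<dots> \<le> 1 / (4 * \<tau>\<^sup>2) * (8 * \<tau> * hkC TYPE('a) * hk (2 * \<tau>) ?w) +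
      DIM('a) / (2 * \<tau>) * (hkC TYPE('a) * hk (2 * \<tau>) ?w)"
    using t by (intro add_mono mult_left_mono hk_bounds) auto
  also have "\<dots> = flowCT TYPE('a) / \<tau> * hk (2 * \<tau>) ?w"
    using t by (simp add: flowCT_def field_simps power2_eq_square)
  finally show "\<bar>f z * hkT \<tau> ?w\<bar> \<le> flowCT TYPE('a) / \<tau> * hk (2 * \<tau>) ?w"
    by (rule hk_shift_bounds[OF t c])
qed (use t in \<open>auto intro: continuous_kernels\<close>)

lemma P1_eq_inner:
  assumes t: "\<tau> > 0"
  shows "P1 \<tau> y h = gradP \<tau> y \<bullet> h"
proof -
  have "f z * hk1 \<tau> (y - z) h = (\<Sum>b\<in>Basis. (h \<bullet> b) * (f z * hk1 \<tau> (y - z) b))" for z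
    unfolding hk1_def
    by (subst euclidean_inner) (simp add: sum_distrib_left sum_distrib_right sum_negf sum_divide_distrib mult_ac)
  then have "P1 \<tau> y h = (\<Sum>b\<in>Basis. (h \<bullet> b) * P1 \<tau> y b)"
    unfolding P1_def
    by (subst integral_mult_right[symmetric], subst integral_sum[symmetric])
       (auto intro!: integrable_continuous continuous_kernels continuous_intros t)
  then show ?thesis
    unfolding gradP_def inner_sum_left inner_scaleR_left
    by (simp add: inner_commute[of h] mult.commute)
qed

text \<open>The directional bound is tested with the direction \<open>gradP \<tau> y\<close> itself,
  so the Euclidean norm is reached without loss in the constant.\<close>

lemma norm_gradP:
  assumes t: "\<tau> > 0"
  shows "norm (gradP \<tau> y) \<le> flowC1 TYPE('a) / sqrt \<tau>"
proof (cases "gradP \<tau> y = 0")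
  case False
  have "norm (gradP \<tau> y) * norm (gradP \<tau> y) \<le> flowC1 TYPE('a) / sqrt \<tau> * norm (gradP \<tau> y)"
    using P1_bound[OF t, of y "gradP \<tau> y"] P1_eq_inner[OF t, of y "gradP \<tau> y"]
    by (simp add: power2_norm_eq_inner[symmetric] power2_eq_square)
  then show ?thesis
    by (rule mult_right_le_imp_le) (use False in simp)
qed (use t flowC1_pos[where 'a='a] in simp)

lemma P_lipschitz: "\<tau> > 0 \<Longrightarrow> \<bar>P \<tau> x - P \<tau> y\<bar> \<le> flowC1 TYPE('a) / sqrt \<tau> * norm (x - y)"
  using lipschitz_of_line_derivative[OF DERIV_P_line P1_bound] by blast

text \<open>The bound is uniform in \<open>y\<close>, which allows the flow time to vary under a
  moving measure. The lower bound \<open>m\<close> keeps both times away from the singularity of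
  order 1 / \<tau>.\<close>

lemma P_time_lipschitz:
  assumes m: "m > 0" "\<tau> \<ge> m" "\<sigma> \<ge> m"
  shows "\<bar>P \<tau> y - P \<sigma> y\<bar> \<le> flowCT TYPE('a) / m * \<bar>\<tau> - \<sigma>\<bar>"
proof -
  have "norm (P \<tau> y - P \<sigma> y) \<le> flowCT TYPE('a) / m * norm (\<tau> - \<sigma>)"
  proof (rule field_differentiable_bound[where S="{m..}" and f'="\<lambda>s. PT s y"])
    fix s assume s: "s \<in> {m..}"
    then show "((\<lambda>\<tau>. P \<tau> y) has_real_derivative PT s y) (at s within {m..})"
      using m by (intro has_field_derivative_at_within[OF DERIV_P_time]) auto
    have "\<bar>PT s y\<bar> \<le> flowCT TYPE('a) / s" using s m by (intro PT_bound) auto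
    also have "\<dots> \<le> flowCT TYPE('a) / m"
      using s m hkC_pos[where 'a='a] by (intro divide_left_mono) (auto simp: flowCT_def)
    finally show "norm (PT s y) \<le> flowCT TYPE('a) / m" by simp
  qed (use m in auto)
  then show ?thesis by simp
qed

lemma continuous_on_P: "\<tau> > 0 \<Longrightarrow> continuous_on UNIV (P \<tau>)"
  by (rule smooth_on_imp_continuous_on[OF smooth_on_P[where \<tau>="\<lambda>_. \<tau>" and L="\<lambda>x. x"]])
     (auto intro!: smooth_on_const smooth_on_linear bounded_linear_inner_left)

lemma continuous_on_P1: 
  assumes t: "\<tau> > 0" shows "continuous_on UNIV (\<lambda>y. P1 \<tau> y h)"
proof -
  have "continuous_on (UNIV \<times> cbox lo hi) (\<lambda>w. hk \<tau> (fst w - snd w))"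
    by (rule continuous_on_compose2[OF continuous_on_hk[OF t, of UNIV]]) (auto intro!: continuous_intros)
  then have "continuous_on (UNIV \<times> cbox lo hi) (\<lambda>(y, z). f z * hk1 \<tau> (y - z) h)"
    using t by (auto simp: hk1_def split_beta intro!: continuous_intros continuous_on_compose2[OF f_cont])
  from integral_continuous_on_param[OF this] show ?thesis by (simp add: P1_def)
qed

lemma continuous_on_gradP: "\<tau> > 0 \<Longrightarrow> continuous_on UNIV (gradP \<tau>)"
  unfolding gradP_def by (intro continuous_intros continuous_on_P1)

text \<open>Near \<open>y\<close> continuity of \<open>f\<close> is used; away from it 1 <= |y -
  z|^2 / d^2, and the second-moment bound in \<open>hk_bounds\<close> yields a factor
  \<tau>.\<close>

lemma P_tendsto: "((\<lambda>\<tau>. P \<tau> y) \<longlongrightarrow> f y) (at_right 0)"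
proof (rule tendstoI)
  fix e :: real assume e: "e > 0"
  obtain d where d: "d > 0" "\<And>z. dist z y < d \<Longrightarrow> dist (f z) (f y) < e / 2"
    using f_cont e unfolding continuous_on_iff by (metis UNIV_I half_gt_zero)
  \<comment> \<open>The factor 2 bounds the oscillation of \<open>f\<close>, and 8
    \<open>hkC\<close> is the constant of the second-moment bound.\<close>
  define C where "C = 2 / d\<^sup>2 * (8 * hkC TYPE('a))"
  have C: "C > 0" using d hkC_pos[where 'a='a] by (simp add: C_def)
  have main: "\<bar>P \<tau> y - f y\<bar> \<le> e / 2 + C * \<tau>" if t: "\<tau> > 0" for \<tau>
  proof -
    have t2: "2 * \<tau> > 0" using t by simp
    have i: "integrable lborel (\<lambda>z. hk \<tau> (y - z))" and i1: "(\<integral>z. hk \<tau> (y - z) \<partial>lborel) = 1"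
      using has_bochner_integral_hk[OF t, of y] by (auto simp: has_bochner_integral_iff)
    have j: "integrable lborel (\<lambda>z. hk (2 * \<tau>) (y - z))" and j1: "(\<integral>z. hk (2 * \<tau>) (y - z) \<partial>lborel) = 1"
      using has_bochner_integral_hk[OF t2, of y] by (auto simp: has_bochner_integral_iff)
    have fm: "f \<in> borel_measurable borel" using f_cont by (rule borel_measurable_continuous_onI)
    have fi: "integrable lborel (\<lambda>z. f z * hk \<tau> (y - z))"
      by (rule Bochner_Integration.integrable_bound[OF i])
         (use fm t f_bound in \<open>auto simp: abs_mult hk_pos intro!: mult_left_le_one_le\<close>)
    have si: "set_integrable lborel (cbox lo hi) (\<lambda>z. f z * hk \<tau> (y - z))"
      unfolding set_integrable_def by (rule integrable_mult_indicator[OF _ fi]) simp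
    have "P \<tau> y = (LINT z:cbox lo hi|lborel. f z * hk \<tau> (y - z))"
      unfolding P_def by (rule set_borel_integral_eq_integral(2)[OF si, symmetric])
    also have "\<dots> = (\<integral>z. f z * hk \<tau> (y - z) \<partial>lborel)"
      unfolding set_lebesgue_integral_def
      by (rule Bochner_Integration.integral_cong) (auto simp: indicator_def f_outside)
    finally have "P \<tau> y - f y = (\<integral>z. (f z - f y) * hk \<tau> (y - z) \<partial>lborel)"
      using i i1 fi by (simp add: left_diff_distrib)
    also have "\<bar>\<dots>\<bar> \<le> (\<integral>z. e / 2 * hk \<tau> (y - z) + C * \<tau> * hk (2 * \<tau>) (y - z) \<partial>lborel)"
    proof (rule integral_abs_bound[THEN order_trans], rule integral_mono)
      show "integrable lborel (\<lambda>z. \<bar>(f z - f y) * hk \<tau> (y - z)\<bar>)"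
        using i fi by (auto simp: left_diff_distrib)
      show "integrable lborel (\<lambda>z. e / 2 * hk \<tau> (y - z) + C * \<tau> * hk (2 * \<tau>) (y - z))"
        using i j by simp
      fix z
      let ?w = "y - z"
      have pos: "hk \<tau> ?w > 0" "hk (2 * \<tau>) ?w > 0" using t by (auto simp: hk_pos)
      show "\<bar>(f z - f y) * hk \<tau> ?w\<bar> \<le> e / 2 * hk \<tau> ?w + C * \<tau> * hk (2 * \<tau>) ?w"
      proof (cases "norm ?w < d")
        case True
        then have "\<bar>f z - f y\<bar> \<le> e / 2" using d(2)[of z] by (simp add: dist_norm norm_minus_commute)
        then have "\<bar>(f z - f y) * hk \<tau> ?w\<bar> \<le> e / 2 * hk \<tau> ?w"
          using pos by (simp add: abs_mult)
        then show ?thesis using pos C t by (simp add: add_increasing2)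
      next
        case False
        then have "1 \<le> (norm ?w)\<^sup>2 / d\<^sup>2" using d(1) by (simp add: power_mono)
        then have "2 * hk \<tau> ?w \<le> 2 * (((norm ?w)\<^sup>2 / d\<^sup>2) * hk \<tau> ?w)"
          using mult_right_mono[OF \<open>1 \<le> (norm ?w)\<^sup>2 / d\<^sup>2\<close>, of "hk \<tau> ?w"] pos by linarith
        also have "\<dots> = 2 / d\<^sup>2 * ((norm ?w)\<^sup>2 * hk \<tau> ?w)" by simp
        also have "\<dots> \<le> 2 / d\<^sup>2 * (8 * \<tau> * hkC TYPE('a) * hk (2 * \<tau>) ?w)"
          by (intro mult_left_mono hk_bounds(3) t) auto
        also have "\<dots> = C * \<tau> * hk (2 * \<tau>) ?w" by (simp add: C_def)
        finally have "2 * hk \<tau> ?w \<le> C * \<tau> * hk (2 * \<tau>) ?w" .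
        moreover have "\<bar>f z - f y\<bar> \<le> 2" using f_bound[of z] f_bound[of y] by linarith
        then have "\<bar>(f z - f y) * hk \<tau> ?w\<bar> \<le> 2 * hk \<tau> ?w" using pos by (simp add: abs_mult)
        moreover have "e / 2 * hk \<tau> ?w \<ge> 0" using pos e by simp
        ultimately show ?thesis by linarith
      qed
    qed
    also have "\<dots> = e / 2 + C * \<tau>" using i j by (simp add: i1 j1)
    finally show ?thesis .
  qed
  show "\<forall>\<^sub>F \<tau> in at_right 0. dist (P \<tau> y) (f y) < e"
    unfolding eventually_at_right_field
  proof (intro exI[of _ "e / (2 * C)"] conjI allI impI)
    show "e / (2 * C) > 0" using e C by simp
    fix \<tau> :: real assume "\<tau> > 0" "\<tau> < e / (2 * C)"
    then have "C * \<tau> < e / 2" using C by (simp add: field_simps)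
    then show "dist (P \<tau> y) (f y) < e" using main[OF \<open>\<tau> > 0\<close>] by (simp add: dist_real_def)
  qed
qed

end

section \<open>Testing a weak formulation with the backward heat flow\<close>

text \<open>Both equations have a generator of this form, degenerate in the kinetic case. Below, the identity
  \<open>\<sigma> * (\<Sum>e\<in>S. (h \<bullet> Y e)\<^sup>2) = (norm h)\<^sup>2\<close> expresses that its second-order part becomes the Laplacian for
  functions of \<open>Y z\<close>.\<close>

definition generator :: "(real \<Rightarrow> 'e::euclidean_space \<Rightarrow> 'e) \<Rightarrow> 'e set \<Rightarrow> real \<Rightarrow>
    (real \<times> 'e \<Rightarrow> real) \<Rightarrow> real \<Rightarrow> 'e \<Rightarrow> real" where
  "generator c S \<sigma> \<phi> t z = pd (1, 0) \<phi> (t, z) + (\<Sum>e\<in>Basis. (c t z \<bullet> e) * pd (0, e) \<phi> (t, z))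
     + \<sigma> * (\<Sum>e\<in>S. pd (0, e) (pd (0, e) \<phi>) (t, z))"

context heat_flow
begin

text \<open>The backward flow pulled back along \<open>Y\<close>, localised in time by \<eta> and in
  space by a cutoff. For times from \<tau> on the flow has no meaning; wherever the function is
  used, \<eta> vanishes there.\<close>

definition flow_test :: "('e::euclidean_space \<Rightarrow> 'a) \<Rightarrow> real \<Rightarrow> (real \<Rightarrow> real) \<Rightarrow> real \<Rightarrow> real \<times> 'e \<Rightarrow> real" where
  "flow_test Y \<tau> \<eta> n w = \<eta> (fst w) * (cutoff n (snd w) * P (\<tau> - fst w) (Y (snd w)))"

text \<open>What the generator leaves of \<open>flow_test\<close> as the cutoff tends to 1: the time
  derivative of the flow cancels against the second-order part, and the first-order part sees the
  drift only through its image under \<open>Y\<close>.\<close>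

definition generator_lim :: "('e::euclidean_space \<Rightarrow> 'a) \<Rightarrow> (real \<Rightarrow> 'e \<Rightarrow> 'e) \<Rightarrow> real \<Rightarrow> (real \<Rightarrow> real) \<Rightarrow>
    real \<Rightarrow> 'e \<Rightarrow> real" where
  "generator_lim Y c \<tau> \<eta> t z =
     pd 1 \<eta> t * P (\<tau> - t) (Y z) + \<eta> t * (gradP (\<tau> - t) (Y z) \<bullet> Y (c t z))"

context
  fixes Y :: "'e::euclidean_space \<Rightarrow> 'a" and c :: "real \<Rightarrow> 'e \<Rightarrow> 'e" and S :: "'e set"
    and \<sigma> \<tau> \<alpha> \<beta> :: real and \<eta> :: "real \<Rightarrow> real"
  assumes Y: "bounded_linear Y" and S: "S \<subseteq> Basis"
    and ellip: "\<And>h. \<sigma> * (\<Sum>e\<in>S. (h \<bullet> Y e)\<^sup>2) = (norm h)\<^sup>2"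
    and \<eta>: "smooth_on UNIV \<eta>" and \<eta>_supp: "\<And>t. t \<notin> {\<alpha>..\<beta>} \<Longrightarrow> \<eta> t = 0"
    and \<beta>_less: "\<beta> < \<tau>"
begin

abbreviation (input) "gen \<equiv> generator c S \<sigma>"
abbreviation (input) "testP \<equiv> flow_test Y \<tau> \<eta>"
abbreviation (input) "gen_lim \<equiv> generator_lim Y c \<tau> \<eta>"

text \<open>The half-spaces t < \<tau> and t > \<beta> cover space-time. On the former all factors
  are smooth, on the latter the function is identically zero.\<close>

lemma testP_smooth: "smooth_on UNIV (testP n)"
proof -
  let ?U = "{..<\<tau>} \<times> (UNIV :: 'e set)" and ?V = "{\<beta><..} \<times> (UNIV :: 'e set)"
  have oU: "open ?U" and oV: "open ?V" by (auto intro: open_Times)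
  have 1: "smooth_on ?U (\<lambda>w. \<eta> (fst w))"
    by (rule smooth_on_compose[OF \<eta> oU open_UNIV smooth_on_linear[OF oU bounded_linear_fst]]) simp
  have 2: "smooth_on ?U (\<lambda>w. cutoff n (snd w))"
    by (rule smooth_on_cutoff_linear[OF oU bounded_linear_snd])
  have 3: "smooth_on ?U (\<lambda>w. \<tau> - fst w)"
    by (rule smooth_on_diff[OF oU smooth_on_const[OF oU] smooth_on_linear[OF oU bounded_linear_fst]])
  have 4: "smooth_on ?U (\<lambda>w. Y (snd w) \<bullet> b)" for b
    by (rule smooth_on_linear[OF oU])
       (intro bounded_linear_inner_left_comp bounded_linear_compose[OF Y] bounded_linear_snd)
  have "smooth_on ?U (testP n)"
    unfolding flow_test_def
    by (rule smooth_on_mult[OF oU 1 smooth_on_mult[OF oU 2 smooth_on_P[OF oU 3 _ 4]]]) auto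
  moreover have "smooth_on ?V (testP n)"
    by (rule smooth_on_cong[OF oV smooth_on_const[OF oV]]) (auto simp: flow_test_def \<eta>_supp)
  ultimately have "smooth_on (?U \<union> ?V) (testP n)" by (rule smooth_on_Un[OF oU oV])
  moreover have "?U \<union> ?V = UNIV" using \<beta>_less by (auto simp: not_less)
  ultimately show ?thesis by simp
qed

lemma testP_test_fun:
  assumes "n > 0" "0 < \<alpha>" "\<beta> < T"
  shows "test_fun ({0<..<T} \<times> UNIV) (testP n)"
proof -
  have sub: "{w. testP n w \<noteq> 0} \<subseteq> {\<alpha>..\<beta>} \<times> cball 0 (2 * n)"
  proof
    fix w assume "w \<in> {w. testP n w \<noteq> 0}"
    then have "\<eta> (fst w) \<noteq> 0" "cutoff n (snd w) \<noteq> 0" by (auto simp: flow_test_def)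
    then have "fst w \<in> {\<alpha>..\<beta>}" "\<not> norm (snd w) \<ge> 2 * n"
      using \<eta>_supp cutoff_0[OF assms(1)] by blast+
    then show "w \<in> {\<alpha>..\<beta>} \<times> cball 0 (2 * n)"
      by (cases w) auto
  qed
  have comp: "compact ({\<alpha>..\<beta>} \<times> cball (0::'e) (2 * n))" by (intro compact_Times) auto
  then have cl: "closure {w. testP n w \<noteq> 0} \<subseteq> {\<alpha>..\<beta>} \<times> cball 0 (2 * n)"
    using sub by (intro closure_minimal compact_imp_closed)
  then have "compact (closure {w. testP n w \<noteq> 0})"
    using comp by (metis compact_Int_closed closed_closure inf.absorb_iff2)
  with cl testP_smooth show ?thesis
    unfolding test_fun_def smooth_fun_iff using assms by fastforce
qed

lemma pd_eta_outside: "t \<notin> {\<alpha>..\<beta>} \<Longrightarrow> pd 1 \<eta> t = 0"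
  using pd_cong[of "- {\<alpha>..\<beta>}" t \<eta> "\<lambda>_. 0" 1] pd_eqI[of "\<lambda>_. 0" t 1 0] \<eta>_supp by auto

lemma pos_time: "\<eta> t \<noteq> 0 \<Longrightarrow> \<tau> - t > 0"
  using \<eta>_supp[of t] \<beta>_less by force

lemma DERIV_P_Y: "\<tau> - t > 0 \<Longrightarrow>
    ((\<lambda>s. P (\<tau> - t) (Y (z + s *\<^sub>R e))) has_real_derivative P1 (\<tau> - t) (Y z) (Y e)) (at 0)"
  using DERIV_P_line[of "\<tau> - t" "Y z" "Y e"]
  by (simp add: linear_add linear_scale bounded_linear.linear[OF Y])

lemma DERIV_P1_Y: "\<tau> - t > 0 \<Longrightarrow>
    ((\<lambda>s. P1 (\<tau> - t) (Y (z + s *\<^sub>R e)) (Y e)) has_real_derivative flow_hessian (\<tau> - t) (Y z) (Y e) (Y e)) (at 0)"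
  using DERIV_P1_line[of "\<tau> - t" "Y z" "Y e" "Y e"]
  by (simp add: linear_add linear_scale bounded_linear.linear[OF Y])

lemma pd_time_testP:
  "pd (1, 0) (testP n) (t, z) =
     pd 1 \<eta> t * (cutoff n z * P (\<tau> - t) (Y z)) + \<eta> t * (cutoff n z * (- PT (\<tau> - t) (Y z)))"
proof (cases "\<tau> - t > 0")
  case True
  have "((\<lambda>s. P (\<tau> - s) (Y z)) has_real_derivative - PT (\<tau> - t) (Y z)) (at t)"
  proof -
    have "((\<lambda>s. \<tau> - s) has_real_derivative -1) (at t)" by (auto intro!: derivative_eq_intros)
    from DERIV_chain2[where f="\<lambda>s. P s (Y z)", OF DERIV_P_time[OF True, of "Y z"] this]
    show ?thesis by simp
  qed
  from DERIV_mult[OF smooth_on_real_DERIV[OF \<eta>, of t] DERIV_cmult[OF this, of "cutoff n z"]]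
  have "((\<lambda>s. testP n (s, z)) has_real_derivative
     pd 1 \<eta> t * (cutoff n z * P (\<tau> - t) (Y z)) + \<eta> t * (cutoff n z * (- PT (\<tau> - t) (Y z)))) (at t)"
    by (simp add: flow_test_def mult.commute)
  then show ?thesis
    using DERIV_shift[of "\<lambda>s. testP n (s, z)" _ 0 t]
    by (intro pd_eqI) (simp add: add.commute)
next
  \<comment> \<open>Here t >= \<tau> > \<beta>, so the test function vanishes in a neighbourhood and
    both sides are 0, whatever \<open>P\<close> and \<open>PT\<close> are at nonpositive
    times.\<close>
  case False
  have o: "open ({\<beta><..} \<times> (UNIV::'e set))" by (intro open_Times) auto
  have "pd (1, 0) (testP n) (t, z) = pd (1, 0) (\<lambda>_. 0) (t, z)"
    using False \<beta>_less by (intro pd_cong[OF o]) (auto simp: flow_test_def \<eta>_supp)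
  then show ?thesis using False \<beta>_less
    by (auto simp: pd_eta_outside \<eta>_supp intro!: pd_eqI)
qed

lemma pd_space_testP:
  "pd (0, e) (testP n) (t, z) =
     \<eta> t * (cutoff1 n z e * P (\<tau> - t) (Y z) + P1 (\<tau> - t) (Y z) (Y e) * cutoff n z)"
proof (cases "\<eta> t = 0")
  case True
  then show ?thesis by (intro pd_eqI) (simp add: flow_test_def)
next
  case False
  from DERIV_cmult[OF DERIV_mult[OF DERIV_cutoff[of n z e] DERIV_P_Y[OF pos_time[OF False], of z e]], of "\<eta> t"]
  show ?thesis by (intro pd_eqI) (simp add: flow_test_def)
qed

lemma pd2_space_testP:
  "pd (0, e) (pd (0, e) (testP n)) (t, z) =
     \<eta> t * (cutoff2 n z e * P (\<tau> - t) (Y z) + 2 * cutoff1 n z e * P1 (\<tau> - t) (Y z) (Y e)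
       + cutoff n z * flow_hessian (\<tau> - t) (Y z) (Y e) (Y e))"
proof (cases "\<eta> t = 0")
  case True
  then show ?thesis by (intro pd_eqI) (simp add: pd_space_testP)
next
  case False
  note p = pos_time[OF False]
  from DERIV_cmult[OF DERIV_add[OF DERIV_mult[OF DERIV_cutoff1[of n z e] DERIV_P_Y[OF p, of z e]]
      DERIV_mult[OF DERIV_P1_Y[OF p, of z e] DERIV_cutoff[of n z e]]], of "\<eta> t"]
  show ?thesis by (intro pd_eqI) (simp add: pd_space_testP algebra_simps)
qed

text \<open>The heat equation for the pulled-back flow, proved for the kernels. Taking for
  \<open>h\<close> in \<open>ellip\<close> the kernel argument gives the quadratic term of
  \<open>hkT\<close>; summing \<open>ellip\<close> over the basis vectors \<open>h\<close> gives the
  trace \<open>DIM('a)\<close>.\<close>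

lemma trace_Y:
  assumes p: "s > 0"
  shows "\<sigma> * (\<Sum>e\<in>S. flow_hessian s y (Y e) (Y e)) = PT s y"
proof -
  have "\<sigma> * (\<Sum>e\<in>S. Y e \<bullet> Y e) = (\<Sum>b\<in>(Basis::'a set). \<sigma> * (\<Sum>e\<in>S. (b \<bullet> Y e)\<^sup>2))"
    by (subst euclidean_inner, subst sum.swap) (simp add: sum_distrib_left power2_eq_square inner_commute)
  also have "\<dots> = DIM('a)" by (simp add: ellip)
  finally have tr: "\<sigma> * (\<Sum>e\<in>S. Y e \<bullet> Y e) = DIM('a)" .
  have "\<sigma> * (\<Sum>e\<in>S. hk2 s w (Y e) (Y e)) = hkT s w" for w :: 'a
  proof -
    have "\<sigma> * (\<Sum>e\<in>S. hk2 s w (Y e) (Y e)) =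
      (\<sigma> * (\<Sum>e\<in>S. (w \<bullet> Y e)\<^sup>2) / (4 * s\<^sup>2) - \<sigma> * (\<Sum>e\<in>S. Y e \<bullet> Y e) / (2 * s)) * hk s w"
      by (simp add: hk2_def sum_distrib_right[symmetric] sum_subtractf sum_divide_distrib[symmetric]
          power2_eq_square[symmetric] right_diff_distrib)
    then show ?thesis by (simp add: hkT_def ellip tr)
  qed
  then have "f z * hkT s w = \<sigma> * (\<Sum>e\<in>S. f z * hk2 s w (Y e) (Y e))" for z w
    unfolding sum_distrib_left[symmetric] by (simp only: mult.left_commute[of \<sigma>])
  then have "PT s y = integral (cbox lo hi) (\<lambda>z. \<sigma> * (\<Sum>e\<in>S. f z * hk2 s (y - z) (Y e) (Y e)))"
    unfolding PT_def by (simp only:)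
  also have "\<dots> = \<sigma> * integral (cbox lo hi) (\<lambda>z. \<Sum>e\<in>S. f z * hk2 s (y - z) (Y e) (Y e))"
    by (rule integral_mult_right)
  also have "integral (cbox lo hi) (\<lambda>z. \<Sum>e\<in>S. f z * hk2 s (y - z) (Y e) (Y e)) = (\<Sum>e\<in>S. flow_hessian s y (Y e) (Y e))"
    unfolding flow_hessian_def
    by (rule integral_sum[OF finite_subset[OF S finite_Basis] integrable_continuous[OF continuous_kernels(3)[OF p]]])
  finally show ?thesis by simp
qed

text \<open>The terms without a derivative of the cutoff combine to the cutoff times the limit,
  since \<open>trace_Y\<close> cancels \<open>PT\<close>; every remaining term carries a factor
  \<open>cutoff1\<close> or \<open>cutoff2\<close>.\<close>

lemma gen_testP:
  "gen (testP n) t z = cutoff n z * gen_lim t z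
     + \<eta> t * ((\<Sum>e\<in>Basis. (c t z \<bullet> e) * cutoff1 n z e) * P (\<tau> - t) (Y z)
        + \<sigma> * (\<Sum>e\<in>S. cutoff2 n z e * P (\<tau> - t) (Y z) + 2 * cutoff1 n z e * P1 (\<tau> - t) (Y z) (Y e)))"
proof (cases "\<eta> t = 0")
  case True
  then show ?thesis by (simp add: generator_def generator_lim_def pd_time_testP pd_space_testP pd2_space_testP)
next
  case False
  note p = pos_time[OF False]
  let ?s = "\<tau> - t"
  interpret Y: bounded_linear Y by (rule Y)
  have 1: "(\<Sum>e\<in>Basis. (c t z \<bullet> e) * P1 ?s (Y z) (Y e)) = gradP ?s (Y z) \<bullet> Y (c t z)"
  proof -
    have "Y (c t z) = (\<Sum>e\<in>Basis. (c t z \<bullet> e) *\<^sub>R Y e)"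
      by (subst euclidean_representation[symmetric]) (simp add: Y.sum Y.scaleR)
    then show ?thesis by (simp add: P1_eq_inner[OF p] inner_sum_right)
  qed
  have 2: "(\<Sum>e\<in>Basis. (c t z \<bullet> e) * (\<eta> t * (cutoff1 n z e * P ?s (Y z) + P1 ?s (Y z) (Y e) * cutoff n z)))
      = \<eta> t * ((\<Sum>e\<in>Basis. (c t z \<bullet> e) * cutoff1 n z e) * P ?s (Y z) + cutoff n z * (gradP ?s (Y z) \<bullet> Y (c t z)))"
    unfolding 1[symmetric] sum_distrib_left sum_distrib_right sum.distrib[symmetric]
    by (rule sum.cong) (auto simp: algebra_simps)
  have 3: "(\<Sum>e\<in>S. \<eta> t * (cutoff2 n z e * P ?s (Y z) + 2 * cutoff1 n z e * P1 ?s (Y z) (Y e)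
       + cutoff n z * flow_hessian ?s (Y z) (Y e) (Y e)))
      = \<eta> t * (\<Sum>e\<in>S. cutoff2 n z e * P ?s (Y z) + 2 * cutoff1 n z e * P1 ?s (Y z) (Y e))
       + \<eta> t * cutoff n z * (\<Sum>e\<in>S. flow_hessian ?s (Y z) (Y e) (Y e))"
    unfolding sum_distrib_left sum.distrib[symmetric]
    by (rule sum.cong) (auto simp: algebra_simps)
  show ?thesis
    unfolding generator_def generator_lim_def pd_time_testP pd_space_testP pd2_space_testP 2 3
    by (simp add: trace_Y[OF p, symmetric] algebra_simps)
qed

text \<open>The sequence is eventually constant: once n reaches |z|, the cutoff is 1 and its
  derivatives are 0 at z.\<close>

lemma gen_testP_tendsto: "(\<lambda>n. gen (testP (real n)) t z) \<longlonglongrightarrow> gen_lim t z"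
proof (rule tendsto_eventually)
  show "\<forall>\<^sub>F n in sequentially. gen (testP (real n)) t z = gen_lim t z"
    using eventually_gt_at_top[of "0::nat"] eventually_ge_at_top[of "nat \<lceil>norm z\<rceil>"]
  proof eventually_elim
    case (elim n)
    then have n: "real n > 0" "norm z \<le> real n" by (auto simp: nat_le_iff ceiling_le_iff)
    show ?case unfolding gen_testP by (simp add: cutoff_1[OF n] cutoff_derivs_0[OF n])
  qed
qed

text \<open>Supplies the dominating function for n to infinity, linear in any majorant
  \<open>w\<close> of the drift that is at least 1. Uniformity in t holds because the flow time is
  at least \<tau> - \<beta> on the support of \<eta>.\<close>

lemma gen_bounded:
  obtains C where "C \<ge> 0"
    "\<And>n t z w. n \<ge> 1 \<Longrightarrow> norm (c t z) \<le> w \<Longrightarrow> 1 \<le> w \<Longrightarrow> \<bar>gen (testP n) t z\<bar> \<le> C * w"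
proof -
  obtain C where C: "C \<ge> 0"
    "\<And>(n::real) (z::'e) e. n \<ge> 1 \<Longrightarrow> norm e \<le> 1 \<Longrightarrow> \<bar>cutoff1 n z e\<bar> \<le> C"
    "\<And>(n::real) (z::'e) e. n \<ge> 1 \<Longrightarrow> norm e \<le> 1 \<Longrightarrow> \<bar>cutoff2 n z e\<bar> \<le> C"
    by (rule cutoff_derivs_bounded) blast
  obtain L where L: "\<And>e. norm (Y e) \<le> norm e * L" "L > 0"
    using bounded_linear.pos_bounded[OF Y] by blast
  have bd: "\<exists>M. \<forall>t. \<bar>g t\<bar> \<le> M" if "smooth_on UNIV g" "\<And>t. t \<notin> {\<alpha>..\<beta>} \<Longrightarrow> g t = 0" for g
  proof -
    have "compact (g ` {\<alpha>..\<beta>})"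
      by (intro compact_continuous_image continuous_on_subset[OF smooth_on_imp_continuous_on[OF that(1)]]) auto
    then obtain M where M: "\<forall>t\<in>{\<alpha>..\<beta>}. \<bar>g t\<bar> \<le> M"
      by (auto dest!: compact_imp_bounded simp: bounded_iff)
    then have "\<bar>g t\<bar> \<le> max M 0" for t using that(2)[of t] by (cases "t \<in> {\<alpha>..\<beta>}") (auto simp: le_max_iff_disj)
    then show ?thesis by blast
  qed
  obtain M1 where M1: "\<And>t. \<bar>\<eta> t\<bar> \<le> M1" using bd[OF \<eta> \<eta>_supp] by blast
  obtain M2 where M2: "\<And>t. \<bar>pd 1 \<eta> t\<bar> \<le> M2" using bd[OF smooth_on_pd[OF \<eta>] pd_eta_outside] by auto
  have M: "M1 \<ge> 0" "M2 \<ge> 0" using M1[of 0] M2[of 0] by linarith+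
  define g where "g = flowC1 TYPE('a) / sqrt (\<tau> - \<beta>)"
  have g0: "g \<ge> 0" using flowC1_pos[where 'a='a] \<beta>_less by (simp add: g_def)
  define D where "D = real DIM('e)"
  \<comment> \<open>\<open>Q\<close> collects the errors caused by the cutoff, \<open>B\<close> adds
    the contribution of \<open>generator_lim\<close>. Terms that do not grow with the drift are
    multiplied by \<open>w\<close>, which is at least 1.\<close>
  define Q where "Q = D * C + \<bar>\<sigma>\<bar> * (real (card S) * (C + 2 * C * (g * L)))"
  define B where "B = M2 + M1 * (g * L) + M1 * Q"
  have Q0: "Q \<ge> 0" using C(1) g0 L(2) by (auto simp: Q_def D_def)
  show thesis
  proof
    show "B \<ge> 0" using M Q0 g0 L(2) by (auto simp: B_def)
    fix n t :: real and z w assume n: "n \<ge> 1" and w: "norm (c t z) \<le> w" "1 \<le> w"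
    show "\<bar>gen (testP n) t z\<bar> \<le> B * w"
    proof (cases "t \<in> {\<alpha>..\<beta>}")
      case False
      then have "gen (testP n) t z = 0"
        by (simp add: gen_testP generator_lim_def \<eta>_supp pd_eta_outside)
      then show ?thesis using w \<open>B \<ge> 0\<close> by simp
    next
      case True
      then have p: "\<tau> - t > 0" and pb: "\<tau> - \<beta> > 0" "t \<le> \<beta>" using \<beta>_less by auto
      have gt: "flowC1 TYPE('a) / sqrt (\<tau> - t) \<le> g"
        unfolding g_def using pb flowC1_pos[where 'a='a] by (intro divide_left_mono) auto
      have P: "\<bar>P (\<tau> - t) (Y z)\<bar> \<le> 1" by (rule P_bound[OF p])
      have grad: "\<bar>gradP (\<tau> - t) (Y z) \<bullet> Y (c t z)\<bar> \<le> g * L * w"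
      proof -
        have "\<bar>gradP (\<tau> - t) (Y z) \<bullet> Y (c t z)\<bar> \<le> norm (gradP (\<tau> - t) (Y z)) * norm (Y (c t z))"
          by (rule Cauchy_Schwarz_ineq2)
        also have "\<dots> \<le> g * (w * L)"
        proof (rule mult_mono)
          show "norm (gradP (\<tau> - t) (Y z)) \<le> g" using norm_gradP[OF p] gt by (rule order_trans)
          show "norm (Y (c t z)) \<le> w * L"
            using L(1)[of "c t z"] mult_right_mono[OF w(1), of L] L(2) by linarith
        qed (use g0 in auto)
        finally show ?thesis by (simp add: mult_ac)
      qed
      have lim: "\<bar>gen_lim t z\<bar> \<le> M2 * w + M1 * (g * L * w)"
      proof -
        have "\<bar>pd 1 \<eta> t * P (\<tau> - t) (Y z)\<bar> \<le> M2 * 1"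
          unfolding abs_mult using P M2[of t] M by (intro mult_mono) auto
        moreover have "M2 * 1 \<le> M2 * w" using w M by (intro mult_left_mono) auto
        moreover have "\<bar>\<eta> t * (gradP (\<tau> - t) (Y z) \<bullet> Y (c t z))\<bar> \<le> M1 * (g * L * w)"
          unfolding abs_mult using M1[of t] grad M by (intro mult_mono) auto
        ultimately show ?thesis unfolding generator_lim_def by linarith
      qed
      have P1: "\<bar>P1 (\<tau> - t) (Y z) (Y e)\<bar> \<le> g * L" if "e \<in> Basis" for e
      proof -
        have "\<bar>P1 (\<tau> - t) (Y z) (Y e)\<bar> \<le> flowC1 TYPE('a) / sqrt (\<tau> - t) * norm (Y e)" by (rule P1_bound[OF p])
        also have "\<dots> \<le> g * L" using L(1)[of e] that gt g0 by (intro mult_mono) auto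
        finally show ?thesis .
      qed
      have s1: "\<bar>(\<Sum>e\<in>Basis. (c t z \<bullet> e) * cutoff1 n z e) * P (\<tau> - t) (Y z)\<bar> \<le> D * C * w"
      proof -
        have "\<bar>(\<Sum>e\<in>Basis. (c t z \<bullet> e) * cutoff1 n z e)\<bar> \<le> (\<Sum>e\<in>(Basis::'e set). w * C)"
          using w(1) order_trans[OF zero_le_one w(2)] Basis_le_norm[of _ "c t z"] C(1) C(2)[OF n]
          by (intro order_trans[OF sum_abs sum_mono])
             (auto simp: abs_mult intro!: mult_mono intro: order_trans)
        also have "\<dots> = D * C * w" by (simp add: D_def)
        finally have "\<bar>(\<Sum>e\<in>Basis. (c t z \<bullet> e) * cutoff1 n z e)\<bar> \<le> D * C * w" .
        from mult_mono[OF this P] show ?thesis using C(1) w by (simp add: abs_mult D_def)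
      qed
      have s2: "\<bar>\<Sum>e\<in>S. cutoff2 n z e * P (\<tau> - t) (Y z) + 2 * cutoff1 n z e * P1 (\<tau> - t) (Y z) (Y e)\<bar>
          \<le> real (card S) * (C + 2 * C * (g * L))"
      proof -
        have "\<bar>cutoff2 n z e * P (\<tau> - t) (Y z) + 2 * cutoff1 n z e * P1 (\<tau> - t) (Y z) (Y e)\<bar> \<le> C + 2 * C * (g * L)"
          if "e \<in> S" for e
        proof -
          have e: "e \<in> Basis" using that S by auto
          have "\<bar>cutoff2 n z e * P (\<tau> - t) (Y z)\<bar> \<le> C * 1"
            unfolding abs_mult using C(3)[OF n, of e z] e P C(1) by (intro mult_mono) auto
          moreover have "\<bar>(2 * cutoff1 n z e) * P1 (\<tau> - t) (Y z) (Y e)\<bar> \<le> (2 * C) * (g * L)"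
            unfolding abs_mult[of "2 * cutoff1 n z e"] using C(2)[OF n, of e z] e P1[OF e] C(1) by (intro mult_mono) auto
          ultimately show ?thesis by linarith
        qed
        then show ?thesis by (intro order_trans[OF sum_abs sum_bounded_above])
      qed
      let ?E = "(\<Sum>e\<in>Basis. (c t z \<bullet> e) * cutoff1 n z e) * P (\<tau> - t) (Y z)
        + \<sigma> * (\<Sum>e\<in>S. cutoff2 n z e * P (\<tau> - t) (Y z) + 2 * cutoff1 n z e * P1 (\<tau> - t) (Y z) (Y e))"
      have "\<bar>?E\<bar> \<le> D * C * w + \<bar>\<sigma>\<bar> * (real (card S) * (C + 2 * C * (g * L)))"
        using s1 mult_left_mono[OF s2, of "\<bar>\<sigma>\<bar>"] unfolding abs_mult[of \<sigma>, symmetric]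
        by (intro order_trans[OF abs_triangle_ineq add_mono]) (auto simp: abs_mult)
      also have "\<dots> \<le> D * C * w + \<bar>\<sigma>\<bar> * (real (card S) * (C + 2 * C * (g * L))) * w"
      proof -
        have "\<bar>\<sigma>\<bar> * (real (card S) * (C + 2 * C * (g * L))) \<ge> 0" using C(1) g0 L(2) by auto
        from mult_left_mono[OF w(2) this] show ?thesis by linarith
      qed
      also have "\<dots> = Q * w" by (simp add: Q_def algebra_simps)
      finally have "\<bar>\<eta> t * ?E\<bar> \<le> M1 * (Q * w)"
        unfolding abs_mult[of "\<eta> t"] using M1[of t] M by (intro mult_mono) auto
      moreover have "\<bar>cutoff n z * gen_lim t z\<bar> \<le> 1 * (M2 * w + M1 * (g * L * w))"
        unfolding abs_mult using cutoff_bounds[of n z] lim by (intro mult_mono) auto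
      ultimately have "\<bar>gen (testP n) t z\<bar> \<le> 1 * (M2 * w + M1 * (g * L * w)) + M1 * (Q * w)"
        unfolding gen_testP by linarith
      also have "\<dots> = B * w" by (simp add: B_def algebra_simps)
      finally show ?thesis .
    qed
  qed
qed

text \<open>Removes the spatial cutoff by dominated convergence on two levels: under
  \<open>\<nu> t\<close> with majorant \<open>C * \<omega>\<close>, and in time with the constant
  \<open>C * W\<close>.\<close>

lemma weak_limit:
  fixes \<nu> :: "real \<Rightarrow> 'e measure" and \<omega> :: "'e \<Rightarrow> real"
  assumes \<alpha>: "0 < \<alpha>" and \<beta>: "\<beta> < T"
    and weak: "\<And>\<phi>. test_fun ({0<..<T} \<times> UNIV) \<phi> \<Longrightarrow> (\<forall>t\<in>{0<..<T}. integrable (\<nu> t) (gen \<phi> t)) \<and>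
      set_integrable lborel {0<..<T} (\<lambda>t. \<integral>z. gen \<phi> t z \<partial>\<nu> t) \<and>
      (LINT t:{0<..<T}|lborel. (\<integral>z. gen \<phi> t z \<partial>\<nu> t)) = 0"
    and sets: "\<And>t. t \<in> {0<..<T} \<Longrightarrow> sets (\<nu> t) = sets borel"
    and meas: "\<And>t. t \<in> {0<..<T} \<Longrightarrow> (\<lambda>z. Y (c t z)) \<in> borel_measurable borel"
    and growth: "\<And>t z. t \<in> {0<..<T} \<Longrightarrow> norm (c t z) \<le> \<omega> z" "\<And>z. 1 \<le> \<omega> z"
    and \<omega>: "\<And>t. t \<in> {0<..<T} \<Longrightarrow> integrable (\<nu> t) \<omega>" "\<And>t. t \<in> {0<..<T} \<Longrightarrow> (\<integral>z. \<omega> z \<partial>\<nu> t) \<le> W"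
  shows "set_integrable lborel {0<..<T} (\<lambda>t. \<integral>z. gen_lim t z \<partial>\<nu> t)"
    and "(LINT t:{0<..<T}|lborel. (\<integral>z. gen_lim t z \<partial>\<nu> t)) = 0"
proof -
  obtain C where C: "C \<ge> 0"
    "\<And>n t z w. n \<ge> 1 \<Longrightarrow> norm (c t z) \<le> w \<Longrightarrow> 1 \<le> w \<Longrightarrow> \<bar>gen (testP n) t z\<bar> \<le> C * w"
    by (rule gen_bounded) blast
  let ?\<phi> = "\<lambda>n. testP (real (Suc n))"
  have tf: "test_fun ({0<..<T} \<times> UNIV) (?\<phi> n)" for n
    by (rule testP_test_fun) (use \<alpha> \<beta> in auto)
  note w = weak[OF tf]
  have bd: "\<bar>gen (?\<phi> n) t z\<bar> \<le> C * \<omega> z" if "t \<in> {0<..<T}" for n t z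
    by (rule C(2)) (use growth that in auto)
  have lim_meas: "gen_lim t \<in> borel_measurable (\<nu> t)" if t: "t \<in> {0<..<T}" for t
  proof (cases "t \<in> {\<alpha>..\<beta>}")
    case False
    then have "gen_lim t = (\<lambda>_. 0)" by (auto simp: generator_lim_def \<eta>_supp pd_eta_outside)
    then show ?thesis by simp
  next
    case True
    then have p: "\<tau> - t > 0" using \<beta>_less by auto
    have [measurable]: "P (\<tau> - t) \<in> borel_measurable borel" "gradP (\<tau> - t) \<in> borel_measurable borel"
      by (intro borel_measurable_continuous_onI continuous_on_P continuous_on_gradP p)+
    have [measurable]: "Y \<in> borel_measurable borel"
      by (intro borel_measurable_continuous_onI linear_continuous_on Y)
    note [measurable] = meas[OF t]
    have "gen_lim t \<in> borel_measurable borel" unfolding generator_lim_def[abs_def] by measurable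
    then show ?thesis using measurable_cong_sets[OF sets[OF t] refl] by blast
  qed
  have inner: "(\<lambda>n. \<integral>z. gen (?\<phi> n) t z \<partial>\<nu> t) \<longlonglongrightarrow> (\<integral>z. gen_lim t z \<partial>\<nu> t)" if t: "t \<in> {0<..<T}" for t
  proof (rule integral_dominated_convergence[where w="\<lambda>z. C * \<omega> z"])
    show "gen (?\<phi> n) t \<in> borel_measurable (\<nu> t)" for n using w[of n] t by (auto dest: borel_measurable_integrable)
    show "AE z in \<nu> t. (\<lambda>n. gen (?\<phi> n) t z) \<longlonglongrightarrow> gen_lim t z"
      by (rule AE_I2) (rule LIMSEQ_Suc[OF gen_testP_tendsto])
    show "AE z in \<nu> t. norm (gen (?\<phi> n) t z) \<le> C * \<omega> z" for n
      using bd[OF t] by auto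
  qed (use \<omega>(1)[OF t] lim_meas[OF t] in auto)
  let ?s = "\<lambda>n t. indicator {0<..<T} t *\<^sub>R (\<integral>z. gen (?\<phi> n) t z \<partial>\<nu> t)"
  let ?l = "\<lambda>t. indicator {0<..<T} t *\<^sub>R (\<integral>z. gen_lim t z \<partial>\<nu> t)"
  have sm: "?s n \<in> borel_measurable lborel" for n
    using w[of n] unfolding set_integrable_def by (auto dest: borel_measurable_integrable)
  have lim: "(\<lambda>n. ?s n t) \<longlonglongrightarrow> ?l t" for t
    using inner[of t] by (cases "t \<in> {0<..<T}") auto
  \<comment> \<open>The weak formulation provides measurability in t for test functions; the limit
    inherits it from the approximating integrals.\<close>
  have lm: "?l \<in> borel_measurable lborel"
    by (rule borel_measurable_LIMSEQ_metric[OF sm lim])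
  have dom: "norm (?s n t) \<le> indicator {0<..<T} t *\<^sub>R (C * W)" for n t
  proof (cases "t \<in> {0<..<T}")
    case True
    have "\<bar>\<integral>z. gen (?\<phi> n) t z \<partial>\<nu> t\<bar> \<le> (\<integral>z. \<bar>gen (?\<phi> n) t z\<bar> \<partial>\<nu> t)" by (rule integral_abs_bound)
    also have "\<dots> \<le> (\<integral>z. C * \<omega> z \<partial>\<nu> t)"
      using w[of n] True \<omega>(1)[OF True] bd[OF True] by (intro integral_mono) auto
    also have "\<dots> \<le> C * W" using \<omega>[OF True] C(1) by (simp add: mult_left_mono)
    finally show ?thesis using True by simp
  qed auto
  have wi: "integrable lborel (\<lambda>t. indicator {0<..<T} t *\<^sub>R (C * W))"
    by (intro integrable_scaleR_left integrable_real_indicator) (use emeasure_lborel_box_finite[of 0 T] in auto)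
  note dc = lm sm wi AE_I2[OF lim] AE_I2[OF dom]
  show "set_integrable lborel {0<..<T} (\<lambda>t. \<integral>z. gen_lim t z \<partial>\<nu> t)"
    unfolding set_integrable_def by (rule integrable_dominated_convergence[OF dc]) 
  have "(\<lambda>n. LINT t|lborel. ?s n t) \<longlonglongrightarrow> (LINT t|lborel. ?l t)"
    by (rule integral_dominated_convergence[OF dc])
  moreover have "(LINT t|lborel. ?s n t) = 0" for n
    using w[of n] by (auto simp: set_lebesgue_integral_def)
  ultimately have "(\<lambda>n::nat. 0) \<longlonglongrightarrow> (LINT t|lborel. ?l t)" by simp
  then show "(LINT t:{0<..<T}|lborel. (\<integral>z. gen_lim t z \<partial>\<nu> t)) = 0"
    unfolding set_lebesgue_integral_def by (simp add: LIMSEQ_const_iff)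
qed

end

end

section \<open>Integrating a weak time derivative\<close>

text \<open>The derivative of \<eta> lives on {p..q}, where \<open>A\<close> is nearly the constant
  \<open>a\<close>; replacing \<open>A\<close> by \<open>a\<close> leaves the total increment of
  \<eta>, and the error is sup bound times oscillation times length.\<close>

lemma concentrated_derivative:
  fixes A \<eta> \<eta>' :: "real \<Rightarrow> real"
  assumes uv: "u \<le> v" and pq: "{p..q} \<subseteq> {u..v}" "p \<le> q"
    and D: "\<And>t. t \<in> {u..v} \<Longrightarrow> (\<eta> has_real_derivative \<eta>' t) (at t)"
    and cont: "continuous_on {u..v} \<eta>'" "continuous_on {u..v} A"
    and zero: "\<And>t. t \<in> {u..v} \<Longrightarrow> t \<notin> {p..q} \<Longrightarrow> \<eta>' t = 0"
    and K: "\<And>t. t \<in> {u..v} \<Longrightarrow> \<bar>\<eta>' t\<bar> \<le> K"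
    and \<delta>: "\<And>t. t \<in> {p..q} \<Longrightarrow> \<bar>A t - a\<bar> \<le> \<delta>"
  shows "\<bar>integral {u..v} (\<lambda>t. \<eta>' t * A t) - (\<eta> v - \<eta> u) * a\<bar> \<le> K * \<delta> * (q - p)"
proof -
  have i: "(\<lambda>t. \<eta>' t * A t) integrable_on {u..v}" "(\<lambda>t. \<eta>' t * (A t - a)) integrable_on {u..v}"
    by (intro integrable_continuous_real continuous_intros cont)+
  have ftc: "(\<eta>' has_integral (\<eta> v - \<eta> u)) {u..v}"
    by (rule fundamental_theorem_of_calculus[OF uv])
       (use D in \<open>auto simp: has_real_derivative_iff_has_vector_derivative[symmetric] intro: has_field_derivative_at_within\<close>)
  have "integral {u..v} (\<lambda>t. \<eta>' t * (A t - a)) = integral {u..v} (\<lambda>t. \<eta>' t * A t) - integral {u..v} (\<lambda>t. \<eta>' t * a)"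
    using i(1) has_integral_integrable[OF has_integral_mult_left[OF ftc, of a]]
    by (simp add: right_diff_distrib integral_diff)
  also have "integral {u..v} (\<lambda>t. \<eta>' t * a) = (\<eta> v - \<eta> u) * a"
    by (rule integral_unique[OF has_integral_mult_left[OF ftc]])
  finally have eq: "integral {u..v} (\<lambda>t. \<eta>' t * A t) - (\<eta> v - \<eta> u) * a = integral {u..v} (\<lambda>t. \<eta>' t * (A t - a))"
    by simp
  have g: "((\<lambda>t. if t \<in> {p..q} then K * \<delta> else 0) has_integral (K * \<delta> * (q - p))) {u..v}"
    using has_integral_const_real[of "K * \<delta>" p q] pq
    by (subst has_integral_restrict) (auto simp: mult.commute)
  have "norm (integral {u..v} (\<lambda>t. \<eta>' t * (A t - a))) \<le> integral {u..v} (\<lambda>t. if t \<in> {p..q} then K * \<delta> else 0)"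
  proof (rule integral_norm_bound_integral[OF i(2)])
    show "(\<lambda>t. if t \<in> {p..q} then K * \<delta> else 0) integrable_on {u..v}" using g by blast
    fix t assume t: "t \<in> {u..v}"
    show "norm (\<eta>' t * (A t - a)) \<le> (if t \<in> {p..q} then K * \<delta> else 0)"
    proof (cases "t \<in> {p..q}")
      case True
      have "\<bar>\<eta>' t\<bar> * \<bar>A t - a\<bar> \<le> K * \<delta>"
        using K[OF t] \<delta>[OF True] by (intro mult_mono) auto
      then show ?thesis using True by (simp add: abs_mult)
    qed (use zero[OF t] in auto)
  qed
  then show ?thesis unfolding eq integral_unique[OF g] by simp
qed

text \<open>For large k a plateau inside (0, t1): it rises on [1/k, 2/k] and falls on
  [t1 - 2/k, t1 - 1/k].\<close>

definition time_step :: "real \<Rightarrow> real \<Rightarrow> real \<Rightarrow> real" where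
  "time_step t1 k t = smooth_step (k * t - 1) * smooth_step (k * (t1 - t) - 1)"

definition time_step' :: "real \<Rightarrow> real \<Rightarrow> real \<Rightarrow> real" where
  "time_step' t1 k t = (k * smooth_step' (k * t - 1)) * smooth_step (k * (t1 - t) - 1)
     - (k * smooth_step' (k * (t1 - t) - 1)) * smooth_step (k * t - 1)"

lemma DERIV_time_step: "(time_step t1 k has_real_derivative time_step' t1 k t) (at t)"
proof -
  have 1: "((\<lambda>t. smooth_step (k * t - 1)) has_real_derivative smooth_step' (k * t - 1) * k) (at t)"
    by (rule DERIV_chain2[OF DERIV_smooth_step]) (auto intro!: derivative_eq_intros)
  have 2: "((\<lambda>t. smooth_step (k * (t1 - t) - 1)) has_real_derivative smooth_step' (k * (t1 - t) - 1) * (- k)) (at t)"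
    by (rule DERIV_chain2[OF DERIV_smooth_step]) (auto intro!: derivative_eq_intros)
  show ?thesis
    unfolding time_step_def[abs_def] time_step'_def
    by (rule DERIV_cong[OF DERIV_mult[OF 1 2]]) (simp add: algebra_simps)
qed

lemma smooth_time_step: "smooth_on UNIV (time_step t1 k)"
proof -
  have l: "smooth_on UNIV (\<lambda>t::real. a * t - b)" for a b
    by (rule smooth_on_diff[OF _ smooth_on_linear smooth_on_const]) (auto intro: bounded_linear_mult_right)
  have 1: "smooth_on UNIV (\<lambda>t. smooth_step (k * t - 1))"
    by (rule smooth_on_compose[OF smooth_on_smooth_step _ _ l]) auto
  have "smooth_on UNIV (\<lambda>t. k * (t1 - t) - 1)"
    by (rule smooth_on_cong[OF _ l[of "- k" "1 - k * t1"]]) (auto simp: algebra_simps)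
  from smooth_on_compose[OF smooth_on_smooth_step _ _ this]
  have 2: "smooth_on UNIV (\<lambda>t. smooth_step (k * (t1 - t) - 1))" by auto
  show ?thesis unfolding time_step_def[abs_def] by (rule smooth_on_mult[OF _ 1 2]) simp
qed

lemma pd_time_step: "pd 1 (time_step t1 k) t = time_step' t1 k t"
  using DERIV_unique[OF smooth_on_real_DERIV[OF smooth_time_step, of t t1 k] DERIV_time_step] by simp

lemma time_step_0:
  assumes "k > 0" "t \<notin> {1 / k..t1 - 1 / k}" shows "time_step t1 k t = 0"
proof -
  have "k * t - 1 \<le> 0 \<or> k * (t1 - t) - 1 \<le> 0" using assms by (auto simp: field_simps)
  then show ?thesis by (auto simp: time_step_def smooth_step_0)
qed

lemma time_step_bounds: "0 \<le> time_step t1 k t" "time_step t1 k t \<le> 1"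
  using smooth_step_bounds[of "k * t - 1"] smooth_step_bounds[of "k * (t1 - t) - 1"]
  by (auto simp: time_step_def mult_le_one)

lemma time_step_mid:
  assumes "k * t1 \<ge> 4" shows "time_step t1 k (t1 / 2) = 1" 
  using assms by (simp add: time_step_def smooth_step_1)

lemma continuous_on_time_step': "continuous_on S (time_step' t1 k)"
proof -
  have s: "continuous_on UNIV smooth_step" "continuous_on UNIV smooth_step'"
    by (intro smooth_on_imp_continuous_on smooth_on_smooth_step smooth_on_smooth_step')+
  show ?thesis unfolding time_step'_def[abs_def]
    by (intro continuous_intros continuous_on_compose2[OF s(1)] continuous_on_compose2[OF s(2)]) auto
qed

text \<open>The derivative of the plateau approximates the difference of the point masses at 0 and
  \<open>t1\<close>. The interval is halved so that each half contains a single ramp.\<close>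

lemma time_step_derivative_limit:
  assumes t1: "t1 > 0" and A: "continuous_on {0..t1} A" and e: "e > 0"
  obtains k where "k > 0" "\<bar>integral {0..t1} (\<lambda>t. time_step' t1 k t * A t) - (A 0 - A t1)\<bar> \<le> e"
proof -
  obtain M where M: "M \<ge> 0" "\<And>x. \<bar>smooth_step' x\<bar> \<le> M"
    by (rule smooth_step_derivs_bounded) blast
  \<comment> \<open>On each half the derivative is at most k M and lives on a length 2 / k, so the
    error is 2 M \<delta>. The additional 4 keeps the denominator positive when M = 0.\<close>
  define \<delta> where "\<delta> = e / (4 * M + 4)"
  have \<delta>: "\<delta> > 0" using e M by (simp add: \<delta>_def)
  obtain d where d: "d > 0" "\<And>s t. s \<in> {0..t1} \<Longrightarrow> t \<in> {0..t1} \<Longrightarrow> dist s t < d \<Longrightarrow> dist (A s) (A t) < \<delta>"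
    using compact_uniformly_continuous[OF A compact_Icc] \<delta> unfolding uniformly_continuous_on_def by metis
  \<comment> \<open>The bound 4 / t1 keeps the ramps in separate halves; 4 / d makes the intervals
    of length 2 / k shorter than the modulus of continuity \<open>d\<close>.\<close>
  define k where "k = max (4 / t1) (4 / d)"
  have k: "k > 0" "k * t1 \<ge> 4" "2 / k < d" "2 / k \<le> t1 / 2"
  proof -
    show k0: "k > 0" using t1 by (simp add: k_def less_max_iff_disj)
    have "k \<ge> 4 / t1" "k \<ge> 4 / d" by (auto simp: k_def)
    then show k4: "k * t1 \<ge> 4" and "2 / k < d" using t1 d(1) k0 by (auto simp: field_simps)
    from k4 k0 show "2 / k \<le> t1 / 2" by (auto simp: field_simps)
  qed
  let ?h = "t1 / 2"
  have kh: "k * ?h \<ge> 2" using k(2) by simp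
  have s0: "0 \<le> 2 / k" using k by simp
  have left: "\<bar>integral {0..?h} (\<lambda>t. time_step' t1 k t * A t) - (time_step t1 k ?h - time_step t1 k 0) * A 0\<bar>
      \<le> (k * M) * \<delta> * (2 / k - 0)"
  proof (rule concentrated_derivative)
    have eq: "time_step' t1 k t = k * smooth_step' (k * t - 1)" if "t \<in> {0..?h}" for t
    proof -
      have "k * (t1 - t) \<ge> k * ?h" using that k by (intro mult_left_mono) auto
      then have "k * (t1 - t) - 1 \<ge> 1" using kh by linarith
      then show ?thesis by (simp add: time_step'_def smooth_step_1 smooth_step'_0)
    qed
    show "time_step' t1 k t = 0" if "t \<in> {0..?h}" "t \<notin> {0..2 / k}" for t
      using that k by (auto simp: eq smooth_step'_0 field_simps)
    show "\<bar>time_step' t1 k t\<bar> \<le> k * M" if "t \<in> {0..?h}" for t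
      using that k M by (simp add: eq abs_mult)
    show "\<bar>A t - A 0\<bar> \<le> \<delta>" if "t \<in> {0..2 / k}" for t
      using d(2)[of t 0] that k t1 by (auto simp: dist_real_def)
    show "continuous_on {0..?h} A" by (rule continuous_on_subset[OF A]) (use t1 in auto)
  qed (use t1 k s0 in \<open>auto intro: DERIV_time_step continuous_on_time_step'\<close>)
  have right: "\<bar>integral {?h..t1} (\<lambda>t. time_step' t1 k t * A t) - (time_step t1 k t1 - time_step t1 k ?h) * A t1\<bar>
      \<le> (k * M) * \<delta> * (t1 - (t1 - 2 / k))"
  proof (rule concentrated_derivative)
    have eq: "time_step' t1 k t = - k * smooth_step' (k * (t1 - t) - 1)" if "t \<in> {?h..t1}" for t
    proof -
      have "k * t \<ge> k * ?h" using that k by (intro mult_left_mono) auto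
      then have "k * t - 1 \<ge> 1" using kh by linarith
      then show ?thesis by (simp add: time_step'_def smooth_step_1 smooth_step'_0)
    qed
    show "time_step' t1 k t = 0" if "t \<in> {?h..t1}" "t \<notin> {t1 - 2 / k..t1}" for t
    proof -
      have "2 / k < t1 - t" using that by auto
      then have "k * (t1 - t) - 1 \<ge> 1" using k by (simp add: field_simps)
      then show ?thesis using that by (simp add: eq smooth_step'_0)
    qed
    show "\<bar>time_step' t1 k t\<bar> \<le> k * M" if "t \<in> {?h..t1}" for t
      using that k M by (simp add: eq abs_mult)
    show "\<bar>A t - A t1\<bar> \<le> \<delta>" if "t \<in> {t1 - 2 / k..t1}" for t
      using d(2)[of t t1] that k t1 by (auto simp: dist_real_def)
    show "continuous_on {?h..t1} A" by (rule continuous_on_subset[OF A]) (use t1 in auto)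
  qed (use t1 k s0 in \<open>auto intro: DERIV_time_step continuous_on_time_step'\<close>)
  have "integral {0..t1} (\<lambda>t. time_step' t1 k t * A t) =
      integral {0..?h} (\<lambda>t. time_step' t1 k t * A t) + integral {?h..t1} (\<lambda>t. time_step' t1 k t * A t)"
    by (rule Henstock_Kurzweil_Integration.integral_combine[symmetric])
       (use t1 in \<open>auto intro!: integrable_continuous_real continuous_intros A continuous_on_time_step'\<close>)
  moreover have "time_step t1 k 0 = 0" "time_step t1 k t1 = 0" "time_step t1 k ?h = 1"
    using time_step_0[OF k(1), of 0 t1] time_step_0[OF k(1), of t1 t1] time_step_mid[OF k(2)] k(1) by auto
  moreover have "(k * M) * \<delta> * (2 / k) = 2 * M * \<delta>" using k by simp
  moreover have "4 * M * \<delta> \<le> e" using e M \<delta> unfolding \<delta>_def by (simp add: field_simps)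
  ultimately have "\<bar>integral {0..t1} (\<lambda>t. time_step' t1 k t * A t) - (A 0 - A t1)\<bar> \<le> e"
    using left right by simp
  with k(1) show thesis by (rule that)
qed

text \<open>The weak equation A' = B is tested with plateaus whose derivative tends to the
  difference of point masses at 0 and \<open>t1\<close>. \<open>B\<close> enters only through its
  majorant \<kappa>, which is continuous up to the end points.\<close>

lemma weak_time_derivative_bound:
  fixes A B \<kappa> :: "real \<Rightarrow> real"
  assumes t1: "0 < t1" "t1 \<le> T" and A: "continuous_on {0..t1} A"
    and \<kappa>: "continuous_on {0..t1} \<kappa>" and B: "\<And>t. t \<in> {0<..<t1} \<Longrightarrow> \<bar>B t\<bar> \<le> \<kappa> t"
    and weak: "\<And>\<eta> \<alpha> \<beta>. smooth_on UNIV \<eta> \<Longrightarrow> 0 < \<alpha> \<Longrightarrow> \<beta> < t1 \<Longrightarrow> (\<And>t. t \<notin> {\<alpha>..\<beta>} \<Longrightarrow> \<eta> t = 0) \<Longrightarrow>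
      set_integrable lborel {0<..<T} (\<lambda>t. pd 1 \<eta> t * A t + \<eta> t * B t) \<and>
      (LINT t:{0<..<T}|lborel. pd 1 \<eta> t * A t + \<eta> t * B t) = 0"
  shows "\<bar>A t1 - A 0\<bar> \<le> integral {0..t1} \<kappa>"
proof (rule field_le_epsilon)
  fix e :: real assume e: "e > 0"
  obtain k where k: "k > 0" and lim: "\<bar>integral {0..t1} (\<lambda>t. time_step' t1 k t * A t) - (A 0 - A t1)\<bar> \<le> e"
    by (rule time_step_derivative_limit[OF t1(1) A e])
  let ?\<eta> = "time_step t1 k" and ?\<eta>' = "time_step' t1 k"
  have supp: "t \<notin> {1 / k..t1 - 1 / k} \<Longrightarrow> ?\<eta> t = 0" for t by (rule time_step_0[OF k])
  have sub: "{1 / k..t1 - 1 / k} \<subseteq> {0<..<t1}"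
  proof -
    have "1 / k > 0" using k by simp
    then show ?thesis
      unfolding subset_iff atLeastAtMost_iff greaterThanLessThan_iff by (intro allI impI conjI; linarith)
  qed
  have supp': "?\<eta>' t = 0" if "t \<notin> {0<..<t1}" for t
  proof -
    have "k * t - 1 \<le> 0 \<or> k * (t1 - t) - 1 \<le> 0" "smooth_step (k * t - 1) = 0 \<or> smooth_step (k * (t1 - t) - 1) = 0"
      using that k mult_nonneg_nonpos[of k t] mult_nonneg_nonpos[of k "t1 - t"] by (auto simp: smooth_step_0)
    moreover have "smooth_step' (k * t - 1) = 0" if "t \<le> 0"
      using that k mult_nonneg_nonpos[of k t] by (simp add: smooth_step'_0)
    moreover have "smooth_step' (k * (t1 - t) - 1) = 0" if "t \<ge> t1"
      using that k mult_nonneg_nonpos[of k "t1 - t"] by (simp add: smooth_step'_0)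
    moreover have "smooth_step (k * t - 1) = 0" if "t \<le> 0"
      using that k mult_nonneg_nonpos[of k t] by (simp add: smooth_step_0)
    moreover have "smooth_step (k * (t1 - t) - 1) = 0" if "t \<ge> t1"
      using that k mult_nonneg_nonpos[of k "t1 - t"] by (simp add: smooth_step_0)
    ultimately show ?thesis using that t1 by (auto simp: time_step'_def not_less)
  qed
  note w = weak[OF smooth_time_step _ _ supp, unfolded pd_time_step]
  have "0 < 1 / k" "t1 - 1 / k < t1" using k by auto
  note w = w[OF this]
  have si: "set_integrable lborel {0..t1} (\<lambda>t. ?\<eta>' t * A t)"
    by (rule borel_integrable_atLeastAtMost'[OF continuous_on_mult[OF continuous_on_time_step' A]])
  have int_eq: "(LINT t:{0..t1}|lborel. ?\<eta>' t * A t) = integral {0..t1} (\<lambda>t. ?\<eta>' t * A t)"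
    by (rule set_borel_integral_eq_integral(2)[OF si])
  have \<eta>'_eq: "indicator {0<..<T} t *\<^sub>R (?\<eta>' t * A t) = indicator {0..t1} t *\<^sub>R (?\<eta>' t * A t)" for t
    using supp'[of t] t1 by (cases "t \<in> {0<..<t1}") (auto simp: indicator_def)
  have si': "set_integrable lborel {0<..<T} (\<lambda>t. ?\<eta>' t * A t)"
    using si unfolding set_integrable_def \<eta>'_eq .
  have int_eq': "(LINT t:{0<..<T}|lborel. ?\<eta>' t * A t) = integral {0..t1} (\<lambda>t. ?\<eta>' t * A t)"
    unfolding int_eq[symmetric] set_lebesgue_integral_def \<eta>'_eq ..
  \<comment> \<open>Integrability is known for the sum of both terms; subtracting the continuous one
    isolates the term with \<open>B\<close>.\<close>
  have sB: "set_integrable lborel {0<..<T} (\<lambda>t. ?\<eta> t * B t)"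
    using set_integral_diff(1)[OF conjunct1[OF w] si'] by simp
  have sum0: "(LINT t:{0<..<T}|lborel. ?\<eta>' t * A t) + (LINT t:{0<..<T}|lborel. ?\<eta> t * B t) = 0"
    using set_integral_add(2)[OF si' sB] w by simp
  have s\<kappa>: "set_integrable lborel {0..t1} \<kappa>" by (rule borel_integrable_atLeastAtMost'[OF \<kappa>])
  have "\<bar>LINT t:{0<..<T}|lborel. ?\<eta> t * B t\<bar> \<le> (LINT t:{0..t1}|lborel. \<kappa> t)"
    unfolding set_lebesgue_integral_def
  proof (rule order_trans[OF integral_abs_bound integral_mono])
    show "integrable lborel (\<lambda>t. \<bar>indicator {0<..<T} t *\<^sub>R (?\<eta> t * B t)\<bar>)"
      using sB unfolding set_integrable_def by (rule integrable_abs)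
    show "integrable lborel (\<lambda>t. indicator {0..t1} t *\<^sub>R \<kappa> t)"
      using s\<kappa> unfolding set_integrable_def .
    \<comment> \<open>The bound on \<open>B\<close> concerns the open interval; continuity carries
      the sign of \<kappa> to the end points.\<close>
    have \<kappa>0: "\<kappa> t \<ge> 0" if "t \<in> {0..t1}" for t
    proof -
      have "{0<..<t1} \<subseteq> {t\<in>{0..t1}. 0 \<le> \<kappa> t}" using B by (force intro: order_trans[OF abs_ge_zero])
      moreover have "closed {t\<in>{0..t1}. 0 \<le> \<kappa> t}"
        by (intro continuous_on_closed_Collect_le \<kappa> continuous_on_const) simp
      ultimately have "closure {0<..<t1} \<subseteq> {t\<in>{0..t1}. 0 \<le> \<kappa> t}" by (rule closure_minimal)
      then show ?thesis using that t1 by (auto simp: closure_greaterThanLessThan)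
    qed
    fix t
    show "\<bar>indicator {0<..<T} t *\<^sub>R (?\<eta> t * B t)\<bar> \<le> indicator {0..t1} t *\<^sub>R \<kappa> t"
    proof (cases "t \<in> {1 / k..t1 - 1 / k}")
      case True
      then have t: "t \<in> {0<..<t1}" using sub by blast
      have "\<bar>?\<eta> t * B t\<bar> \<le> 1 * \<kappa> t"
        unfolding abs_mult using time_step_bounds[of t1 k t] B[OF t] by (intro mult_mono) auto
      then show ?thesis using t t1 by auto
    next
      case False
      then show ?thesis using \<kappa>0[of t] by (auto simp: supp indicator_def)
    qed
  qed
  also have "\<dots> = integral {0..t1} \<kappa>" by (rule set_borel_integral_eq_integral(2)[OF s\<kappa>])
  finally show "\<bar>A t1 - A 0\<bar> \<le> integral {0..t1} \<kappa> + e"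
    using lim sum0 unfolding int_eq' by linarith
qed

section \<open>Total variation and relative entropy\<close>

text \<open>Compares the Hellinger integrand with the entropy integrand. It is the inequality ln y
  <= y - 1 at y = 1 / sqrt x; at x = 0 both sides equal 1.\<close>

lemma sqrt_diff_sq_le_entropy:
  assumes "x \<ge> 0" shows "(sqrt x - 1)\<^sup>2 \<le> x * ln x - x + 1"
proof (cases "x = 0")
  case False
  then have x: "x > 0" using assms by simp
  let ?s = "sqrt x"
  have s: "?s > 0" "?s * ?s = x" using x by auto
  have "ln (inverse ?s) \<le> inverse ?s - 1" using s by (intro ln_le_minus_one) simp
  then have "2 * x * (1 - inverse ?s) \<le> 2 * x * ln ?s"
    using s x by (intro mult_left_mono) (auto simp: ln_inverse)
  also have "2 * x * ln ?s = x * ln x"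
    using x by (simp add: ln_sqrt)
  also have "2 * x * (1 - inverse ?s) = 2 * x - 2 * ?s"
  proof -
    have "x * inverse ?s = ?s" using s by (metis mult.assoc mult.right_neutral right_inverse less_irrefl)
    then show ?thesis by (simp add: right_diff_distrib)
  qed
  finally show ?thesis using s by (simp add: power2_eq_square algebra_simps)
qed simp

text \<open>Factor x - 1 = (sqrt x - 1) (sqrt x + 1) and apply Young's inequality with weight
  \<open>l\<close>; the weight stays free so that it can be chosen after integration.\<close>

lemma abs_diff_one_le_entropy:
  assumes "x \<ge> 0" "l > (0::real)"
  shows "\<bar>x - 1\<bar> \<le> l / 2 * (x * ln x - x + 1) + 1 / l * (x + 1)"
proof -
  let ?s = "sqrt x"
  have s: "?s \<ge> 0" "?s * ?s = x" using assms by auto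
  have "x - 1 = (?s - 1) * (?s + 1)" using s by (simp add: algebra_simps)
  then have 1: "\<bar>x - 1\<bar> = \<bar>?s - 1\<bar> * (?s + 1)" using s by (simp add: abs_mult)
  have amgm: "u * v \<le> l / 2 * u\<^sup>2 + 1 / (2 * l) * v\<^sup>2" for u v :: real
  proof -
    have "0 \<le> (l * u - v)\<^sup>2 / (2 * l)" using assms by simp
    also have "\<dots> = l / 2 * u\<^sup>2 + 1 / (2 * l) * v\<^sup>2 - u * v"
      using assms by (simp add: field_simps power2_eq_square)
    finally show ?thesis by simp
  qed
  have "(?s + 1)\<^sup>2 \<le> 2 * (x + 1)"
    using sum_squares_bound[of ?s 1] s by (simp add: power2_eq_square algebra_simps)
  then have "1 / (2 * l) * (?s + 1)\<^sup>2 \<le> 1 / (2 * l) * (2 * (x + 1))"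
    using assms by (intro mult_left_mono) auto
  moreover have "l / 2 * \<bar>?s - 1\<bar>\<^sup>2 \<le> l / 2 * (x * ln x - x + 1)"
    using sqrt_diff_sq_le_entropy[OF assms(1)] assms(2) by (intro mult_left_mono) auto
  moreover have "1 / (2 * l) * (2 * (x + 1)) = 1 / l * (x + 1)" using assms by (simp add: field_simps)
  ultimately show ?thesis
    using amgm[of "\<bar>?s - 1\<bar>" "?s + 1"] unfolding 1 by linarith
qed

text \<open>Integrating \<open>abs_diff_one_le_entropy\<close> along the density gives D <= (l / 2)
  I + 2 / l for every l > 0, because the density has mean 1 and the centring terms drop out. The
  constant 4 results from the choice l = 4 / D.\<close>

theorem pinsker:
  fixes \<mu> \<nu> :: "'b measure" and h :: "'b \<Rightarrow> real"
  assumes \<mu>: "prob_space \<mu>" and \<nu>: "prob_space \<nu>" and sets: "sets \<mu> = sets \<nu>"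
    and h: "h \<in> borel_measurable \<nu>" "\<And>x. \<bar>h x\<bar> \<le> 1"
  shows "ereal (((\<integral>x. h x \<partial>\<mu>) - (\<integral>x. h x \<partial>\<nu>))\<^sup>2) \<le> 4 * Ent \<mu> \<nu>"
proof (cases "absolutely_continuous \<nu> \<mu>")
  case False
  then show ?thesis by (simp add: Ent_def)
next
  case ac: True
  interpret \<mu>: prob_space \<mu> by fact
  interpret \<nu>: prob_space \<nu> by fact
  define F where "F = (\<lambda>x. enn2real (RN_deriv \<nu> \<mu> x))"
  let ?g = "\<lambda>x. F x * ln (F x)"
  have F0: "F x \<ge> 0" for x by (simp add: F_def)
  have [measurable]: "F \<in> borel_measurable \<nu>" unfolding F_def by measurable
  have "AE x in \<nu>. RN_deriv \<nu> \<mu> x \<noteq> \<infinity>"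
    by (rule \<nu>.RN_deriv_finite[OF _ ac sets]) unfold_locales
  then have "AE x in \<nu>. RN_deriv \<nu> \<mu> x = ennreal (F x)"
    by eventually_elim (simp add: F_def less_top)
  then have "density \<nu> (RN_deriv \<nu> \<mu>) = density \<nu> (\<lambda>x. ennreal (F x))"
    by (intro density_cong) auto
  then have dens: "\<mu> = density \<nu> (\<lambda>x. ennreal (F x))"
    using \<nu>.density_RN_deriv[OF ac sets] by simp
  have "(\<integral>\<^sup>+x. ennreal (F x) \<partial>\<nu>) = emeasure \<mu> (space \<nu>)"
    unfolding dens by (simp add: emeasure_density cong: nn_integral_cong)
  then have nnF: "(\<integral>\<^sup>+x. ennreal (F x) \<partial>\<nu>) = ennreal 1"
    using \<mu>.emeasure_space_1 sets_eq_imp_space_eq[OF sets] by simp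
  have "has_bochner_integral \<nu> F 1"
    by (rule has_bochner_integral_nn_integral[OF _ _ _ nnF]) (auto simp: F0)
  then have Fi: "integrable \<nu> F" and F1: "(\<integral>x. F x \<partial>\<nu>) = 1"
    by (auto simp: has_bochner_integral_iff)
  have gm [measurable]: "?g \<in> borel_measurable \<nu>" by measurable
  \<comment> \<open>The negative part of the entropy integrand is at most 1, so its integral is
    finite and the difference that defines \<open>Ent\<close> is never infinity minus
    infinity.\<close>
  have "- ?g x \<le> 1" for x
    using sqrt_diff_sq_le_entropy[OF F0[of x]] F0[of x] zero_le_power2[of "sqrt (F x) - 1"] by linarith
  then have "(\<integral>\<^sup>+x. ennreal (- ?g x) \<partial>\<nu>) \<le> (\<integral>\<^sup>+x. 1 \<partial>\<nu>)"
    by (intro nn_integral_mono) (metis ennreal_1 ennreal_leI)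
  then have neg: "(\<integral>\<^sup>+x. ennreal (- ?g x) \<partial>\<nu>) \<noteq> \<infinity>"
    by (auto simp: \<nu>.emeasure_space_1 top_unique)
  have Ent: "Ent \<mu> \<nu> = enn2ereal (\<integral>\<^sup>+x. ennreal (?g x) \<partial>\<nu>) - enn2ereal (\<integral>\<^sup>+x. ennreal (- ?g x) \<partial>\<nu>)"
    using ac by (simp add: Ent_def F_def Let_def)
  show ?thesis
  proof (cases "(\<integral>\<^sup>+x. ennreal (?g x) \<partial>\<nu>) = \<infinity>")
    case True
    then show ?thesis using neg unfolding Ent
      by (cases "\<integral>\<^sup>+x. ennreal (- ?g x) \<partial>\<nu>") (auto simp: enn2ereal_ennreal)
  next
    case False
    with neg have gi: "integrable \<nu> ?g" by (simp add: real_integrable_def)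
    define I where "I = (\<integral>x. ?g x \<partial>\<nu>)"
    have "Ent \<mu> \<nu> = ereal I"
      using False neg unfolding Ent I_def real_lebesgue_integral_def[OF gi]
      by (cases "\<integral>\<^sup>+x. ennreal (?g x) \<partial>\<nu>"; cases "\<integral>\<^sup>+x. ennreal (- ?g x) \<partial>\<nu>") (auto simp: enn2ereal_ennreal)
    define D where "D = \<bar>(\<integral>x. h x \<partial>\<mu>) - (\<integral>x. h x \<partial>\<nu>)\<bar>"
    have hi: "integrable \<nu> h"
      using h by (intro \<nu>.integrable_const_bound[where B=1]) auto
    have Fh: "integrable \<nu> (\<lambda>x. F x * h x)"
      by (rule Bochner_Integration.integrable_bound[OF Fi])
         (use h F0 in \<open>auto simp: abs_mult intro!: mult_left_le\<close>)
    have "(\<integral>x. h x \<partial>\<mu>) = (\<integral>x. F x * h x \<partial>\<nu>)"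
      unfolding dens by (subst integral_density) (use h F0 in auto)
    then have "(\<integral>x. h x \<partial>\<mu>) - (\<integral>x. h x \<partial>\<nu>) = (\<integral>x. (F x - 1) * h x \<partial>\<nu>)"
      using hi Fh by (simp add: left_diff_distrib)
    then have "D \<le> (\<integral>x. \<bar>(F x - 1) * h x\<bar> \<partial>\<nu>)"
      unfolding D_def by (simp only: integral_abs_bound)
    also have "\<dots> \<le> (\<integral>x. \<bar>F x - 1\<bar> \<partial>\<nu>)"
    proof (rule integral_mono)
      show "integrable \<nu> (\<lambda>x. \<bar>(F x - 1) * h x\<bar>)"
        unfolding left_diff_distrib using hi Fh by simp
      show "integrable \<nu> (\<lambda>x. \<bar>F x - 1\<bar>)" using Fi by simp
      show "\<bar>(F x - 1) * h x\<bar> \<le> \<bar>F x - 1\<bar>" for x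
        unfolding abs_mult by (rule mult_left_le[OF h(2)]) simp
    qed
    finally have D: "D \<le> (\<integral>x. \<bar>F x - 1\<bar> \<partial>\<nu>)" .
    have bd: "D \<le> l / 2 * I + 2 / l" if l: "l > 0" for l
    proof -
      have "(\<integral>x. \<bar>F x - 1\<bar> \<partial>\<nu>) \<le> (\<integral>x. l / 2 * (?g x - F x + 1) + 1 / l * (F x + 1) \<partial>\<nu>)"
        using abs_diff_one_le_entropy[OF F0 l] Fi gi by (intro integral_mono) auto
      also have "\<dots> = l / 2 * (I - 1 + 1) + 1 / l * (1 + 1)"
        using Fi gi by (simp add: F1 I_def \<nu>.prob_space)
      finally show ?thesis using D by simp
    qed
    have "D\<^sup>2 \<le> 4 * I"
    proof (cases "D > 0")
      case True
      then have "D \<le> (4 / D) / 2 * I + 2 / (4 / D)" by (intro bd) simp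
      then have "D * D \<le> D * (2 * I / D + D / 2)" using True by (intro mult_left_mono) auto
      also have "\<dots> = 2 * I + D * D / 2" using True by (simp add: field_simps)
      finally show ?thesis by (simp add: power2_eq_square)
    next
      case False
      then have "D = 0" by (simp add: D_def)
      moreover have "I \<ge> 0"
      proof -
        have "0 \<le> (\<integral>x. ?g x - F x + 1 \<partial>\<nu>)"
          using sqrt_diff_sq_le_entropy[OF F0] by (intro Bochner_Integration.integral_nonneg) (meson order_trans zero_le_power2)
        then show ?thesis using Fi gi by (simp add: F1 I_def \<nu>.prob_space)
      qed
      ultimately show ?thesis by simp
    qed
    then show ?thesis using \<open>Ent \<mu> \<nu> = ereal I\<close> by (simp add: D_def)
  qed
qed

text \<open>A Borel function is a Lebesgue-almost everywhere limit of continuous ones; truncation to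
  [-1, 1] and cutoffs make these admissible data for the heat flow. Absolute continuity turns the
  exceptional set into a null set of both measures, and dominated convergence concludes.\<close>

lemma tv_bound_extend:
  fixes \<mu> \<nu> :: "'a::euclidean_space measure"
  assumes \<mu>: "prob_space \<mu>" "sets \<mu> = sets borel" "absolutely_continuous lborel \<mu>"
    and \<nu>: "prob_space \<nu>" "sets \<nu> = sets borel" "absolutely_continuous lborel \<nu>"
    and bd: "\<And>f a b. heat_flow f a b \<Longrightarrow> \<bar>(\<integral>x. f x \<partial>\<mu>) - (\<integral>x. f x \<partial>\<nu>)\<bar> \<le> c"
    and h: "h \<in> borel_measurable borel" "\<And>x. \<bar>h x\<bar> \<le> (1::real)"
  shows "\<bar>(\<integral>x. h x \<partial>\<mu>) - (\<integral>x. h x \<partial>\<nu>)\<bar> \<le> c"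
proof -
  have "h \<in> borel_measurable lebesgue"
    by (rule measurable_completion) (simp only: measurable_lborel2 h(1))
  then have "h measurable_on UNIV"
    using lebesgue_measurable_imp_measurable_on[of h UNIV] by simp
  then have "\<exists>N g. negligible N \<and> (\<forall>n. continuous_on UNIV (g n)) \<and>
      (\<forall>x. x \<notin> N \<longrightarrow> (\<lambda>n. g n x) \<longlonglongrightarrow> h x)"
    unfolding measurable_on_def by (simp only: UNIV_I if_True)
  then obtain N g where N: "negligible N" and "\<forall>n. continuous_on UNIV (g n)"
    and "\<forall>x. x \<notin> N \<longrightarrow> (\<lambda>n. g n x) \<longlonglongrightarrow> h x"
    by (elim exE conjE)
  then have g: "\<And>n. continuous_on UNIV (g n)" and lim: "\<And>x. x \<notin> N \<Longrightarrow> (\<lambda>n. g n x) \<longlonglongrightarrow> h x"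
    by blast+
  define F where "F n x = max (-1) (min 1 (g n x)) * cutoff (real (Suc n)) x" for n x
  have Flim: "(\<lambda>n. F n x) \<longlonglongrightarrow> h x" if "x \<notin> N" for x
  proof -
    have "(\<lambda>n. max (-1) (min 1 (g n x))) \<longlonglongrightarrow> max (-1) (min 1 (h x))"
      by (intro tendsto_max tendsto_min tendsto_const lim that)
    moreover have "max (-1) (min 1 (h x)) = h x" using h(2)[of x] by auto
    moreover have "(\<lambda>n. cutoff (real (Suc n)) x) \<longlonglongrightarrow> 1"
      by (rule LIMSEQ_Suc[OF tendsto_eventually[OF eventually_cutoff_1]])
    ultimately show ?thesis
      using tendsto_mult[of "\<lambda>n. max (-1) (min 1 (g n x))" "h x" sequentially "\<lambda>n. cutoff (real (Suc n)) x" 1]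
      by (simp add: F_def)
  qed
  have Fb: "\<bar>F n x\<bar> \<le> 1" for n x
    using cutoff_bounds[of "real (Suc n)" x] unfolding F_def abs_mult
    by (intro mult_le_one) (auto simp: max_def min_def)
  have cutc: "continuous_on UNIV (\<lambda>x::'a. cutoff r x)" for r
    by (rule smooth_on_imp_continuous_on[OF smooth_on_cutoff_linear]) auto
  have Fc: "continuous_on UNIV (F n)" for n
    unfolding F_def[abs_def] by (intro continuous_intros g cutc)
  have hf: "\<exists>a b. heat_flow (F n) a b" for n
  proof -
    obtain r where r: "cball (0::'a) (2 * real (Suc n)) \<subseteq> cbox (-r) r"
      using bounded_subset_cbox_symmetric[OF bounded_cball] by blast
    have "F n x = 0" if "x \<notin> cbox (-r) r" for x
    proof -
      have "x \<notin> cball 0 (2 * real (Suc n))" using r that by blast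
      then show ?thesis using cutoff_0[of "real (Suc n)" x] by (simp add: F_def)
    qed
    then have "heat_flow (F n) (-r) r" by (unfold_locales) (auto intro: Fc Fb)
    then show ?thesis by blast
  qed
  have conv: "(\<lambda>n. \<integral>x. F n x \<partial>\<rho>) \<longlonglongrightarrow> (\<integral>x. h x \<partial>\<rho>)"
    if \<rho>: "prob_space \<rho>" "sets \<rho> = sets borel" "absolutely_continuous lborel \<rho>" for \<rho> :: "'a measure"
  proof -
    interpret prob_space \<rho> by fact
    have "AE x in lborel. x \<notin> N"
      using AE_not_in[OF N[unfolded negligible_iff_null_sets]] by (simp only: AE_completion_iff)
    then have ae: "AE x in \<rho>. x \<notin> N" 
      using absolutely_continuous_AE[OF _ \<rho>(3)] \<rho>(2) by simp
    show ?thesis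
    proof (rule integral_dominated_convergence[where w="\<lambda>_. 1"])
      show "AE x in \<rho>. (\<lambda>n. F n x) \<longlonglongrightarrow> h x" using ae by eventually_elim (rule Flim)
      show "h \<in> borel_measurable \<rho>" using h(1) measurable_cong_sets[OF \<rho>(2) refl] by blast
      show "F n \<in> borel_measurable \<rho>" for n
        using borel_measurable_continuous_onI[OF Fc] measurable_cong_sets[OF \<rho>(2) refl] by blast
    qed (use Fb in auto)
  qed
  have "(\<lambda>n. \<bar>(\<integral>x. F n x \<partial>\<mu>) - (\<integral>x. F n x \<partial>\<nu>)\<bar>) \<longlonglongrightarrow> \<bar>(\<integral>x. h x \<partial>\<mu>) - (\<integral>x. h x \<partial>\<nu>)\<bar>"
    by (intro tendsto_rabs tendsto_diff conv \<mu> \<nu>)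
  then show ?thesis
    by (rule LIMSEQ_le_const2) (use hf bd in blast)
qed

section \<open>Shear estimates from a weak gradient\<close>

lemma borel_fst: "fst \<in> borel_measurable (borel :: ('a::euclidean_space \<times> 'a) measure)"
  and borel_snd: "snd \<in> borel_measurable (borel :: ('a::euclidean_space \<times> 'a) measure)"
  by (intro borel_measurable_continuous_onI continuous_intros)+

text \<open>For a fixed velocity the map is a translation in x, which preserves null sets; Tonelli's
  theorem integrates over the velocity.\<close>

lemma null_shear:
  fixes h :: "'a::euclidean_space \<Rightarrow> 'a"
  assumes h: "h \<in> borel_measurable borel" and N: "N \<in> null_sets lborel"
  shows "(\<lambda>z. fst z + h (snd z)) -` N \<in> null_sets lborel"
proof -
  have Nb: "N \<in> sets borel" using N by auto
  have [measurable]: "h \<in> borel_measurable borel" by fact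
  have meas: "(\<lambda>z. fst z + h (snd z)) \<in> borel_measurable (borel :: ('a \<times> 'a) measure)"
    by (intro borel_measurable_add measurable_compose[OF _ h] borel_fst borel_snd)
  have pre: "(\<lambda>z. fst z + h (snd z)) -` N \<in> sets borel"
    using measurable_sets[OF meas Nb] by simp
  have tr: "emeasure lborel ((\<lambda>x. x + c) -` N) = 0" for c
  proof -
    have "emeasure lborel N = emeasure (distr lborel borel ((+) c)) N"
      by (simp only: lborel_distr_plus)
    also have "\<dots> = emeasure lborel ((+) c -` N)"
      using Nb by (subst emeasure_distr) auto
    also have "(+) c -` N = (\<lambda>x. x + c) -` N" by (auto simp: add.commute)
    finally show ?thesis using N by (auto simp: null_sets_def)
  qed
  have "emeasure lborel ((\<lambda>z. fst z + h (snd z)) -` N) =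
     emeasure (lborel \<Otimes>\<^sub>M lborel) ((\<lambda>z. fst z + h (snd z)) -` N)"
    by (simp only: lborel_prod)
  also have "\<dots> = (\<integral>\<^sup>+v. emeasure lborel ((\<lambda>x. (x, v)) -` ((\<lambda>z. fst z + h (snd z)) -` N)) \<partial>lborel)"
    by (rule lborel_pair.emeasure_pair_measure_alt2) (use pre in \<open>simp only: lborel_prod sets_lborel\<close>)
  also have "\<dots> = (\<integral>\<^sup>+v. emeasure lborel ((\<lambda>x. x + h v) -` N) \<partial>lborel)"
    by (simp add: vimage_def)
  finally show ?thesis using pre by (simp add: tr null_sets_def)
qed

text \<open>Covers both the x-marginal, with \<open>h\<close> equal to 0, and the coarse-grained
  law, with h v = v / \<gamma>.\<close>

lemma absolutely_continuous_shear:
  fixes h :: "'a::euclidean_space \<Rightarrow> 'a"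
  assumes h: "h \<in> borel_measurable borel" and m: "m \<in> borel_measurable borel"
  shows "absolutely_continuous lborel
    (distr (density lborel (\<lambda>z::'a \<times> 'a. ennreal (m z))) borel (\<lambda>z. fst z + h (snd z)))"
  unfolding absolutely_continuous_def
proof
  fix N :: "'a set" assume N: "N \<in> null_sets lborel"
  then have Nb: "N \<in> sets borel" by auto
  have meas: "(\<lambda>z. fst z + h (snd z)) \<in> borel_measurable (borel :: ('a \<times> 'a) measure)"
    by (intro borel_measurable_add measurable_compose[OF _ h] borel_fst borel_snd)
  have "absolutely_continuous lborel (density lborel (\<lambda>z. ennreal (m z)))"
    by (rule absolutely_continuousI_density) (use m in simp)
  then have "(\<lambda>z. fst z + h (snd z)) -` N \<in> null_sets (density lborel (\<lambda>z. ennreal (m z)))"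
    using null_shear[OF h N] unfolding absolutely_continuous_def by blast
  then show "N \<in> null_sets (distr (density lborel (\<lambda>z. ennreal (m z))) borel (\<lambda>z. fst z + h (snd z)))"
    using Nb meas by (subst null_sets_distr_iff) auto
qed

context heat_flow
begin

text \<open>A smooth, compactly supported approximation of \<open>f\<close>; the single parameter
  serves as cutoff radius and as inverse smoothing time.\<close>

definition mollified :: "real \<Rightarrow> 'a \<Rightarrow> real" where
  "mollified r y = cutoff r y * P (1 / r) y"

definition mollified1 :: "real \<Rightarrow> 'a \<Rightarrow> 'a \<Rightarrow> real" where
  "mollified1 r y k = cutoff1 r y k * P (1 / r) y + (gradP (1 / r) y \<bullet> k) * cutoff r y"

lemma DERIV_mollified: "r > 0 \<Longrightarrow>
    ((\<lambda>s. mollified r (y + s *\<^sub>R k)) has_real_derivative mollified1 r y k) (at 0)"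
  using DERIV_mult[OF DERIV_cutoff[of r y k] DERIV_P_line[of "1 / r" y k]]
  by (simp add: mollified_def mollified1_def P1_eq_inner)

lemma mollified_bound: "r > 0 \<Longrightarrow> \<bar>mollified r y\<bar> \<le> 1"
  unfolding mollified_def abs_mult using cutoff_bounds[of r y] P_bound[of "1 / r" y]
  by (intro mult_le_one) auto

lemma mollified_outside: "r > 0 \<Longrightarrow> norm y \<ge> 2 * r \<Longrightarrow> mollified r y = 0"
  by (simp add: mollified_def cutoff_0)

lemma smooth_on_mollified:
  fixes L :: "'c::euclidean_space \<Rightarrow> 'a"
  assumes U: "open U" and r: "r > 0" and L: "\<And>b. b \<in> Basis \<Longrightarrow> smooth_on U (\<lambda>p. L p \<bullet> b)"
  shows "smooth_on U (\<lambda>p. mollified r (L p))"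
  unfolding mollified_def
  by (rule smooth_on_mult[OF U smooth_on_cutoff[OF U L] smooth_on_P[OF U smooth_on_const[OF U] _ L]])
     (use r in auto)

lemma continuous_on_mollified: "r > 0 \<Longrightarrow> continuous_on UNIV (mollified r)"
  using smooth_on_imp_continuous_on[OF smooth_on_mollified[where L="\<lambda>x. x"]]
  by (auto intro!: smooth_on_linear bounded_linear_inner_left)

text \<open>Allows the derivative along the shear to be resolved into the coordinate directions in
  which the weak gradient is tested.\<close>

lemma mollified1_linear: "mollified1 r y k = (\<Sum>b\<in>Basis. (k \<bullet> b) * mollified1 r y b)"
proof -
  have "y \<bullet> k = (\<Sum>b\<in>Basis. (k \<bullet> b) * (y \<bullet> b))" "gradP (1 / r) y \<bullet> k = (\<Sum>b\<in>Basis. (k \<bullet> b) * (gradP (1 / r) y \<bullet> b))"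
    by (subst euclidean_inner, simp add: mult.commute)+
  moreover define A where "A = - smooth_step' ((norm y)\<^sup>2 / r\<^sup>2 - 1) * 2 / r\<^sup>2 * P (1 / r) y"
  moreover have eq: "mollified1 r y k = A * (y \<bullet> k) + cutoff r y * (gradP (1 / r) y \<bullet> k)" for k
    unfolding mollified1_def cutoff1_def A_def by (simp add: mult_ac)
  ultimately have "mollified1 r y k = A * (\<Sum>b\<in>Basis. (k \<bullet> b) * (y \<bullet> b)) +
      cutoff r y * (\<Sum>b\<in>Basis. (k \<bullet> b) * (gradP (1 / r) y \<bullet> b))"
    by (simp only:)
  then show ?thesis
    by (simp only: eq sum_distrib_left sum.distrib[symmetric] distrib_left mult.left_commute)
qed

lemma mollified_tendsto: "(\<lambda>n. mollified (real (Suc n)) y) \<longlonglongrightarrow> f y"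
proof -
  have "filterlim (\<lambda>n. 1 / real (Suc n)) (at_right 0) sequentially"
    unfolding filterlim_at using LIMSEQ_inverse_real_of_nat
    by (auto simp: inverse_eq_divide)
  from filterlim_compose[OF P_tendsto this]
  have "(\<lambda>n. P (1 / real (Suc n)) y) \<longlonglongrightarrow> f y" .
  moreover have "(\<lambda>n. cutoff (real (Suc n)) y) \<longlonglongrightarrow> 1"
    by (rule LIMSEQ_Suc[OF tendsto_eventually[OF eventually_cutoff_1]])
  ultimately show ?thesis
    using tendsto_mult[of "\<lambda>n. cutoff (real (Suc n)) y" 1 sequentially "\<lambda>n. P (1 / real (Suc n)) y" "f y"]
    by (simp add: mollified_def)
qed

context
  fixes \<alpha> :: real and h0 :: 'a and r :: real
  assumes r: "r > 0"
begin

abbreviation (input) shear :: "'a \<Rightarrow> 'a" where "shear v \<equiv> \<alpha> *\<^sub>R v + h0"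

text \<open>The derivative of \<open>path_avg\<close> along \<open>shear v\<close> in the \<open>x\<close>-variable is the increment
  \<open>mollified r (x + shear v) - mollified r x\<close>, so the weak \<open>x\<close>-gradient can be tested with it.\<close>

definition path_avg :: "'a \<times> 'a \<Rightarrow> real" where
  "path_avg p = integral (cbox 0 1) (\<lambda>s::real. mollified r (fst p + s *\<^sub>R shear (snd p)))"

lemma smooth_path: "smooth_on (UNIV \<times> UNIV) (\<lambda>w::('a \<times> 'a) \<times> real. mollified r (fst (fst w) + snd w *\<^sub>R shear (snd (fst w))))"
proof -
  have o: "open (UNIV \<times> UNIV :: (('a \<times> 'a) \<times> real) set)" by simp
  have l1: "bounded_linear (\<lambda>w::('a \<times> 'a) \<times> real. fst (fst w) \<bullet> b)" for b
    by (intro bounded_linear_inner_left_comp bounded_linear_compose[OF bounded_linear_fst] bounded_linear_fst)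
  have l2: "bounded_linear (\<lambda>w::('a \<times> 'a) \<times> real. \<alpha> * (snd (fst w) \<bullet> b))" for b
    by (intro bounded_linear_const_mult bounded_linear_inner_left_comp
        bounded_linear_compose[OF bounded_linear_snd] bounded_linear_fst)
  have "smooth_on (UNIV \<times> UNIV) (\<lambda>w::('a \<times> 'a) \<times> real. fst (fst w) \<bullet> b + snd w * (\<alpha> * (snd (fst w) \<bullet> b) + h0 \<bullet> b))" for b
    by (rule smooth_on_add[OF o smooth_on_linear[OF o l1] smooth_on_mult[OF o smooth_on_linear[OF o bounded_linear_snd]
          smooth_on_add[OF o smooth_on_linear[OF o l2] smooth_on_const[OF o]]]])
  then have "smooth_on (UNIV \<times> UNIV) (\<lambda>w::('a \<times> 'a) \<times> real. (fst (fst w) + snd w *\<^sub>R shear (snd (fst w))) \<bullet> b)" for b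
    by (simp add: inner_simps)
  from smooth_on_mollified[OF o r this] show ?thesis .
qed

lemma smooth_path_avg: "smooth_on UNIV path_avg"
  using smooth_on_integral_param(1)[OF open_UNIV continuous_on_const smooth_path, of 0 1 1]
  by (simp add: path_avg_def[abs_def])

lemma DERIV_path_avg:
  assumes b: "b \<in> Basis"
  shows "((\<lambda>s. path_avg (p + s *\<^sub>R (b, 0))) has_real_derivative
     integral (cbox 0 1) (\<lambda>s. mollified1 r (fst p + s *\<^sub>R shear (snd p)) b)) (at 0)"
proof -
  have b0: "(b, 0) \<in> (Basis :: ('a \<times> 'a) set)" using b by (simp add: Basis_prod_def)
  have "pd ((b, 0), 0) (\<lambda>w::('a \<times> 'a) \<times> real. mollified r (fst (fst w) + snd w *\<^sub>R shear (snd (fst w)))) (p, s)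
     = mollified1 r (fst p + s *\<^sub>R shear (snd p)) b" for s
    using DERIV_mollified[OF r, of "fst p + s *\<^sub>R shear (snd p)" b]
    by (intro pd_eqI) (simp add: algebra_simps)
  then show ?thesis
    using smooth_on_integral_param(2)[OF open_UNIV continuous_on_const smooth_path b0, of p 0 1 1]
    by (simp add: path_avg_def[abs_def])
qed

text \<open>The fundamental theorem of calculus along the segment from x to x + shear v, spelled out
  over \<open>Basis\<close> because the weak x-gradient is tested one coordinate at a time.\<close>

lemma path_ftc:
  "(\<Sum>b\<in>Basis. (shear v \<bullet> b) * integral (cbox 0 1) (\<lambda>s. mollified1 r (x + s *\<^sub>R shear v) b))
     = mollified r (x + shear v) - mollified r x"
proof -
  have c: "continuous_on UNIV (\<lambda>y. mollified1 r y b)" if "b \<in> Basis" for b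
  proof -
    have "smooth_on UNIV (mollified r)"
      by (rule smooth_on_mollified[OF open_UNIV r, of "\<lambda>x. x"])
         (intro smooth_on_linear open_UNIV bounded_linear_inner_left)
    from smooth_on_imp_continuous_on[OF smooth_on_pd[OF this that]] show ?thesis
      using pd_eqI[OF DERIV_mollified[OF r]] by (simp cong: continuous_on_cong)
  qed
  have ci: "(\<lambda>s. mollified1 r (x + s *\<^sub>R shear v) b) integrable_on cbox 0 1" if "b \<in> Basis" for b
    by (intro integrable_continuous continuous_on_compose2[OF c[OF that]] continuous_intros) auto
  have "((\<lambda>s. mollified1 r (x + s *\<^sub>R shear v) (shear v)) has_integral
      (mollified r (x + 1 *\<^sub>R shear v) - mollified r (x + 0 *\<^sub>R shear v))) {0..1}"
  proof (rule fundamental_theorem_of_calculus)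
    fix s :: real
    have "((\<lambda>q. mollified r (x + q *\<^sub>R shear v)) has_real_derivative mollified1 r (x + s *\<^sub>R shear v) (shear v)) (at s)"
      using DERIV_mollified[OF r, of "x + s *\<^sub>R shear v" "shear v"]
        DERIV_shift[of "\<lambda>q. mollified r (x + q *\<^sub>R shear v)" _ 0 s]
      by (simp add: algebra_simps)
    then show "((\<lambda>q. mollified r (x + q *\<^sub>R shear v)) has_vector_derivative mollified1 r (x + s *\<^sub>R shear v) (shear v)) (at s within {0..1})"
      by (simp add: has_real_derivative_iff_has_vector_derivative[symmetric] has_field_derivative_at_within)
  qed simp
  then have "mollified r (x + shear v) - mollified r x = integral (cbox 0 1) (\<lambda>s. mollified1 r (x + s *\<^sub>R shear v) (shear v))"
    by (simp add: integral_unique)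
  also have "\<dots> = integral (cbox 0 1) (\<lambda>s. \<Sum>b\<in>Basis. (shear v \<bullet> b) * mollified1 r (x + s *\<^sub>R shear v) b)"
    by (subst mollified1_linear) simp
  also have "\<dots> = (\<Sum>b\<in>Basis. integral (cbox 0 1) (\<lambda>s. (shear v \<bullet> b) * mollified1 r (x + s *\<^sub>R shear v) b))"
    by (intro integral_sum finite_Basis integrable_on_mult_right ci)
  finally show ?thesis by simp
qed

lemma path_avg_bound: "\<bar>path_avg p\<bar> \<le> 1"
proof -
  have "norm (path_avg p) \<le> integral (cbox 0 1) (\<lambda>s::real. 1)"
    unfolding path_avg_def
  proof (rule integral_norm_bound_integral)
    show "(\<lambda>s. mollified r (fst p + s *\<^sub>R shear (snd p))) integrable_on cbox 0 1"
      by (intro integrable_continuous continuous_on_compose2[OF continuous_on_mollified[OF r]] continuous_intros) auto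
  qed (use mollified_bound[OF r] in auto)
  then show ?thesis by simp
qed

text \<open>A segment of length |shear v| that starts at distance 2 r + |shear v| or more from the
  origin never enters the ball of radius 2 r, outside of which \<open>mollified r\<close>
  vanishes.\<close>

lemma path_avg_outside:
  assumes "norm (fst p) \<ge> 2 * r + norm (shear (snd p))"
  shows "path_avg p = 0"
proof -
  have "mollified r (fst p + s *\<^sub>R shear (snd p)) = 0" if "s \<in> cbox 0 1" for s
  proof (rule mollified_outside[OF r])
    have "norm (s *\<^sub>R shear (snd p)) \<le> norm (shear (snd p))"
      using that by (auto intro!: mult_left_le_one_le)
    then show "2 * r \<le> norm (fst p + s *\<^sub>R shear (snd p))"
      using assms norm_diff_ineq[of "fst p" "s *\<^sub>R shear (snd p)"] by linarith
  qed
  then have "path_avg p = integral (cbox 0 1) (\<lambda>s::real. 0)"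
    unfolding path_avg_def by (intro integral_cong) auto
  then show ?thesis by simp
qed

text \<open>The component along \<open>e\<close> of the vector field with value shear(v) times
  cutoff(v) times \<open>path_avg\<close>. The first two factors depend on v alone, so its
  x-divergence is the cutoff times the increment of \<open>mollified r\<close>.\<close>

definition shear_test :: "real \<Rightarrow> 'a \<Rightarrow> 'a \<times> 'a \<Rightarrow> real" where
  "shear_test n e p = ((shear (snd p) \<bullet> e) * cutoff n (snd p)) * path_avg p"

lemma smooth_shear_test: "smooth_on UNIV (shear_test n b)"
proof -
  have l: "bounded_linear (\<lambda>p::'a \<times> 'a. \<alpha> * (snd p \<bullet> b))"
    by (intro bounded_linear_const_mult bounded_linear_inner_left_comp bounded_linear_snd)
  have "smooth_on UNIV (\<lambda>p::'a \<times> 'a. \<alpha> * (snd p \<bullet> b) + h0 \<bullet> b)"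
    by (rule smooth_on_add[OF open_UNIV smooth_on_linear[OF open_UNIV l] smooth_on_const[OF open_UNIV]])
  then have "smooth_on UNIV (\<lambda>p::'a \<times> 'a. shear (snd p) \<bullet> b)" by (simp add: inner_simps)
  then show ?thesis unfolding shear_test_def[abs_def]
    by (intro smooth_on_mult[OF open_UNIV smooth_on_mult[OF open_UNIV]] smooth_path_avg
        smooth_on_cutoff_linear open_UNIV bounded_linear_snd)
qed

lemma test_fun_shear_test:
  assumes n: "n > 0" shows "test_fun UNIV (shear_test n b)"
proof -
  have sub: "{p. shear_test n b p \<noteq> 0} \<subseteq> cball 0 (2 * r + \<bar>\<alpha>\<bar> * (2 * n) + norm h0) \<times> cball 0 (2 * n)"
  proof
    fix p assume "p \<in> {p. shear_test n b p \<noteq> 0}"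
    then have "\<not> norm (snd p) \<ge> 2 * n" "\<not> norm (fst p) \<ge> 2 * r + norm (shear (snd p))"
      using cutoff_0[OF n, of "snd p"] path_avg_outside[of p] by (auto simp: shear_test_def)
    moreover have "norm (shear (snd p)) \<le> \<bar>\<alpha>\<bar> * norm (snd p) + norm h0"
      using norm_triangle_ineq[of "\<alpha> *\<^sub>R snd p" h0] by simp
    moreover have "\<bar>\<alpha>\<bar> * norm (snd p) \<le> \<bar>\<alpha>\<bar> * (2 * n)"
      using calculation(1) by (intro mult_left_mono) auto
    ultimately have "norm (fst p) \<le> 2 * r + \<bar>\<alpha>\<bar> * (2 * n) + norm h0" "norm (snd p) \<le> 2 * n"
      by linarith+
    then show "p \<in> cball 0 (2 * r + \<bar>\<alpha>\<bar> * (2 * n) + norm h0) \<times> cball 0 (2 * n)"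
      by (cases p) auto
  qed
  then have "bounded {p. shear_test n b p \<noteq> 0}"
    by (rule bounded_subset[rotated]) (intro bounded_Times bounded_cball)
  then have "compact (closure {p. shear_test n b p \<noteq> 0})" by simp
  then show ?thesis unfolding test_fun_def smooth_fun_iff using smooth_shear_test by simp
qed

lemma pd_shear_test:
  assumes b: "b \<in> Basis"
  shows "pd (b, 0) (shear_test n b) p =
    ((shear (snd p) \<bullet> b) * cutoff n (snd p)) * integral (cbox 0 1) (\<lambda>s. mollified1 r (fst p + s *\<^sub>R shear (snd p)) b)"
  using DERIV_cmult[OF DERIV_path_avg[OF b, of p], of "(shear (snd p) \<bullet> b) * cutoff n (snd p)"]
  by (intro pd_eqI) (simp add: shear_test_def)

lemma test_fun_pd_bounded:
  fixes \<psi> :: "'e::euclidean_space \<Rightarrow> real"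
  assumes \<psi>: "test_fun UNIV \<psi>" and e: "e \<in> Basis"
  shows "\<exists>M. \<forall>p. \<bar>pd e \<psi> p\<bar> \<le> M"
proof -
  let ?K = "closure {x. \<psi> x \<noteq> 0}"
  have K: "compact ?K" and s: "smooth_on UNIV (pd e \<psi>)"
    using \<psi> smooth_on_pd[OF _ e] by (auto simp: test_fun_def smooth_fun_iff)
  have "compact (pd e \<psi> ` ?K)"
    by (intro compact_continuous_image K continuous_on_subset[OF smooth_on_imp_continuous_on[OF s]]) auto
  then obtain M where M: "\<forall>x\<in>?K. \<bar>pd e \<psi> x\<bar> \<le> M" by (auto dest!: compact_imp_bounded simp: bounded_iff)
  have "\<bar>pd e \<psi> p\<bar> \<le> max M 0" for p
  proof (cases "p \<in> ?K")
    case False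
    have z: "\<psi> y = 0" if "y \<in> - ?K" for y
      using that closure_subset[of "{x. \<psi> x \<noteq> 0}"] by blast
    have "pd e \<psi> p = pd e (\<lambda>_. 0) p"
      by (rule pd_cong[OF open_Compl[OF closed_closure] _ z]) (use False in \<open>simp only: Compl_iff not_False_eq_True\<close>)
    also have "\<dots> = 0" by (rule pd_eqI) simp
    finally show ?thesis by simp
  qed (use M in \<open>auto simp: le_max_iff_disj\<close>)
  then show ?thesis by blast
qed

text \<open>Integration by parts with the components \<open>shear_test n b\<close> moves the
  increment onto \<open>g\<close>. The field is bounded by |shear v| since \<open>path_avg\<close>
  and the cutoff are at most 1 in modulus, and the velocity cutoff disappears by dominated
  convergence.\<close>

lemma shear_mollified_bound:
  fixes m :: "'a \<times> 'a \<Rightarrow> real" and g :: "'a \<times> 'a \<Rightarrow> 'a"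
  assumes mi: "integrable lborel m" and wg: "weak_x_grad m g"
    and gi: "integrable lborel (\<lambda>z. norm (shear (snd z)) * norm (g z))"
  shows "\<bar>\<integral>z. m z * (mollified r (fst z + shear (snd z)) - mollified r (fst z)) \<partial>lborel\<bar>
     \<le> (\<integral>z. norm (shear (snd z)) * norm (g z) \<partial>lborel)"
proof -
  let ?c = "\<integral>z. norm (shear (snd z)) * norm (g z) \<partial>lborel"
  let ?d = "\<lambda>z. mollified r (fst z + shear (snd z)) - mollified r (fst z)"
  have [measurable]: "m \<in> borel_measurable borel" "g \<in> borel_measurable borel"
    using wg by (auto simp: weak_x_grad_def)
  have stm [measurable]: "shear_test n b \<in> borel_measurable borel" for n b
    by (rule borel_measurable_continuous_onI[OF smooth_on_imp_continuous_on[OF smooth_shear_test]])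
  have db: "\<bar>?d z\<bar> \<le> 2" for z
    using mollified_bound[OF r, of "fst z + shear (snd z)"] mollified_bound[OF r, of "fst z"] by linarith
  have c1: "continuous_on UNIV (\<lambda>z::'a \<times> 'a. fst z + shear (snd z))" by (intro continuous_intros)
  have c2: "continuous_on UNIV (fst :: 'a \<times> 'a \<Rightarrow> 'a)" by (intro continuous_intros)
  have dm [measurable]: "?d \<in> borel_measurable borel"
    by (rule borel_measurable_continuous_onI[OF continuous_on_diff[OF
          continuous_on_compose2[OF continuous_on_mollified[OF r] c1] continuous_on_compose2[OF continuous_on_mollified[OF r] c2]]])
       (rule subset_UNIV)+
  have cm [measurable]: "(\<lambda>z::'a \<times> 'a. cutoff n (snd z)) \<in> borel_measurable borel" for n
    by (rule borel_measurable_continuous_onI[OF smooth_on_imp_continuous_on[OF smooth_on_cutoff_linear[OF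
        open_UNIV bounded_linear_snd]]])
  have main: "\<bar>\<integral>z. m z * (cutoff n (snd z) * ?d z) \<partial>lborel\<bar> \<le> ?c" if n: "n > 0" for n
  proof -
    have i1: "integrable lborel (\<lambda>z. m z * pd (b, 0) (shear_test n b) z)" if b: "b \<in> Basis" for b
    proof -
      have b0: "(b, 0) \<in> (Basis :: ('a \<times> 'a) set)" using b by (simp add: Basis_prod_def)
      obtain M where M: "\<And>p. \<bar>pd (b, 0) (shear_test n b) p\<bar> \<le> M"
        using test_fun_pd_bounded[OF test_fun_shear_test[OF n] b0] by blast
      have [measurable]: "pd (b, 0) (shear_test n b) \<in> borel_measurable borel"
        by (rule borel_measurable_continuous_onI[OF smooth_on_imp_continuous_on[OF smooth_on_pd[OF smooth_shear_test b0]]])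
      have "integrable lborel (\<lambda>z. M * m z)" using mi by simp
      then show ?thesis
      proof (rule Bochner_Integration.integrable_bound)
        show "AE z in lborel. norm (m z * pd (b, 0) (shear_test n b) z) \<le> norm (M * m z)"
        proof (rule AE_I2)
          fix z
          have "\<bar>pd (b, 0) (shear_test n b) z\<bar> \<le> \<bar>M\<bar>" using M[of z] by linarith
          from mult_left_mono[OF this abs_ge_zero[of "m z"]]
          show "norm (m z * pd (b, 0) (shear_test n b) z) \<le> norm (M * m z)" by (simp add: abs_mult mult.commute)
        qed
      qed simp
    qed
    have bd2: "\<bar>(\<Sum>b\<in>Basis. (g z \<bullet> b) * shear_test n b z)\<bar> \<le> norm (shear (snd z)) * norm (g z)" for z
    proof -
      have "(\<Sum>b\<in>Basis. (g z \<bullet> b) * shear_test n b z) = (g z \<bullet> shear (snd z)) * (cutoff n (snd z) * path_avg z)"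
        unfolding shear_test_def euclidean_inner[of "g z" "shear (snd z)"] sum_distrib_right
        by (rule sum.cong) auto
      also have "\<bar>\<dots>\<bar> \<le> norm (g z) * norm (shear (snd z)) * (1 * 1)"
        unfolding abs_mult using cutoff_bounds[of n "snd z"] path_avg_bound[of z]
        by (intro mult_mono Cauchy_Schwarz_ineq2) auto
      finally show ?thesis by (simp add: mult.commute)
    qed
    have i2: "integrable lborel (\<lambda>z. (g z \<bullet> b) * shear_test n b z)" if b: "b \<in> Basis" for b
    proof (rule Bochner_Integration.integrable_bound[OF gi])
      show "AE z in lborel. norm ((g z \<bullet> b) * shear_test n b z) \<le> norm (norm (shear (snd z)) * norm (g z))"
      proof (rule AE_I2)
        fix z
        have "\<bar>g z \<bullet> b\<bar> \<le> norm (g z)" "\<bar>shear (snd z) \<bullet> b\<bar> \<le> norm (shear (snd z))"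
          using Basis_le_norm[OF b] by auto
        then have "\<bar>g z \<bullet> b\<bar> * (\<bar>shear (snd z) \<bullet> b\<bar> * \<bar>cutoff n (snd z)\<bar> * \<bar>path_avg z\<bar>)
            \<le> norm (g z) * (norm (shear (snd z)) * 1 * 1)"
          using cutoff_bounds[of n "snd z"] path_avg_bound[of z] by (intro mult_mono) auto
        then show "norm ((g z \<bullet> b) * shear_test n b z) \<le> norm (norm (shear (snd z)) * norm (g z))"
          by (simp add: shear_test_def abs_mult mult.commute)
      qed
    qed simp
    have "(\<integral>z. m z * (cutoff n (snd z) * ?d z) \<partial>lborel)
        = (\<integral>z. (\<Sum>b\<in>Basis. m z * pd (b, 0) (shear_test n b) z) \<partial>lborel)"
    proof (rule Bochner_Integration.integral_cong[OF refl])
      fix z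
      have "(\<Sum>b\<in>Basis. m z * pd (b, 0) (shear_test n b) z) = m z * (cutoff n (snd z) *
          (\<Sum>b\<in>Basis. (shear (snd z) \<bullet> b) * integral (cbox 0 1) (\<lambda>s. mollified1 r (fst z + s *\<^sub>R shear (snd z)) b)))"
        unfolding sum_distrib_left by (rule sum.cong) (auto simp: pd_shear_test mult_ac)
      then show "m z * (cutoff n (snd z) * ?d z) = (\<Sum>b\<in>Basis. m z * pd (b, 0) (shear_test n b) z)"
        by (simp only: path_ftc)
    qed
    also have "\<dots> = (\<Sum>b\<in>Basis. \<integral>z. m z * pd (b, 0) (shear_test n b) z \<partial>lborel)"
      by (rule Bochner_Integration.integral_sum[OF i1])
    also have "\<dots> = (\<Sum>b\<in>Basis. - (\<integral>z. (g z \<bullet> b) * shear_test n b z \<partial>lborel))"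
      using wg test_fun_shear_test[OF n] unfolding weak_x_grad_def by (intro sum.cong) auto
    also have "\<dots> = - (\<integral>z. (\<Sum>b\<in>Basis. (g z \<bullet> b) * shear_test n b z) \<partial>lborel)"
      by (subst Bochner_Integration.integral_sum[OF i2]) (auto simp: sum_negf)
    also have "\<bar>\<dots>\<bar> \<le> (\<integral>z. \<bar>\<Sum>b\<in>Basis. (g z \<bullet> b) * shear_test n b z\<bar> \<partial>lborel)"
      unfolding abs_minus_cancel by (rule integral_abs_bound)
    also have "\<dots> \<le> ?c"
      by (rule integral_mono[OF _ gi bd2]) (intro integrable_abs Bochner_Integration.integrable_sum i2)
    finally show ?thesis .
  qed
  have "(\<lambda>n. \<integral>z. m z * (cutoff (real (Suc n)) (snd z) * ?d z) \<partial>lborel) \<longlonglongrightarrow> (\<integral>z. m z * ?d z \<partial>lborel)"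
  proof (rule integral_dominated_convergence[where w="\<lambda>z. 2 * \<bar>m z\<bar>"])
    show "AE z in lborel. (\<lambda>n. m z * (cutoff (real (Suc n)) (snd z) * ?d z)) \<longlonglongrightarrow> m z * ?d z"
    proof (rule AE_I2)
      fix z :: "'a \<times> 'a"
      have "(\<lambda>n. cutoff (real (Suc n)) (snd z)) \<longlonglongrightarrow> 1"
        by (rule LIMSEQ_Suc[OF tendsto_eventually[OF eventually_cutoff_1]])
      from tendsto_mult[OF tendsto_const tendsto_mult[OF this tendsto_const], of "m z" "?d z"]
      show "(\<lambda>n. m z * (cutoff (real (Suc n)) (snd z) * ?d z)) \<longlonglongrightarrow> m z * ?d z" by simp
    qed
    show "AE z in lborel. norm (m z * (cutoff (real (Suc n)) (snd z) * ?d z)) \<le> 2 * \<bar>m z\<bar>" for n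
    proof (rule AE_I2)
      fix z :: "'a \<times> 'a"
      have "\<bar>m z\<bar> * (\<bar>cutoff (real (Suc n)) (snd z)\<bar> * \<bar>?d z\<bar>) \<le> \<bar>m z\<bar> * (1 * 2)"
        using cutoff_bounds[of "real (Suc n)" "snd z"] db[of z] by (intro mult_left_mono mult_mono) auto
      then show "norm (m z * (cutoff (real (Suc n)) (snd z) * ?d z)) \<le> 2 * \<bar>m z\<bar>"
        by (simp add: abs_mult mult.commute)
    qed
  qed (use mi in \<open>auto intro!: borel_measurable_times dm cm\<close>)
  then have "(\<lambda>n. \<bar>\<integral>z. m z * (cutoff (real (Suc n)) (snd z) * ?d z) \<partial>lborel\<bar>) \<longlonglongrightarrow> \<bar>\<integral>z. m z * ?d z \<partial>lborel\<bar>"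
    by (rule tendsto_rabs)
  then show ?thesis
    by (rule LIMSEQ_le_const2) (intro exI[of _ 0] allI impI main, simp)
qed

end

end

text \<open>Two limits lead from smooth to measurable \<open>f\<close>: the mollified functions
  converge boundedly to continuous compactly supported data, and \<open>tv_bound_extend\<close>
  reaches \<open>f\<close> because both image laws are absolutely continuous.\<close>

lemma shear_tv_bound:
  fixes m :: "'a::euclidean_space \<times> 'a \<Rightarrow> real" and g :: "'a \<times> 'a \<Rightarrow> 'a"
  defines "\<mu> \<equiv> density lborel (\<lambda>z. ennreal (m z))"
  assumes m0: "\<And>z. 0 \<le> m z" and prob: "prob_space \<mu>" and wg: "weak_x_grad m g"
    and gi: "integrable lborel (\<lambda>z. norm (\<alpha> *\<^sub>R snd z + h0) * norm (g z))"
    and f: "f \<in> borel_measurable borel" "\<And>x. \<bar>f x\<bar> \<le> (1::real)"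
  shows "\<bar>(\<integral>z. f (fst z + (\<alpha> *\<^sub>R snd z + h0)) \<partial>\<mu>) - (\<integral>z. f (fst z) \<partial>\<mu>)\<bar>
     \<le> (\<integral>z. norm (\<alpha> *\<^sub>R snd z + h0) * norm (g z) \<partial>lborel)"
proof -
  interpret prob_space \<mu> by fact
  have mm: "m \<in> borel_measurable borel" using wg by (simp add: weak_x_grad_def)
  have "(\<integral>\<^sup>+z. ennreal (m z) \<partial>lborel) = emeasure \<mu> (space \<mu>)"
    unfolding \<mu>_def using mm by (simp add: emeasure_density)
  then have "has_bochner_integral lborel m 1"
    using emeasure_space_1 mm m0 by (intro has_bochner_integral_nn_integral) auto
  then have mi: "integrable lborel m" by (auto simp: has_bochner_integral_iff)
  have sets\<mu>: "sets \<mu> = sets borel" by (simp add: \<mu>_def)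
  let ?S = "\<lambda>z. fst z + (\<alpha> *\<^sub>R snd z + h0)"
  have Sm: "?S \<in> borel_measurable (borel :: ('a \<times> 'a) measure)"
    by (intro borel_measurable_continuous_onI continuous_intros)
  have meas: "?S \<in> measurable \<mu> borel" "fst \<in> measurable \<mu> borel"
    using Sm borel_fst measurable_cong_sets[OF sets\<mu> refl] by blast+
  have eqI: "(\<integral>z. k (?S z) \<partial>\<mu>) = (\<integral>z. m z * k (?S z) \<partial>lborel)"
    "(\<integral>z. k (fst z) \<partial>\<mu>) = (\<integral>z. m z * k (fst z) \<partial>lborel)" if k: "k \<in> borel_measurable borel" for k :: "'a \<Rightarrow> real"
    unfolding \<mu>_def using measurable_compose[OF Sm k] measurable_compose[OF borel_fst k] mm m0
    by (subst integral_density; simp)+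
  have bound: "\<bar>(\<integral>z. k z \<partial>distr \<mu> borel ?S) - (\<integral>z. k z \<partial>distr \<mu> borel fst)\<bar>
     \<le> (\<integral>z. norm (\<alpha> *\<^sub>R snd z + h0) * norm (g z) \<partial>lborel)" (is "_ \<le> ?c")
    if hf: "heat_flow k a b" for k a b
  proof -
    interpret heat_flow k a b by fact
    have km: "k \<in> borel_measurable borel" by (rule borel_measurable_continuous_onI[OF f_cont])
    have bm: "mollified (real (Suc n)) \<in> borel_measurable borel" for n
      by (rule borel_measurable_continuous_onI[OF continuous_on_mollified]) simp
    have lim: "(\<lambda>n. \<integral>z. mollified (real (Suc n)) (h z) \<partial>\<mu>) \<longlonglongrightarrow> (\<integral>z. k (h z) \<partial>\<mu>)" if h: "h \<in> measurable \<mu> borel" for h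
      by (rule integral_dominated_convergence[where w="\<lambda>_. 1"])
         (use measurable_compose[OF h km] measurable_compose[OF h bm] mollified_tendsto mollified_bound in auto)
    have "\<bar>(\<integral>z. mollified (real (Suc n)) (?S z) \<partial>\<mu>) - (\<integral>z. mollified (real (Suc n)) (fst z) \<partial>\<mu>)\<bar> \<le> ?c" for n
    proof -
      have i: "integrable lborel (\<lambda>z. m z * mollified (real (Suc n)) (h z))" if h: "h \<in> measurable lborel borel" for h
        by (rule Bochner_Integration.integrable_bound[OF mi])
           (use mm measurable_compose[OF h bm] mollified_bound[of "real (Suc n)"] m0 in
             \<open>auto simp: abs_mult intro!: mult_left_le\<close>)
      have "(\<integral>z. mollified (real (Suc n)) (?S z) \<partial>\<mu>) - (\<integral>z. mollified (real (Suc n)) (fst z) \<partial>\<mu>)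
        = (\<integral>z. m z * (mollified (real (Suc n)) (?S z) - mollified (real (Suc n)) (fst z)) \<partial>lborel)"
        unfolding eqI[OF bm] right_diff_distrib using Sm borel_fst
        by (subst Bochner_Integration.integral_diff[OF i i]) simp_all
      then show ?thesis using shear_mollified_bound[OF _ mi wg gi, of "real (Suc n)"] by simp
    qed
    moreover have "(\<lambda>n. \<bar>(\<integral>z. mollified (real (Suc n)) (?S z) \<partial>\<mu>) - (\<integral>z. mollified (real (Suc n)) (fst z) \<partial>\<mu>)\<bar>)
        \<longlonglongrightarrow> \<bar>(\<integral>z. k (?S z) \<partial>\<mu>) - (\<integral>z. k (fst z) \<partial>\<mu>)\<bar>"
      by (intro tendsto_rabs tendsto_diff lim meas)
    ultimately have "\<bar>(\<integral>z. k (?S z) \<partial>\<mu>) - (\<integral>z. k (fst z) \<partial>\<mu>)\<bar> \<le> ?c"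
      by (intro LIMSEQ_le_const2) blast+
    then show ?thesis using meas km by (simp add: integral_distr)
  qed
  have ac: "absolutely_continuous lborel (distr \<mu> borel ?S)"
    unfolding \<mu>_def by (rule absolutely_continuous_shear[OF _ mm])
       (intro borel_measurable_continuous_onI continuous_intros)
  have ac0: "absolutely_continuous lborel (distr \<mu> borel fst)"
    using absolutely_continuous_shear[OF _ mm, of "\<lambda>_. 0"] unfolding \<mu>_def by simp
  have "\<bar>(\<integral>z. f z \<partial>distr \<mu> borel ?S) - (\<integral>z. f z \<partial>distr \<mu> borel fst)\<bar> \<le> ?c"
    by (rule tv_bound_extend[OF _ _ ac _ _ ac0 bound f]) (auto intro: prob_space_distr meas)
  then show ?thesis using meas f by (simp add: integral_distr)
qed

section \<open>Gibbs weights and the L1 bound on the x-gradient\<close>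

lemma integrable_lborel_product:
  fixes F :: "'a::euclidean_space \<Rightarrow> real" and G :: "'b::euclidean_space \<Rightarrow> real"
  assumes F: "integrable lborel F" "\<And>x. 0 \<le> F x" and G: "integrable lborel G" "\<And>x. 0 \<le> G x"
  shows "integrable lborel (\<lambda>z. F (fst z) * G (snd z))"
proof -
  have [measurable]: "F \<in> borel_measurable lborel" "G \<in> borel_measurable lborel"
    using F(1) G(1) by (auto dest: borel_measurable_integrable)
  have "integrable (lborel \<Otimes>\<^sub>M lborel) (\<lambda>z. F (fst z) * G (snd z))"
  proof (rule integrableI_nonneg)
    have "(\<integral>\<^sup>+z. ennreal (F (fst z) * G (snd z)) \<partial>(lborel \<Otimes>\<^sub>M lborel))
        = (\<integral>\<^sup>+x. (\<integral>\<^sup>+y. ennreal (F x) * ennreal (G y) \<partial>lborel) \<partial>lborel)"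
      by (subst lborel.nn_integral_fst[symmetric]) (auto simp: ennreal_mult F G)
    also have "\<dots> = (\<integral>\<^sup>+x. ennreal (F x) \<partial>lborel) * (\<integral>\<^sup>+y. ennreal (G y) \<partial>lborel)"
      by (simp add: nn_integral_cmult nn_integral_multc)
    also have "\<dots> < \<infinity>"
      using F G by (auto simp: nn_integral_eq_integral ennreal_mult[symmetric])
    finally show "(\<integral>\<^sup>+z. ennreal (F (fst z) * G (snd z)) \<partial>(lborel \<Otimes>\<^sub>M lborel)) < \<infinity>" .
  qed (use F G in auto)
  then show ?thesis by (simp only: lborel_prod)
qed

text \<open>With q = |v|^2 / 4 the weight is at most (2 + 8 q) exp(-q) exp(-q) <= 10 exp(-q), and
  the last expression is a multiple of the heat kernel at time 1. \<open>K\<close> is the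
  normalisation of that kernel.\<close>

lemma integrable_gaussian_weight:
  "integrable lborel (\<lambda>v::'a::euclidean_space. (1 + norm v)\<^sup>2 * exp (- ((norm v)\<^sup>2 / 2)))"
proof -
  define K where "K = (4 * pi) powr (- (real DIM('a) / 2))"
  have K: "K > 0" by (simp add: K_def)
  have "integrable lborel (\<lambda>z. hk 1 (0 - z :: 'a))"
    using has_bochner_integral_hk[of 1 "0::'a"] by (auto simp: has_bochner_integral_iff)
  then have i: "integrable lborel (\<lambda>z. 10 / K * hk 1 (0 - z :: 'a))" by simp
  show ?thesis
  proof (rule Bochner_Integration.integrable_bound[OF i])
    show "AE v in lborel. norm ((1 + norm v)\<^sup>2 * exp (- ((norm v)\<^sup>2 / 2))) \<le> norm (10 / K * hk 1 (0 - v :: 'a))"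
    proof (rule AE_I2)
      fix v :: 'a
      let ?q = "(norm v)\<^sup>2 / 4"
      have "?q \<le> exp ?q" using exp_ge_add_one_self[of ?q] by linarith
      then have "?q * exp (- ?q) \<le> exp ?q * exp (- ?q)" by (rule mult_right_mono) simp
      then have e: "exp (- ?q) \<le> 1" "?q * exp (- ?q) \<le> 1"
        by (simp, simp only: exp_add[symmetric] add.right_inverse exp_zero)
      have "(1 + norm v)\<^sup>2 \<le> 2 + 8 * ?q"
        using sum_squares_bound[of 1 "norm v"] by (simp add: power2_eq_square algebra_simps)
      then have "(1 + norm v)\<^sup>2 * exp (- ?q) \<le> (2 + 8 * ?q) * exp (- ?q)"
        by (rule mult_right_mono) simp
      also have "\<dots> = 2 * exp (- ?q) + 8 * (?q * exp (- ?q))" by (simp add: algebra_simps)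
      also have "\<dots> \<le> 10" using e by linarith
      finally have "(1 + norm v)\<^sup>2 * exp (- ?q) * exp (- ?q) \<le> 10 * exp (- ?q)"
        by (rule mult_right_mono) simp
      moreover have "exp (- ((norm v)\<^sup>2 / 2)) = exp (- ?q) * exp (- ?q)"
        by (simp add: exp_add[symmetric])
      moreover have "10 / K * hk 1 (0 - v) = 10 * exp (- ?q)"
        using K by (simp add: hk_eq K_def)
      ultimately show "norm ((1 + norm v)\<^sup>2 * exp (- ((norm v)\<^sup>2 / 2))) \<le> norm (10 / K * hk 1 (0 - v))"
        by (simp add: mult.assoc)
    qed
  qed (auto intro!: borel_measurable_continuous_onI continuous_intros)
qed

text \<open>Young's inequality against the Gibbs weight turns the weighted L2 bound into an L1 bound.\<close>

lemma weighted_gradient_L1: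
  fixes Phi :: "'a::euclidean_space \<Rightarrow> real" and g :: "'a \<times> 'a \<Rightarrow> 'a"
  assumes Phi: "integrable lborel (\<lambda>x. exp (- Phi x))" "Phi \<in> borel_measurable borel"
    and g: "g \<in> borel_measurable borel"
    and fin: "(\<integral>\<^sup>+z. ennreal (norm (g z) ^ 2 * exp (Hamil Phi z)) \<partial>lborel) < \<infinity>"
    and M: "sqrt (enn2real (\<integral>\<^sup>+z. ennreal (norm (g z) ^ 2 * exp (Hamil Phi z)) \<partial>lborel)) \<le> M"
  defines "Z \<equiv> \<integral>z. exp (- Phi (fst z)) * ((1 + norm (snd z))\<^sup>2 * exp (- ((norm (snd z :: 'a))\<^sup>2 / 2))) \<partial>lborel"
  shows "integrable lborel (\<lambda>z. (1 + norm (snd z)) * norm (g z))"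
    and "(\<integral>z. (1 + norm (snd z)) * norm (g z) \<partial>lborel) \<le> (Z + M\<^sup>2) / 2"
proof -
  let ?w = "\<lambda>z::'a \<times> 'a. exp (- Phi (fst z)) * ((1 + norm (snd z))\<^sup>2 * exp (- ((norm (snd z))\<^sup>2 / 2)))"
  let ?G = "\<lambda>z. norm (g z) ^ 2 * exp (Hamil Phi z)"
  note [measurable] = Phi(2) g borel_fst borel_snd
  have Hm [measurable]: "Hamil Phi \<in> borel_measurable borel"
    unfolding Hamil_def[abs_def] by measurable
  have w: "integrable lborel ?w"
    by (rule integrable_lborel_product[OF Phi(1) _ integrable_gaussian_weight]) auto
  have Gi: "integrable lborel ?G"
    by (rule integrableI_nonneg) (use fin in auto)
  have "sqrt (\<integral>z. ?G z \<partial>lborel) \<le> M"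
    using M by (subst integral_eq_nn_integral) auto
  then have "(sqrt (\<integral>z. ?G z \<partial>lborel))\<^sup>2 \<le> M\<^sup>2" by (intro power_mono) auto
  then have GM: "(\<integral>z. ?G z \<partial>lborel) \<le> M\<^sup>2" by simp
  \<comment> \<open>The product is split as (1 + |v|) exp(-H / 2) times |g| exp(H / 2). The squares
    of these factors are the Gibbs weight with its polynomial and the integrand of the weighted
    norm.\<close>
  have young: "(1 + norm (snd z)) * norm (g z) \<le> (?w z + ?G z) / 2" for z
  proof -
    let ?e = "exp (Hamil Phi z / 2)"
    have e: "?e * ?e = exp (Hamil Phi z)" "?e > 0" by (auto simp: exp_add[symmetric])
    have w_eq: "?w z = ((1 + norm (snd z)) * inverse ?e)\<^sup>2"
    proof -
      have "(inverse ?e)\<^sup>2 = exp (- Phi (fst z)) * exp (- ((norm (snd z))\<^sup>2 / 2))"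
        by (simp add: exp_minus[symmetric] exp_add[symmetric] power2_eq_square Hamil_def)
      then show ?thesis by (simp add: power_mult_distrib)
    qed
    have G_eq: "?G z = (norm (g z) * ?e)\<^sup>2"
      using e by (simp add: power_mult_distrib power2_eq_square)
    have "(1 + norm (snd z)) * norm (g z) = ((1 + norm (snd z)) * inverse ?e) * (norm (g z) * ?e)"
      using e(2) by simp
    also have "\<dots> \<le> (((1 + norm (snd z)) * inverse ?e)\<^sup>2 + (norm (g z) * ?e)\<^sup>2) / 2"
      using sum_squares_bound[of "(1 + norm (snd z)) * inverse ?e" "norm (g z) * ?e"] by simp
    finally show ?thesis unfolding w_eq G_eq .
  qed
  have wG: "integrable lborel (\<lambda>z. (?w z + ?G z) / 2)" using w Gi by simp
  show i: "integrable lborel (\<lambda>z. (1 + norm (snd z)) * norm (g z))"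
  proof (rule Bochner_Integration.integrable_bound[OF wG])
    show "AE z in lborel. norm ((1 + norm (snd z)) * norm (g z)) \<le> norm ((?w z + ?G z) / 2)"
    proof (rule AE_I2)
      fix z
      have "norm ((1 + norm (snd z)) * norm (g z)) = (1 + norm (snd z)) * norm (g z)" by simp
      also have "\<dots> \<le> norm ((?w z + ?G z) / 2)" 
        unfolding real_norm_def by (rule order_trans[OF young abs_ge_self])
      finally show "norm ((1 + norm (snd z)) * norm (g z)) \<le> norm ((?w z + ?G z) / 2)" .
    qed
  qed measurable
  have "(\<integral>z. (1 + norm (snd z)) * norm (g z) \<partial>lborel) \<le> (\<integral>z. (?w z + ?G z) / 2 \<partial>lborel)"
    by (rule integral_mono[OF i wG young])
  also have "\<dots> = (Z + (\<integral>z. ?G z \<partial>lborel)) / 2" using w Gi by (simp add: Z_def)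
  also have "\<dots> \<le> (Z + M\<^sup>2) / 2" using GM by simp
  finally show "(\<integral>z. (1 + norm (snd z)) * norm (g z) \<partial>lborel) \<le> (Z + M\<^sup>2) / 2" .
qed

section \<open>The total variation distance and integrals controlled by it\<close>

definition tv :: "'a::euclidean_space measure \<Rightarrow> 'a measure \<Rightarrow> real" where
  "tv \<mu> \<nu> = (SUP h\<in>{h \<in> borel_measurable borel. \<forall>x. \<bar>h x\<bar> \<le> 1}. \<bar>(\<integral>x. h x \<partial>\<mu>) - (\<integral>x. h x \<partial>\<nu>)\<bar>)"

text \<open>For integrable \<open>h\<close> this is monotonicity; otherwise the integral is 0 by
  convention.\<close>

lemma prob_integral_le_1:
  fixes h :: "'b \<Rightarrow> real"
  assumes "prob_space \<mu>" "\<And>x. \<bar>h x\<bar> \<le> 1"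
  shows "\<bar>\<integral>x. h x \<partial>\<mu>\<bar> \<le> 1"
proof (cases "integrable \<mu> h")
  case True
  interpret prob_space \<mu> by fact
  have "\<bar>\<integral>x. h x \<partial>\<mu>\<bar> \<le> (\<integral>x. \<bar>h x\<bar> \<partial>\<mu>)" by (rule integral_abs_bound)
  also have "\<dots> \<le> (\<integral>x. 1 \<partial>\<mu>)" using True assms by (intro integral_mono) auto
  finally show ?thesis by (simp add: prob_space)
qed (simp add: not_integrable_integral_eq)

lemma tv_upper:
  fixes \<mu> \<nu> :: "'a::euclidean_space measure"
  assumes "prob_space \<mu>" "prob_space \<nu>" "h \<in> borel_measurable borel" "\<And>x. \<bar>h x\<bar> \<le> 1"
  shows "\<bar>(\<integral>x. h x \<partial>\<mu>) - (\<integral>x. h x \<partial>\<nu>)\<bar> \<le> tv \<mu> \<nu>"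
  unfolding tv_def
proof (rule cSUP_upper)
  show "bdd_above ((\<lambda>h::'a \<Rightarrow> real. \<bar>(\<integral>x. h x \<partial>\<mu>) - (\<integral>x. h x \<partial>\<nu>)\<bar>) ` {h \<in> borel_measurable borel. \<forall>x. \<bar>h x\<bar> \<le> 1})"
  proof -
    have "\<bar>(\<integral>x. h x \<partial>\<mu>) - (\<integral>x. h x \<partial>\<nu>)\<bar> \<le> 2" if "\<forall>x. \<bar>h x\<bar> \<le> 1" for h :: "'a \<Rightarrow> real"
      using that prob_integral_le_1[OF assms(1), of h] prob_integral_le_1[OF assms(2), of h] by auto
    then show ?thesis unfolding bdd_above_def by (intro exI[of _ "2::real"]) auto
  qed
qed (use assms in auto)

lemma tv_least:
  assumes "\<And>h. h \<in> borel_measurable borel \<Longrightarrow> (\<And>x. \<bar>h x\<bar> \<le> 1) \<Longrightarrow> \<bar>(\<integral>x. h x \<partial>\<mu>) - (\<integral>x. h x \<partial>\<nu>)\<bar> \<le> c"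
  shows "tv \<mu> \<nu> \<le> c"
  unfolding tv_def by (rule cSUP_least) (auto intro!: exI[of _ "\<lambda>_. 0"] assms)

lemma tv_nonneg: "prob_space \<mu> \<Longrightarrow> prob_space \<nu> \<Longrightarrow> tv \<mu> \<nu> \<ge> 0"
  using tv_upper[of \<mu> \<nu> "\<lambda>_. 0"] by simp

text \<open>Test functions take values in [-1, 1], so \<open>tv\<close> carries the normalisation
  with maximum 2. This a priori bound makes the weighted supremum in the Volterra argument
  finite.\<close>

lemma tv_le_2: "prob_space \<mu> \<Longrightarrow> prob_space \<nu> \<Longrightarrow> tv \<mu> \<nu> \<le> 2"
proof (rule tv_least)
  fix h :: "'a \<Rightarrow> real" assume "prob_space \<mu>" "prob_space \<nu>" "\<And>x. \<bar>h x\<bar> \<le> 1"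
  then show "\<bar>(\<integral>x. h x \<partial>\<mu>) - (\<integral>x. h x \<partial>\<nu>)\<bar> \<le> 2"
    using prob_integral_le_1[of \<mu> h] prob_integral_le_1[of \<nu> h] by auto
qed

text \<open>Scaling reduces to test functions bounded by 1. The maps \<open>F\<close> and
  \<open>G\<close> and the abstract constant \<open>c\<close> allow image laws and shifted arguments
  to be treated without naming their distributions.\<close>

lemma tv_bounded_function:
  fixes h :: "'a::euclidean_space \<Rightarrow> real"
  assumes \<mu>: "prob_space \<mu>" and \<nu>: "prob_space \<nu>"
    and h: "h \<in> borel_measurable borel" "\<And>x. \<bar>h x\<bar> \<le> B" and B: "0 \<le> B"
    and c: "\<And>k. k \<in> borel_measurable borel \<Longrightarrow> (\<And>x. \<bar>k x\<bar> \<le> 1) \<Longrightarrow> \<bar>(\<integral>x. k (F x) \<partial>\<mu>) - (\<integral>x. k (G x) \<partial>\<nu>)\<bar> \<le> c"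
  shows "\<bar>(\<integral>x. h (F x) \<partial>\<mu>) - (\<integral>x. h (G x) \<partial>\<nu>)\<bar> \<le> B * (c :: real)"
proof (cases "B = 0")
  case True
  then show ?thesis using h(2) by simp
next
  case False
  have "\<bar>(\<integral>x. h (F x) / B \<partial>\<mu>) - (\<integral>x. h (G x) / B \<partial>\<nu>)\<bar> \<le> c"
    by (rule c) (use h B False in \<open>auto simp: divide_le_eq\<close>)
  then have "\<bar>(\<integral>x. h (F x) \<partial>\<mu>) - (\<integral>x. h (G x) \<partial>\<nu>)\<bar> / B \<le> c"
    using B by (simp add: diff_divide_distrib[symmetric])
  then show ?thesis using B False by (simp add: divide_le_eq mult.commute)
qed

text \<open>Duality: the scalar estimate is applied to the inner product with the difference vector
  itself, so no factor depending on the dimension arises.\<close>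

lemma tv_bounded_vector:
  fixes H :: "'b::euclidean_space \<Rightarrow> 'a::euclidean_space"
  assumes \<mu>: "prob_space \<mu>" and \<nu>: "prob_space \<nu>"
    and F: "F \<in> measurable \<mu> borel" and G: "G \<in> measurable \<nu> borel"
    and H: "H \<in> borel_measurable borel" "\<And>x. norm (H x) \<le> B"
    and c: "\<And>k. k \<in> borel_measurable borel \<Longrightarrow> (\<And>x. \<bar>k x\<bar> \<le> 1) \<Longrightarrow> \<bar>(\<integral>x. k (F x) \<partial>\<mu>) - (\<integral>x. k (G x) \<partial>\<nu>)\<bar> \<le> (c::real)"
  shows "norm ((\<integral>x. H (F x) \<partial>\<mu>) - (\<integral>x. H (G x) \<partial>\<nu>)) \<le> B * c"
proof -
  interpret \<mu>: prob_space \<mu> by fact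
  interpret \<nu>: prob_space \<nu> by fact
  let ?w = "(\<integral>x. H (F x) \<partial>\<mu>) - (\<integral>x. H (G x) \<partial>\<nu>)"
  have B: "B \<ge> 0" using order_trans[OF norm_ge_zero H(2)] .
  have i: "integrable \<mu> (\<lambda>x. H (F x))" "integrable \<nu> (\<lambda>x. H (G x))"
    using measurable_compose[OF F H(1)] measurable_compose[OF G H(1)] H(2)
    by (auto intro!: \<mu>.integrable_const_bound[where B=B] \<nu>.integrable_const_bound[where B=B])
  have Hw: "\<bar>H x \<bullet> ?w\<bar> \<le> B * norm ?w" for x
    by (rule order_trans[OF Cauchy_Schwarz_ineq2]) (intro mult_right_mono H(2) norm_ge_zero)
  have "norm ?w * norm ?w = \<bar>?w \<bullet> ?w\<bar>" by (simp add: power2_norm_eq_inner[symmetric] power2_eq_square)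
  also have "?w \<bullet> ?w = (\<integral>x. H (F x) \<bullet> ?w \<partial>\<mu>) - (\<integral>x. H (G x) \<bullet> ?w \<partial>\<nu>)"
    using i by (simp add: inner_diff_left)
  also have "\<bar>\<dots>\<bar> \<le> (B * norm ?w) * c"
    by (rule tv_bounded_function[OF \<mu> \<nu> _ Hw _ c])
       (use H(1) B in auto)
  finally have *: "norm ?w * norm ?w \<le> (B * c) * norm ?w" by (simp add: mult_ac)
  have "c \<ge> 0" using c[of "\<lambda>_. 0"] by simp
  show ?thesis
  proof (cases "norm ?w = 0")
    case False
    then show ?thesis using * by (intro mult_right_le_imp_le[of "norm ?w" "norm ?w"]) auto
  qed (use B \<open>c \<ge> 0\<close> in simp)
qed

text \<open>A coupling of cost below \<open>\<delta>\<^sup>2\<close> is chosen, and d <= (d^2 /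
  \<delta> + \<delta>) / 2 bounds its mean distance by \<delta>, in place of the Cauchy-Schwarz
  inequality.\<close>

lemma W2sq_lipschitz:
  fixes \<mu> \<nu> :: "'b::euclidean_space measure"
  assumes W: "W2sq \<mu> \<nu> < ennreal (\<delta>\<^sup>2)" and \<delta>: "\<delta> > 0"
    and F: "F \<in> borel_measurable borel" "\<And>x. \<bar>F x\<bar> \<le> (1::real)"
    and L: "\<And>x y. \<bar>F x - F y\<bar> \<le> L * norm (x - y)" "L \<ge> 0"
  shows "\<bar>(\<integral>x. F x \<partial>\<mu>) - (\<integral>x. F x \<partial>\<nu>)\<bar> \<le> L * \<delta>"
proof -
  obtain \<pi> where \<pi>: "\<pi> \<in> couplings \<mu> \<nu>"
    and lt: "(\<integral>\<^sup>+p. ennreal (dist (fst p) (snd p) ^ 2) \<partial>\<pi>) < ennreal (\<delta>\<^sup>2)"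
    using W unfolding W2sq_def by (auto simp: INF_less_iff)
  from \<pi> have p: "prob_space \<pi>" "sets \<pi> = sets borel" "distr \<pi> borel fst = \<mu>" "distr \<pi> borel snd = \<nu>"
    by (auto simp: couplings_def)
  interpret prob_space \<pi> by fact
  have m: "fst \<in> measurable \<pi> borel" "snd \<in> measurable \<pi> borel"
    using borel_fst borel_snd measurable_cong_sets[OF p(2) refl] by blast+
  let ?d = "\<lambda>p. dist (fst p) (snd p)"
  have dm: "?d \<in> borel_measurable \<pi>" using m by measurable
  have di2: "integrable \<pi> (\<lambda>p. ?d p ^ 2)"
    by (rule integrableI_nonneg) (use dm lt in \<open>auto intro: less_trans ennreal_less_top\<close>)
  have "ennreal (\<integral>p. ?d p ^ 2 \<partial>\<pi>) < ennreal (\<delta>\<^sup>2)"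
    using lt by (subst (asm) nn_integral_eq_integral[OF di2]) auto
  then have d2: "(\<integral>p. ?d p ^ 2 \<partial>\<pi>) \<le> \<delta>\<^sup>2"
    by (simp add: ennreal_less_iff less_imp_le)
  have Fi: "integrable \<pi> (\<lambda>p. F (fst p))" "integrable \<pi> (\<lambda>p. F (snd p))"
    using measurable_compose[OF m(1) F(1)] measurable_compose[OF m(2) F(1)] F(2)
    by (auto intro!: integrable_const_bound[where B=1])
  have bi: "integrable \<pi> (\<lambda>p. L * ((?d p ^ 2 / \<delta> + \<delta>) / 2))" using di2 by simp
  have "(\<integral>x. F x \<partial>\<mu>) - (\<integral>x. F x \<partial>\<nu>) = (\<integral>p. F (fst p) - F (snd p) \<partial>\<pi>)"
    using Fi m F(1) unfolding p(3,4)[symmetric] by (simp add: integral_distr)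
  also have "\<bar>\<dots>\<bar> \<le> (\<integral>p. \<bar>F (fst p) - F (snd p)\<bar> \<partial>\<pi>)" by (rule integral_abs_bound)
  also have "\<dots> \<le> (\<integral>p. L * ((?d p ^ 2 / \<delta> + \<delta>) / 2) \<partial>\<pi>)"
  proof (rule integral_mono[OF _ bi])
    show "integrable \<pi> (\<lambda>p. \<bar>F (fst p) - F (snd p)\<bar>)" using Fi by simp
    fix p :: "'b \<times> 'b"
    have "0 \<le> (?d p - \<delta>)\<^sup>2 / \<delta>" using \<delta> by simp
    also have "\<dots> = ?d p ^ 2 / \<delta> + \<delta> - 2 * ?d p" using \<delta> by (simp add: field_simps power2_eq_square)
    finally have "?d p \<le> (?d p ^ 2 / \<delta> + \<delta>) / 2" by simp
    from mult_left_mono[OF this L(2)] show "\<bar>F (fst p) - F (snd p)\<bar> \<le> L * ((?d p ^ 2 / \<delta> + \<delta>) / 2)"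
      using L(1)[of "fst p" "snd p"] by (simp add: dist_norm)
  qed
  also have "\<dots> = L * (((\<integral>p. ?d p ^ 2 \<partial>\<pi>) / \<delta> + \<delta>) / 2)" using di2 by (simp add: prob_space)
  also have "\<dots> \<le> L * ((\<delta>\<^sup>2 / \<delta> + \<delta>) / 2)"
    using d2 \<delta> L(2) by (intro mult_left_mono divide_right_mono add_right_mono) auto
  also have "\<dots> = L * \<delta>" using \<delta> by (simp add: power2_eq_square)
  finally show ?thesis .
qed

section \<open>Integrals of the weakly singular kernel, regularised by a time shift\<close>

lemma singular_kernel_integral:
  assumes "0 \<le> t1" "0 < \<epsilon>"
  shows "integral {0..t1} (\<lambda>t. 1 / sqrt (t1 + \<epsilon> - t)) \<le> 2 * sqrt (t1 + \<epsilon>)"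
proof -
  have "((\<lambda>t. 1 / sqrt (t1 + \<epsilon> - t)) has_integral
     (- 2 * sqrt (t1 + \<epsilon> - t1) - - 2 * sqrt (t1 + \<epsilon> - 0))) {0..t1}"
  proof (rule fundamental_theorem_of_calculus[OF assms(1)])
    fix t assume t: "t \<in> {0..t1}"
    then have "((\<lambda>t. - 2 * sqrt (t1 + \<epsilon> - t)) has_real_derivative 1 / sqrt (t1 + \<epsilon> - t)) (at t)"
      using assms by (auto intro!: derivative_eq_intros simp: field_simps)
    then show "((\<lambda>t. - 2 * sqrt (t1 + \<epsilon> - t)) has_vector_derivative 1 / sqrt (t1 + \<epsilon> - t)) (at t within {0..t1})"
      by (simp add: has_real_derivative_iff_has_vector_derivative[symmetric] has_field_derivative_at_within)
  qed
  from integral_unique[OF this] show ?thesis using assms by simp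
qed

text \<open>The weight \<open>exp (l * t)\<close> makes the singular Volterra kernel small for large \<open>l\<close>; using
  \<open>exp (- l * r) \<le> 1 / (1 + l * r)\<close> the integral becomes an explicit arctangent.\<close>

lemma singular_kernel_integral_exp:
  assumes "0 \<le> t1" "0 < \<epsilon>" and l: "0 < l"
  shows "integral {0..t1} (\<lambda>t. exp (l * t) / sqrt (t1 + \<epsilon> - t)) \<le> exp (l * (t1 + \<epsilon>)) * (pi / sqrt l)"
proof -
  let ?r = "\<lambda>t. t1 + \<epsilon> - t"
  let ?g = "\<lambda>t. exp (l * (t1 + \<epsilon>)) * (1 / (sqrt (?r t) * (1 + l * ?r t)))"
  \<comment> \<open>The antiderivative comes from the substitution u = sqrt (l * r), with r the
    remaining time, which turns the integrand into a multiple of 1 / (1 + u^2).\<close>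
  let ?A = "\<lambda>t. - (2 / sqrt l) * arctan (sqrt (l * ?r t))"
  have h: "((\<lambda>t. 1 / (sqrt (?r t) * (1 + l * ?r t))) has_integral (?A t1 - ?A 0)) {0..t1}"
  proof (rule fundamental_theorem_of_calculus[OF assms(1)])
    fix t assume t: "t \<in> {0..t1}"
    then have r: "?r t > 0" using assms by auto
    have s: "((\<lambda>t. sqrt (l * ?r t)) has_real_derivative inverse (sqrt (l * ?r t)) / 2 * (- l)) (at t)"
      by (rule DERIV_chain2[OF DERIV_real_sqrt]) (use r l in \<open>auto intro!: derivative_eq_intros\<close>)
    have "(?A has_real_derivative (- (2 / sqrt l)) * (inverse (1 + (sqrt (l * ?r t))\<^sup>2) * (inverse (sqrt (l * ?r t)) / 2 * (- l)))) (at t)"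
      by (rule DERIV_cmult[OF DERIV_chain2[OF DERIV_arctan s]])
    moreover have "(- (2 / sqrt l)) * (inverse (1 + (sqrt (l * ?r t))\<^sup>2) * (inverse (sqrt (l * ?r t)) / 2 * (- l)))
      = 1 / (sqrt (?r t) * (1 + l * ?r t))"
    proof -
      have alg: "- (2 / u) * (inverse x * (inverse (u * v) / 2 * - y)) = 1 / (v * x)"
        if "u \<noteq> 0" "v \<noteq> 0" "x \<noteq> 0" "y = u * u" for u v x y :: real
        using that by (simp add: field_simps)
      have "1 + l * ?r t > 0" using r l by (simp add: add_pos_pos)
      moreover have sq: "(sqrt (l * ?r t))\<^sup>2 = l * ?r t" using r l by simp
      ultimately show ?thesis
        unfolding sq
        by (intro alg[of "sqrt l" "sqrt (?r t)" "1 + l * ?r t" l, folded real_sqrt_mult]) (use r l in auto)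
    qed
    ultimately have "(?A has_real_derivative 1 / (sqrt (?r t) * (1 + l * ?r t))) (at t)" by simp
    then show "(?A has_vector_derivative 1 / (sqrt (?r t) * (1 + l * ?r t))) (at t within {0..t1})"
      by (simp add: has_real_derivative_iff_has_vector_derivative[symmetric] has_field_derivative_at_within)
  qed
  have "integral {0..t1} (\<lambda>t. exp (l * t) / sqrt (?r t)) \<le> integral {0..t1} ?g"
  proof (rule integral_le)
    show "(\<lambda>t. exp (l * t) / sqrt (?r t)) integrable_on {0..t1}"
      using assms by (intro integrable_continuous_real continuous_intros) auto
    show "?g integrable_on {0..t1}" using has_integral_integrable[OF h] by (rule integrable_on_mult_right)
    fix t assume t: "t \<in> {0..t1}"
    then have r: "?r t > 0" using assms by auto
    then have "1 + l * ?r t > 0" using l by (simp add: add_pos_pos)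
    have "exp (l * t) = exp (l * (t1 + \<epsilon>)) * exp (- (l * ?r t))"
      by (simp add: exp_add[symmetric] algebra_simps)
    also have "exp (- (l * ?r t)) \<le> 1 / (1 + l * ?r t)"
      using exp_ge_add_one_self[of "l * ?r t"] \<open>1 + l * ?r t > 0\<close>
      by (simp add: exp_minus inverse_eq_divide[symmetric] le_imp_inverse_le)
    finally have "exp (l * t) \<le> exp (l * (t1 + \<epsilon>)) * (1 / (1 + l * ?r t))" by simp
    from divide_right_mono[OF this, of "sqrt (?r t)"] show "exp (l * t) / sqrt (?r t) \<le> ?g t"
      using r by (simp add: mult.commute)
  qed
  also have "\<dots> = exp (l * (t1 + \<epsilon>)) * (?A t1 - ?A 0)"
    by (rule integral_unique[OF has_integral_mult_right[OF h]])
  also have "\<dots> \<le> exp (l * (t1 + \<epsilon>)) * (pi / sqrt l)"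
  proof (rule mult_left_mono)
    have "arctan (sqrt (l * ?r t1)) \<ge> 0" using assms by (simp add: zero_le_arctan_iff)
    then have "2 / sqrt l * (arctan (sqrt (l * ?r 0)) - arctan (sqrt (l * ?r t1))) \<le> 2 / sqrt l * (pi / 2)"
      using arctan_ubound[of "sqrt (l * ?r 0)"] l by (intro mult_left_mono; linarith?) auto
    then show "?A t1 - ?A 0 \<le> pi / sqrt l" by (simp add: right_diff_distrib)
  qed simp
  finally show ?thesis .
qed

section \<open>Time-integrated weak formulations\<close>

context heat_flow
begin

text \<open>Measure and integrand both move. With the integrand frozen at time t, continuity follows
  from the Wasserstein continuity of the curve and the Lipschitz bound of the flow; the change of
  the integrand is small uniformly in z by \<open>P_time_lipschitz\<close>.\<close>

lemma flow_along_curve_continuous: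
  fixes \<nu> :: "real \<Rightarrow> 'e::euclidean_space measure" and Y :: "'e \<Rightarrow> 'a"
  assumes \<nu>: "P2_curve T \<nu>" and Y: "bounded_linear Y" and t1: "t1 \<le> T" "t1 < \<tau>"
  shows "continuous_on {0..t1} (\<lambda>t. \<integral>z. P (\<tau> - t) (Y z) \<partial>\<nu> t)"
  unfolding continuous_on_def
proof (intro ballI)
  fix t assume t: "t \<in> {0..t1}"
  define m where "m = \<tau> - t1"
  have m: "m > 0" using t1 by (simp add: m_def)
  have mt: "\<tau> - s \<ge> m" if "s \<in> {0..t1}" for s using that by (simp add: m_def)
  have pr: "prob_space (\<nu> s)" "sets (\<nu> s) = sets borel" if "s \<in> {0..t1}" for s
    using \<nu> that t1 by (auto simp: P2_curve_def P2_def)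
  have Ym: "Y \<in> borel_measurable borel"
    by (intro borel_measurable_continuous_onI linear_continuous_on Y)
  have Pm: "(\<lambda>z. P s (Y z)) \<in> borel_measurable borel" if "s > 0" for s
    by (rule measurable_compose[OF Ym borel_measurable_continuous_onI[OF continuous_on_P[OF that]]])
  have Pi: "integrable (\<nu> s) (\<lambda>z. P r (Y z))" if "s \<in> {0..t1}" "r > 0" for r s
  proof -
    interpret prob_space "\<nu> s" by (rule pr[OF that(1)])
    show ?thesis using Pm[OF that(2)] P_bound[OF that(2)] measurable_cong_sets[OF pr(2)[OF that(1)] refl]
      by (intro integrable_const_bound[where B=1]) auto
  qed
  let ?a = "\<lambda>s. \<integral>z. P (\<tau> - t) (Y z) \<partial>\<nu> s"
  let ?A = "\<lambda>s. \<integral>z. P (\<tau> - s) (Y z) \<partial>\<nu> s"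
  have \<tau>t: "\<tau> - t > 0" using mt[OF t] m by linarith
  obtain Ly where Ly: "\<And>z. norm (Y z) \<le> norm z * Ly" "Ly > 0"
    using bounded_linear.pos_bounded[OF Y] by blast
  define L where "L = flowC1 TYPE('a) / sqrt (\<tau> - t) * Ly"
  have L: "L > 0" using flowC1_pos[where 'a='a] \<tau>t Ly(2) by (simp add: L_def)
  have lip: "\<bar>P (\<tau> - t) (Y x) - P (\<tau> - t) (Y y)\<bar> \<le> L * norm (x - y)" for x y
  proof -
    have "\<bar>P (\<tau> - t) (Y x) - P (\<tau> - t) (Y y)\<bar> \<le> flowC1 TYPE('a) / sqrt (\<tau> - t) * norm (Y (x - y))"
      using P_lipschitz[OF \<tau>t, of "Y x" "Y y"] by (simp add: linear_diff bounded_linear.linear[OF Y])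
    also have "\<dots> \<le> flowC1 TYPE('a) / sqrt (\<tau> - t) * (norm (x - y) * Ly)"
      using flowC1_pos[where 'a='a] \<tau>t by (intro mult_left_mono Ly) auto
    finally show ?thesis by (simp add: L_def mult_ac)
  qed
  have "(?a \<longlongrightarrow> ?a t) (at t within {0..t1})"
  proof (rule tendstoI)
    fix e :: real assume e: "e > 0"
    define \<delta> where "\<delta> = e / (2 * L)"
    have \<delta>: "\<delta> > 0" using e L by (simp add: \<delta>_def)
    have "((\<lambda>s. W2sq (\<nu> s) (\<nu> t)) \<longlongrightarrow> 0) (at t within {0..T})"
      using \<nu> t t1 unfolding P2_curve_def by auto
    then have "((\<lambda>s. W2sq (\<nu> s) (\<nu> t)) \<longlongrightarrow> 0) (at t within {0..t1})"
      by (rule tendsto_within_subset) (use t1 in auto)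
    then have "eventually (\<lambda>s. W2sq (\<nu> s) (\<nu> t) < ennreal (\<delta>\<^sup>2)) (at t within {0..t1})"
      by (rule order_tendstoD) (use \<delta> in simp)
    then show "eventually (\<lambda>s. dist (?a s) (?a t) < e) (at t within {0..t1})"
    proof eventually_elim
      case (elim s)
      have "\<bar>?a s - ?a t\<bar> \<le> L * \<delta>"
        by (rule W2sq_lipschitz[OF elim \<delta> Pm[OF \<tau>t] P_bound[OF \<tau>t] lip]) (use L in simp)
      also have "L * \<delta> < e" using e L by (simp add: \<delta>_def)
      finally show ?case by (simp add: dist_real_def)
    qed
  qed
  moreover have "((\<lambda>s. ?A s - ?a s) \<longlongrightarrow> 0) (at t within {0..t1})"
  proof (rule Lim_null_comparison)
    show "eventually (\<lambda>s. norm (?A s - ?a s) \<le> flowCT TYPE('a) / m * \<bar>s - t\<bar>) (at t within {0..t1})"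
      unfolding eventually_at_filter
    proof (intro always_eventually allI impI)
      fix s assume s: "s \<in> {0..t1}"
      interpret prob_space "\<nu> s" by (rule pr[OF s])
      have \<tau>s: "\<tau> - s > 0" using mt[OF s] m by linarith
      have "?A s - ?a s = (\<integral>z. P (\<tau> - s) (Y z) - P (\<tau> - t) (Y z) \<partial>\<nu> s)"
        using Pi[OF s \<tau>s] Pi[OF s \<tau>t] by simp
      also have "norm \<dots> \<le> (\<integral>z. flowCT TYPE('a) / m * \<bar>s - t\<bar> \<partial>\<nu> s)"
      proof (rule order_trans[OF integral_norm_bound integral_mono])
        fix z
        show "norm (P (\<tau> - s) (Y z) - P (\<tau> - t) (Y z)) \<le> flowCT TYPE('a) / m * \<bar>s - t\<bar>"
          using P_time_lipschitz[OF m mt[OF s] mt[OF t], of "Y z"] by (simp add: abs_minus_commute)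
      qed (use Pi[OF s \<tau>s] Pi[OF s \<tau>t] in auto)
      finally show "norm (?A s - ?a s) \<le> flowCT TYPE('a) / m * \<bar>s - t\<bar>" by (simp add: prob_space)
    qed
    have "((\<lambda>s. flowCT TYPE('a) / m * \<bar>s - t\<bar>) \<longlongrightarrow> flowCT TYPE('a) / m * \<bar>t - t\<bar>) (at t within {0..t1})"
      by (intro tendsto_intros)
    then show "((\<lambda>s. flowCT TYPE('a) / m * \<bar>s - t\<bar>) \<longlongrightarrow> 0) (at t within {0..t1})" by simp
  qed
  ultimately have "((\<lambda>s. (?A s - ?a s) + ?a s) \<longlongrightarrow> 0 + ?a t) (at t within {0..t1})"
    by (intro tendsto_add)
  then show "(?A \<longlongrightarrow> ?A t) (at t within {0..t1})" by simp
qed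

text \<open>Splits the identity of \<open>weak_limit\<close> into the term with the derivative of
  \<eta> and the term with the drift, the form in which \<open>weak_time_derivative_bound\<close>
  consumes it.\<close>

lemma weak_time_form:
  fixes \<nu> :: "real \<Rightarrow> 'e::euclidean_space measure" and \<omega> :: "'e \<Rightarrow> real" and Y :: "'e \<Rightarrow> 'a"
  assumes Y: "bounded_linear Y" and S: "S \<subseteq> Basis"
    and ellip: "\<And>h. \<sigma> * (\<Sum>e\<in>S. (h \<bullet> Y e)\<^sup>2) = (norm h)\<^sup>2"
    and weak: "\<And>\<phi>. test_fun ({0<..<T} \<times> UNIV) \<phi> \<Longrightarrow> (\<forall>t\<in>{0<..<T}. integrable (\<nu> t) (generator c S \<sigma> \<phi> t)) \<and>
      set_integrable lborel {0<..<T} (\<lambda>t. \<integral>z. generator c S \<sigma> \<phi> t z \<partial>\<nu> t) \<and>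
      (LINT t:{0<..<T}|lborel. (\<integral>z. generator c S \<sigma> \<phi> t z \<partial>\<nu> t)) = 0"
    and \<nu>: "P2_curve T \<nu>"
    and meas: "\<And>t. t \<in> {0<..<T} \<Longrightarrow> (\<lambda>z. Y (c t z)) \<in> borel_measurable borel"
    and growth: "\<And>t z. t \<in> {0<..<T} \<Longrightarrow> norm (c t z) \<le> \<omega> z" "\<And>z. 1 \<le> \<omega> z"
    and \<omega>: "\<And>t. t \<in> {0<..<T} \<Longrightarrow> integrable (\<nu> t) \<omega>" "\<And>t. t \<in> {0<..<T} \<Longrightarrow> (\<integral>z. \<omega> z \<partial>\<nu> t) \<le> W"
    and \<eta>: "smooth_on UNIV \<eta>" and \<alpha>: "0 < \<alpha>" and \<beta>: "\<beta> < T" "\<beta> < \<tau>"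
    and supp: "\<And>t. t \<notin> {\<alpha>..\<beta>} \<Longrightarrow> \<eta> t = 0"
  shows "set_integrable lborel {0<..<T} (\<lambda>t. pd 1 \<eta> t * (\<integral>z. P (\<tau> - t) (Y z) \<partial>\<nu> t)
      + \<eta> t * (\<integral>z. gradP (\<tau> - t) (Y z) \<bullet> Y (c t z) \<partial>\<nu> t))" (is "set_integrable _ _ ?f")
    and "(LINT t:{0<..<T}|lborel. pd 1 \<eta> t * (\<integral>z. P (\<tau> - t) (Y z) \<partial>\<nu> t)
      + \<eta> t * (\<integral>z. gradP (\<tau> - t) (Y z) \<bullet> Y (c t z) \<partial>\<nu> t)) = 0"
proof -
  have pr: "prob_space (\<nu> s)" "sets (\<nu> s) = sets borel" if "s \<in> {0<..<T}" for s
    using \<nu> that by (auto simp: P2_curve_def P2_def)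
  note wl = weak_limit[where c=c, OF Y S ellip \<eta> supp \<beta>(2) \<alpha> \<beta>(1) weak pr(2) meas growth \<omega>]
  have Ym: "Y \<in> borel_measurable borel"
    by (intro borel_measurable_continuous_onI linear_continuous_on Y)
  have eq: "(\<integral>z. generator_lim Y c \<tau> \<eta> t z \<partial>\<nu> t) = ?f t" if t: "t \<in> {0<..<T}" for t
  proof (cases "t \<in> {\<alpha>..\<beta>}")
    case False
    then show ?thesis by (simp add: generator_lim_def supp pd_eta_outside[OF Y S ellip \<eta> supp \<beta>(2)])
  next
    case True
    then have p: "\<tau> - t > 0" using \<beta> by auto
    interpret prob_space "\<nu> t" by (rule pr[OF t])
    note cs = measurable_cong_sets[OF pr(2)[OF t] refl]
    have g: "gradP (\<tau> - t) \<in> borel_measurable borel"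
      by (rule borel_measurable_continuous_onI[OF continuous_on_gradP[OF p]])
    have 1: "integrable (\<nu> t) (\<lambda>z. P (\<tau> - t) (Y z))"
      using measurable_compose[OF Ym borel_measurable_continuous_onI[OF continuous_on_P[OF p]]] P_bound[OF p] cs
      by (intro integrable_const_bound[where B=1]) auto
    obtain Ly where Ly: "\<And>z. norm (Y z) \<le> norm z * Ly" "Ly > 0"
      using bounded_linear.pos_bounded[OF Y] by blast
    let ?C = "flowC1 TYPE('a) / sqrt (\<tau> - t) * Ly"
    have C: "?C \<ge> 0" using flowC1_pos[where 'a='a] p Ly(2) by simp
    have "integrable (\<nu> t) (\<lambda>z. ?C * \<omega> z)" using \<omega>(1)[OF t] by simp
    then have 2: "integrable (\<nu> t) (\<lambda>z. gradP (\<tau> - t) (Y z) \<bullet> Y (c t z))"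
    proof (rule Bochner_Integration.integrable_bound)
      have "(\<lambda>z. gradP (\<tau> - t) (Y z) \<bullet> Y (c t z)) \<in> borel_measurable borel"
        by (rule borel_measurable_inner[OF measurable_compose[OF Ym g] meas[OF t]])
      then show "(\<lambda>z. gradP (\<tau> - t) (Y z) \<bullet> Y (c t z)) \<in> borel_measurable (\<nu> t)" using cs by blast
      show "AE z in \<nu> t. norm (gradP (\<tau> - t) (Y z) \<bullet> Y (c t z)) \<le> norm (?C * \<omega> z)"
      proof (rule AE_I2)
        fix z
        have "norm (gradP (\<tau> - t) (Y z) \<bullet> Y (c t z)) \<le> norm (gradP (\<tau> - t) (Y z)) * norm (Y (c t z))"
          unfolding real_norm_def by (rule Cauchy_Schwarz_ineq2)
        also have "\<dots> \<le> flowC1 TYPE('a) / sqrt (\<tau> - t) * (\<omega> z * Ly)"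
          using norm_gradP[OF p] order_trans[OF Ly(1) mult_right_mono[OF growth(1)[OF t]]] Ly(2)
            flowC1_pos[where 'a='a] p
          by (intro mult_mono) auto
        also have "\<dots> = ?C * \<omega> z" by (simp add: mult_ac)
        also have "\<dots> \<le> norm (?C * \<omega> z)" unfolding real_norm_def by (rule abs_ge_self)
        finally show "norm (gradP (\<tau> - t) (Y z) \<bullet> Y (c t z)) \<le> norm (?C * \<omega> z)" .
      qed
    qed
    show ?thesis unfolding generator_lim_def using 1 2 by simp
  qed
  have eq': "indicator {0<..<T} t *\<^sub>R (\<integral>z. generator_lim Y c \<tau> \<eta> t z \<partial>\<nu> t) = indicator {0<..<T} t *\<^sub>R ?f t" for t
    using eq[of t] by (cases "t \<in> {0<..<T}") auto
  show "set_integrable lborel {0<..<T} ?f"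
    using wl(1) unfolding set_integrable_def eq' .
  show "(LINT t:{0<..<T}|lborel. ?f t) = 0"
    using wl(2) unfolding set_lebesgue_integral_def eq' .
qed

end

section \<open>Bounds on the drift, and both equations as instances of one generator\<close>

lemma inner_Pair_sum:
  "(\<Sum>e\<in>(Basis :: ('a::euclidean_space \<times> 'a) set). ((u, w) \<bullet> e) * F e) =
     (\<Sum>b\<in>Basis. (u \<bullet> b) * F (b, 0)) + (\<Sum>b\<in>Basis. (w \<bullet> b) * F (0, b))"
proof -
  have 1: "(\<Sum>e\<in>(\<lambda>b::'a. (b, 0::'a)) ` Basis. G e) = (\<Sum>b\<in>Basis. G (b, 0))"
    "(\<Sum>e\<in>(\<lambda>b::'a. (0::'a, b)) ` Basis. G e) = (\<Sum>b\<in>Basis. G (0, b))" for G :: "'a \<times> 'a \<Rightarrow> real"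
    by (subst sum.reindex; simp add: inj_on_def)+
  have "(\<lambda>b::'a. (b, 0::'a)) ` Basis \<inter> (\<lambda>b::'a. (0::'a, b)) ` Basis = {}"
    using nonzero_Basis by auto
  then show ?thesis
    unfolding Basis_prod_def by (subst sum.union_disjoint) (simp_all add: 1)
qed

lemma inner_grad_sum: "u \<bullet> (\<Sum>b\<in>Basis. G b *\<^sub>R b) = (\<Sum>b\<in>Basis. (u \<bullet> b) * G b)"
  by (simp add: inner_sum_right mult.commute)

definition conv_drift :: "('a::euclidean_space \<Rightarrow> 'a) \<Rightarrow> 'a measure \<Rightarrow> 'a \<Rightarrow> 'a" where
  "conv_drift DK \<rho> x = (\<integral>y. DK (x - y) \<partial>\<rho>)"

lemma Fdrift_eq: "Fdrift DPhi DK x \<rho> = - DPhi x - conv_drift DK \<rho> x"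
  by (simp add: Fdrift_def conv_drift_def)

lemma conv_drift_bound:
  assumes "prob_space \<rho>" "\<And>x. norm (DK x) \<le> B"
  shows "norm (conv_drift DK \<rho> x) \<le> B"
proof (cases "integrable \<rho> (\<lambda>y. DK (x - y))")
  case True
  interpret prob_space \<rho> by fact
  have "norm (conv_drift DK \<rho> x) \<le> (\<integral>y. norm (DK (x - y)) \<partial>\<rho>)"
    unfolding conv_drift_def by (rule integral_norm_bound)
  also have "\<dots> \<le> (\<integral>y. B \<partial>\<rho>)" using True assms by (intro integral_mono) auto
  finally show ?thesis by (simp add: prob_space)
next
  case False
  then show ?thesis using order_trans[OF norm_ge_zero assms(2)]
    by (simp add: conv_drift_def not_integrable_integral_eq)
qed

lemma conv_drift_measurable:
  fixes DK :: "'a::euclidean_space \<Rightarrow> 'a"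
  assumes \<rho>: "prob_space \<rho>" "sets \<rho> = sets borel" and DK: "DK \<in> borel_measurable borel"
  shows "conv_drift DK \<rho> \<in> borel_measurable borel"
proof -
  interpret prob_space \<rho> by fact
  have eq: "sets (borel \<Otimes>\<^sub>M \<rho>) = sets (borel :: ('a \<times> 'a) measure)"
  proof -
    have "sets ((borel :: 'a measure) \<Otimes>\<^sub>M \<rho>) = sets (borel \<Otimes>\<^sub>M borel)"
      by (rule sets_pair_measure_cong[OF refl \<rho>(2)])
    then show ?thesis by (simp only: borel_prod)
  qed
  have "(\<lambda>z::'a \<times> 'a. fst z - snd z) \<in> borel_measurable borel"
    by (intro borel_measurable_continuous_onI continuous_intros)
  from measurable_compose[OF this DK] have "(\<lambda>z. DK (fst z - snd z)) \<in> borel_measurable (borel \<Otimes>\<^sub>M \<rho>)"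
    using measurable_cong_sets[OF eq refl] by blast
  then have "(\<lambda>x. \<integral>y. DK (fst (x, y) - snd (x, y)) \<partial>\<rho>) \<in> borel_measurable borel"
    by (intro borel_measurable_lebesgue_integral) (simp add: split_beta')
  then show ?thesis by (simp add: conv_drift_def[abs_def])
qed

lemma Fdrift_measurable:
  fixes DK :: "'a::euclidean_space \<Rightarrow> 'a"
  assumes "prob_space \<rho>" "sets \<rho> = sets borel" "DK \<in> borel_measurable borel" "DPhi \<in> borel_measurable borel"
  shows "(\<lambda>x. Fdrift DPhi DK x \<rho>) \<in> borel_measurable borel"
  unfolding Fdrift_eq using conv_drift_measurable[OF assms(1-3)] assms(4) by simp

lemma Fdrift_bound:
  assumes "prob_space \<rho>" "\<And>x. norm (DK x) \<le> BK" "\<And>x. norm (DPhi x) \<le> BP"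
  shows "norm (Fdrift DPhi DK x \<rho>) \<le> BP + BK"
  unfolding Fdrift_eq
  by (rule order_trans[OF norm_triangle_ineq4]) (use conv_drift_bound[where DK=DK and x=x, OF assms(1,2)] assms(3)[of x] in simp)

context heat_flow
begin

text \<open>The degenerate instance: second derivatives act in the velocity directions only. The
  flow depends on z through \<open>Y \<gamma> z\<close>, and applying \<open>Y \<gamma>\<close> to
  the phase-space drift cancels the velocity and leaves the force at x.\<close>

lemma kinetic_time_form:
  fixes \<mu> :: "real \<Rightarrow> ('a \<times> 'a) measure"
  defines "Y \<equiv> \<lambda>\<gamma> z. fst z + (1 / \<gamma>) *\<^sub>R snd z"
  assumes \<gamma>: "\<gamma> > 0" and sol: "kinetic_weak_sol DPhi DK \<gamma> T \<mu>"
    and DK: "DK \<in> borel_measurable borel" "\<And>x. norm (DK x) \<le> BK"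
    and DPhi: "DPhi \<in> borel_measurable borel" "\<And>x. norm (DPhi x) \<le> BP"
    and mom: "\<And>t. t \<in> {0<..<T} \<Longrightarrow> integrable (\<mu> t) (\<lambda>z. norm (snd z)) \<and> (\<integral>z. norm (snd z) \<partial>\<mu> t) \<le> M1"
    and \<eta>: "smooth_on UNIV \<eta>" and \<alpha>: "0 < \<alpha>" and \<beta>: "\<beta> < T" "\<beta> < \<tau>"
    and supp: "\<And>t. t \<notin> {\<alpha>..\<beta>} \<Longrightarrow> \<eta> t = 0"
  shows "set_integrable lborel {0<..<T} (\<lambda>t. pd 1 \<eta> t * (\<integral>z. P (\<tau> - t) (Y \<gamma> z) \<partial>\<mu> t)
      + \<eta> t * (\<integral>z. gradP (\<tau> - t) (Y \<gamma> z) \<bullet> Fdrift DPhi DK (fst z) (xmarg (\<mu> t)) \<partial>\<mu> t))" (is ?t1)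
    and "(LINT t:{0<..<T}|lborel. pd 1 \<eta> t * (\<integral>z. P (\<tau> - t) (Y \<gamma> z) \<partial>\<mu> t)
      + \<eta> t * (\<integral>z. gradP (\<tau> - t) (Y \<gamma> z) \<bullet> Fdrift DPhi DK (fst z) (xmarg (\<mu> t)) \<partial>\<mu> t)) = 0" (is ?t2)
proof -
  define c where "c t z = (\<gamma> *\<^sub>R snd z, \<gamma> *\<^sub>R (Fdrift DPhi DK (fst z) (xmarg (\<mu> t)) - \<gamma> *\<^sub>R snd z))"
    for t and z :: "'a \<times> 'a"
  define S where "S = (\<lambda>b::'a. (0::'a, b)) ` Basis"
  have S: "S \<subseteq> Basis" by (auto simp: S_def Basis_prod_def)
  have sumS: "(\<Sum>e\<in>S. F e) = (\<Sum>b\<in>Basis. F (0, b))" for F :: "'a \<times> 'a \<Rightarrow> real"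
    unfolding S_def by (subst sum.reindex) (auto simp: inj_on_def)
  have bl: "bounded_linear (Y \<gamma>)"
    unfolding Y_def by (intro bounded_linear_intros)
  \<comment> \<open>A velocity basis vector is mapped to itself divided by \<gamma>, and the
    diffusion coefficient compensates exactly.\<close>
  have ell: "\<gamma>\<^sup>2 * (\<Sum>e\<in>S. (h \<bullet> Y \<gamma> e)\<^sup>2) = (norm h)\<^sup>2" for h
    unfolding sumS norm_sq_sum[of h] Y_def using \<gamma> by (simp add: power_divide sum_divide_distrib[symmetric])
  have gen_eq: "generator c S (\<gamma>\<^sup>2) \<phi> t z = dt_kin \<phi> (t, z) + \<gamma> * (snd z \<bullet> gradx_kin \<phi> (t, z))
      + \<gamma> * ((Fdrift DPhi DK (fst z) (xmarg (\<mu> t)) - \<gamma> *\<^sub>R snd z) \<bullet> gradv_kin \<phi> (t, z))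
      + \<gamma>\<^sup>2 * lapv_kin \<phi> (t, z)" for \<phi> t z
    unfolding generator_def c_def inner_Pair_sum sumS dt_kin_def gradx_kin_def gradv_kin_def lapv_kin_def inner_grad_sum
    by (simp add: sum_distrib_left mult.assoc)
  have curve: "P2_curve T \<mu>" using sol by (simp add: kinetic_weak_sol_def)
  have pr: "prob_space (\<mu> s)" "sets (\<mu> s) = sets borel" if "s \<in> {0<..<T}" for s
    using curve that by (auto simp: P2_curve_def P2_def)
  have fm: "fst \<in> measurable (\<mu> s) borel" if "s \<in> {0<..<T}" for s
    using borel_fst measurable_cong_sets[OF pr(2)[OF that] refl] by blast
  have xp: "prob_space (xmarg (\<mu> s))" "sets (xmarg (\<mu> s)) = sets borel" if "s \<in> {0<..<T}" for s
    using prob_space.prob_space_distr[OF pr(1)[OF that] fm[OF that]] by (auto simp: xmarg_def)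
  have weak: "(\<forall>t\<in>{0<..<T}. integrable (\<mu> t) (generator c S (\<gamma>\<^sup>2) \<phi> t)) \<and>
      set_integrable lborel {0<..<T} (\<lambda>t. \<integral>z. generator c S (\<gamma>\<^sup>2) \<phi> t z \<partial>\<mu> t) \<and>
      (LINT t:{0<..<T}|lborel. (\<integral>z. generator c S (\<gamma>\<^sup>2) \<phi> t z \<partial>\<mu> t)) = 0"
    if "test_fun ({0<..<T} \<times> UNIV) \<phi>" for \<phi>
    using sol that unfolding kinetic_weak_sol_def Let_def gen_eq[abs_def] by blast
  have Yc: "Y \<gamma> (c t z) = Fdrift DPhi DK (fst z) (xmarg (\<mu> t))" for t z
    using \<gamma> by (simp add: Y_def c_def)
  have meas: "(\<lambda>z. Y \<gamma> (c t z)) \<in> borel_measurable borel" if "t \<in> {0<..<T}" for t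
    unfolding Yc by (rule measurable_compose[OF borel_fst Fdrift_measurable[OF xp[OF that] DK(1) DPhi(1)]])
  \<comment> \<open>A crude constant such that k (1 + |v|) majorises the phase-space drift and 1. It
    depends on \<gamma>, which is harmless: it justifies passages to the limit and appears in no
    estimate.\<close>
  define k where "k = 1 + \<gamma> + \<gamma>\<^sup>2 + \<gamma> * (BP + BK)"
  have B0: "BP + BK \<ge> 0" using order_trans[OF norm_ge_zero DK(2)] order_trans[OF norm_ge_zero DPhi(2)] by simp
  have k: "k \<ge> 1" "k \<ge> \<gamma> + \<gamma>\<^sup>2" "k \<ge> \<gamma> * (BP + BK)" using \<gamma> B0 by (auto simp: k_def add_nonneg_nonneg)
  have growth: "norm (c t z) \<le> k * (1 + norm (snd z))" if t: "t \<in> {0<..<T}" for t z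
  proof -
    have "norm (c t z) \<le> norm (\<gamma> *\<^sub>R snd z) + norm (\<gamma> *\<^sub>R (Fdrift DPhi DK (fst z) (xmarg (\<mu> t)) - \<gamma> *\<^sub>R snd z))"
      unfolding c_def by (rule norm_Pair_le)
    also have "\<dots> \<le> \<gamma> * norm (snd z) + \<gamma> * ((BP + BK) + \<gamma> * norm (snd z))"
      using \<gamma> norm_triangle_ineq4[of "Fdrift DPhi DK (fst z) (xmarg (\<mu> t))" "\<gamma> *\<^sub>R snd z"]
        Fdrift_bound[where DK=DK and DPhi=DPhi and x="fst z", OF xp(1)[OF t] DK(2) DPhi(2)] by simp
    also have "\<dots> = (\<gamma> + \<gamma>\<^sup>2) * norm (snd z) + \<gamma> * (BP + BK)" by (simp add: algebra_simps power2_eq_square)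
    also have "\<dots> \<le> k * norm (snd z) + k" using k by (intro add_mono mult_right_mono) auto
    finally show ?thesis by (simp add: algebra_simps)
  qed
  have one: "1 \<le> k * (1 + norm (snd z))" for z :: "'a \<times> 'a"
    using mult_mono[of 1 k 1 "1 + norm (snd z)"] k by simp
  have \<omega>i: "integrable (\<mu> t) (\<lambda>z. k * (1 + norm (snd z)))" if "t \<in> {0<..<T}" for t
  proof -
    interpret prob_space "\<mu> t" by (rule pr[OF that])
    show ?thesis using mom[OF that] by simp
  qed
  have \<omega>b: "(\<integral>z. k * (1 + norm (snd z)) \<partial>\<mu> t) \<le> k * (1 + M1)" if "t \<in> {0<..<T}" for t
  proof -
    interpret prob_space "\<mu> t" by (rule pr[OF that])
    show ?thesis using mom[OF that] k by (simp add: prob_space)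
  qed
  note form = weak_time_form[OF bl S ell weak curve meas growth one \<omega>i \<omega>b \<eta> \<alpha> \<beta> supp, unfolded Yc]
  show ?t1 ?t2 by (rule form; assumption)+
qed

text \<open>The nondegenerate instance, with the identity in place of \<open>Y\<close>, all basis
  directions and diffusion coefficient 1.\<close>

lemma aggregation_diffusion_time_form:
  fixes \<rho> :: "real \<Rightarrow> 'a measure"
  assumes sol: "\<And>\<psi>. test_fun ({0<..<T} \<times> UNIV) \<psi> \<Longrightarrow>
        (let G = (\<lambda>t x. dt_ad \<psi> (t, x) + Fdrift DPhi DK x (\<rho> t) \<bullet> grad_ad \<psi> (t, x)
                        + lap_ad \<psi> (t, x))
         in (\<forall>t\<in>{0<..<T}. integrable (\<rho> t) (G t)) \<and>
            set_integrable lborel {0<..<T} (\<lambda>t. \<integral>x. G t x \<partial>\<rho> t) \<and>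
            (\<integral>t\<in>{0<..<T}. (\<integral>x. G t x \<partial>\<rho> t) \<partial>lborel) = 0)"
    and curve: "P2_curve T \<rho>"
    and DK: "DK \<in> borel_measurable borel" "\<And>x. norm (DK x) \<le> BK"
    and DPhi: "DPhi \<in> borel_measurable borel" "\<And>x. norm (DPhi x) \<le> BP"
    and \<eta>: "smooth_on UNIV \<eta>" and \<alpha>: "0 < \<alpha>" and \<beta>: "\<beta> < T" "\<beta> < \<tau>"
    and supp: "\<And>t. t \<notin> {\<alpha>..\<beta>} \<Longrightarrow> \<eta> t = 0"
  shows "set_integrable lborel {0<..<T} (\<lambda>t. pd 1 \<eta> t * (\<integral>z. P (\<tau> - t) z \<partial>\<rho> t)
      + \<eta> t * (\<integral>z. gradP (\<tau> - t) z \<bullet> Fdrift DPhi DK z (\<rho> t) \<partial>\<rho> t))" (is ?t1)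
    and "(LINT t:{0<..<T}|lborel. pd 1 \<eta> t * (\<integral>z. P (\<tau> - t) z \<partial>\<rho> t)
      + \<eta> t * (\<integral>z. gradP (\<tau> - t) z \<bullet> Fdrift DPhi DK z (\<rho> t) \<partial>\<rho> t)) = 0" (is ?t2)
proof -
  define c where "c t z = Fdrift DPhi DK z (\<rho> t)" for t z
  have ell: "1 * (\<Sum>e\<in>Basis. (h \<bullet> e)\<^sup>2) = (norm h)\<^sup>2" for h :: 'a
    by (simp add: norm_sq_sum[of h])
  have gen_eq: "generator c Basis 1 \<psi> t z = dt_ad \<psi> (t, z) + Fdrift DPhi DK z (\<rho> t) \<bullet> grad_ad \<psi> (t, z)
      + lap_ad \<psi> (t, z)" for \<psi> t z
    unfolding generator_def c_def dt_ad_def grad_ad_def lap_ad_def inner_grad_sum by simp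
  have pr: "prob_space (\<rho> s)" "sets (\<rho> s) = sets borel" if "s \<in> {0<..<T}" for s
    using curve that by (auto simp: P2_curve_def P2_def)
  have weak: "(\<forall>t\<in>{0<..<T}. integrable (\<rho> t) (generator c Basis 1 \<phi> t)) \<and>
      set_integrable lborel {0<..<T} (\<lambda>t. \<integral>z. generator c Basis 1 \<phi> t z \<partial>\<rho> t) \<and>
      (LINT t:{0<..<T}|lborel. (\<integral>z. generator c Basis 1 \<phi> t z \<partial>\<rho> t)) = 0"
    if "test_fun ({0<..<T} \<times> UNIV) \<phi>" for \<phi>
    using sol[OF that] unfolding Let_def gen_eq[abs_def] .
  have meas: "c t \<in> borel_measurable borel" if "t \<in> {0<..<T}" for t
    unfolding c_def[abs_def] by (rule Fdrift_measurable[OF pr[OF that] DK(1) DPhi(1)])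
  have B0: "BP + BK \<ge> 0" using order_trans[OF norm_ge_zero DK(2)] order_trans[OF norm_ge_zero DPhi(2)] by simp
  have growth: "norm (c t z) \<le> 1 + (BP + BK)" if t: "t \<in> {0<..<T}" for t z
    unfolding c_def using Fdrift_bound[where DK=DK and DPhi=DPhi and x=z, OF pr(1)[OF t] DK(2) DPhi(2)] by linarith
  have one: "1 \<le> 1 + (BP + BK)" using B0 by simp
  have \<omega>i: "integrable (\<rho> t) (\<lambda>_. 1 + (BP + BK))" "(\<integral>z. 1 + (BP + BK) \<partial>\<rho> t) \<le> 1 + (BP + BK)"
    if "t \<in> {0<..<T}" for t
  proof -
    interpret prob_space "\<rho> t" by (rule pr[OF that])
    show "integrable (\<rho> t) (\<lambda>_. 1 + (BP + BK))" "(\<integral>z. 1 + (BP + BK) \<partial>\<rho> t) \<le> 1 + (BP + BK)"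
      by (simp_all add: prob_space)
  qed
  note form = weak_time_form[OF bounded_linear_ident order_refl ell weak curve meas growth one \<omega>i \<eta> \<alpha> \<beta> supp,
      unfolded c_def]
  show ?t1 ?t2 by (rule form; assumption)+
qed

end

section \<open>Coarse-graining and the Volterra inequality\<close>

text \<open>Everything is stated for one \<gamma>, while \<open>L\<close>, \<open>BP\<close>,
  \<open>BK\<close>, \<open>CG\<close> and \<open>M1\<close> are parameters. Bounds expressed
  through these constants are uniform in \<gamma> as soon as the locale is interpreted with
  constants that do not depend on it.\<close>

locale coarse_grained =
  fixes DPhi DK :: "'a::euclidean_space \<Rightarrow> 'a" and L BP BK CG M1 T \<gamma> :: real
    and \<mu> :: "real \<Rightarrow> ('a \<times> 'a) measure" and \<rho> :: "real \<Rightarrow> 'a measure"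
  assumes \<gamma>: "1 \<le> \<gamma>" and T: "0 < T"
    and nonneg: "0 \<le> L" "0 \<le> BP" "0 \<le> BK" "0 \<le> CG" "0 \<le> M1"
    and DPhi_lip: "\<And>x y. norm (DPhi x - DPhi y) \<le> L * norm (x - y)"
    and DPhi_bound: "\<And>x. norm (DPhi x) \<le> BP"
    and DK_meas: "DK \<in> borel_measurable borel" and DK_bound: "\<And>x. norm (DK x) \<le> BK"
    and kin: "kinetic_weak_sol DPhi DK \<gamma> T \<mu>"
    and dens: "\<And>t. t \<in> {0..T} \<Longrightarrow> \<exists>m g. (\<forall>z. 0 \<le> m z) \<and> \<mu> t = density lborel (\<lambda>z. ennreal (m z)) \<and>
      weak_x_grad m g \<and> integrable lborel (\<lambda>z. (1 + norm (snd z)) * norm (g z)) \<and>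
      (\<integral>z. (1 + norm (snd z)) * norm (g z) \<partial>lborel) \<le> CG"
    and mom: "\<And>t. t \<in> {0..T} \<Longrightarrow> integrable (\<mu> t) (\<lambda>z. norm (snd z)) \<and> (\<integral>z. norm (snd z) \<partial>\<mu> t) \<le> M1"
    and curve: "P2_curve T \<rho>"
    and ad: "\<And>\<psi>. test_fun ({0<..<T} \<times> UNIV) \<psi> \<Longrightarrow>
        (let G = (\<lambda>t x. dt_ad \<psi> (t, x) + Fdrift DPhi DK x (\<rho> t) \<bullet> grad_ad \<psi> (t, x)
                        + lap_ad \<psi> (t, x))
         in (\<forall>t\<in>{0<..<T}. integrable (\<rho> t) (G t)) \<and>
            set_integrable lborel {0<..<T} (\<lambda>t. \<integral>x. G t x \<partial>\<rho> t) \<and>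
            (\<integral>t\<in>{0<..<T}. (\<integral>x. G t x \<partial>\<rho> t) \<partial>lborel) = 0)"
    and ac: "\<And>t. t \<in> {0..T} \<Longrightarrow> absolutely_continuous lborel (\<rho> t)"
begin

definition Y :: "'a \<times> 'a \<Rightarrow> 'a" where
  "Y z = fst z + (1 / \<gamma>) *\<^sub>R snd z"

definition coarse :: "real \<Rightarrow> 'a measure" where
  "coarse t = distr (\<mu> t) borel Y"

definition gap :: "real \<Rightarrow> real" where
  "gap t = tv (coarse t) (\<rho> t)"

text \<open>A common constant for the error sources in \<open>drift_work_diff\<close>: the shift of
  the argument by v / \<gamma>, the replacement of the x-marginal by the coarse-grained law and then
  by \<open>\<rho> t\<close> inside the convolution, and the change of the outer measure, which
  costs the full drift bound \<open>BP + BK\<close>.\<close>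

definition \<kappa> :: real where
  "\<kappa> = (L + BK * CG) * (1 + M1) + BK + (BP + BK)"

lemma \<kappa>_nonneg: "\<kappa> \<ge> 0"
  unfolding \<kappa>_def using nonneg by simp

lemma prob_mu: "t \<in> {0..T} \<Longrightarrow> prob_space (\<mu> t)" and sets_mu: "t \<in> {0..T} \<Longrightarrow> sets (\<mu> t) = sets borel"
  using kin by (auto simp: kinetic_weak_sol_def P2_curve_def P2_def)

lemma prob_rho: "t \<in> {0..T} \<Longrightarrow> prob_space (\<rho> t)" and sets_rho: "t \<in> {0..T} \<Longrightarrow> sets (\<rho> t) = sets borel"
  using curve by (auto simp: P2_curve_def P2_def)

lemma Y_measurable: "Y \<in> borel_measurable borel"
  unfolding Y_def[abs_def] by (intro borel_measurable_continuous_onI continuous_intros)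

lemma measurable_mu:
  "t \<in> {0..T} \<Longrightarrow> f \<in> borel_measurable borel \<Longrightarrow> f \<in> borel_measurable (\<mu> t)"
  using measurable_cong_sets[OF sets_mu refl] by blast

lemma prob_coarse: "t \<in> {0..T} \<Longrightarrow> prob_space (coarse t)"
  unfolding coarse_def by (intro prob_space.prob_space_distr prob_mu measurable_mu Y_measurable)

lemma prob_xmarg: "t \<in> {0..T} \<Longrightarrow> prob_space (xmarg (\<mu> t))"
  unfolding xmarg_def by (intro prob_space.prob_space_distr prob_mu measurable_mu borel_fst)

lemma integral_coarse:
  "t \<in> {0..T} \<Longrightarrow> f \<in> borel_measurable borel \<Longrightarrow> (\<integral>y. f y \<partial>coarse t) = (\<integral>z. f (Y z) \<partial>\<mu> t)"
  for f :: "'a \<Rightarrow> 'b::{banach, second_countable_topology}"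
  unfolding coarse_def by (intro integral_distr measurable_mu Y_measurable)

lemma integral_xmarg:
  "t \<in> {0..T} \<Longrightarrow> f \<in> borel_measurable borel \<Longrightarrow> (\<integral>y. f y \<partial>xmarg (\<mu> t)) = (\<integral>z. f (fst z) \<partial>\<mu> t)"
  for f :: "'a \<Rightarrow> 'b::{banach, second_countable_topology}"
  unfolding xmarg_def by (intro integral_distr measurable_mu borel_fst)

lemma DPhi_measurable: "DPhi \<in> borel_measurable borel"
proof (rule borel_measurable_continuous_onI)
  have "L-lipschitz_on UNIV DPhi"
    by (rule lipschitz_onI) (use DPhi_lip nonneg in \<open>auto simp: dist_norm\<close>)
  then show "continuous_on UNIV DPhi" by (rule lipschitz_on_continuous_on)
qed

text \<open>The weight 1 + |v| in the gradient bound is there to absorb shifts that are affine in v,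
  since |\<alpha> v + h0| <= (|\<alpha>| + |h0|) (1 + |v|).\<close>

lemma shear_bound:
  assumes t: "t \<in> {0..T}" and h: "h \<in> borel_measurable borel" "\<And>x. \<bar>h x\<bar> \<le> (1::real)"
  shows "\<bar>(\<integral>z. h (fst z + (\<alpha> *\<^sub>R snd z + h0)) \<partial>\<mu> t) - (\<integral>z. h (fst z) \<partial>\<mu> t)\<bar> \<le> (\<bar>\<alpha>\<bar> + norm h0) * CG"
proof -
  obtain m g where m: "\<And>z. 0 \<le> m z" and \<mu>: "\<mu> t = density lborel (\<lambda>z. ennreal (m z))"
    and wg: "weak_x_grad m g" and gi: "integrable lborel (\<lambda>z. (1 + norm (snd z)) * norm (g z))"
    and gb: "(\<integral>z. (1 + norm (snd z)) * norm (g z) \<partial>lborel) \<le> CG"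
    using dens[OF t] by blast
  have gm: "g \<in> borel_measurable borel" using wg by (simp add: weak_x_grad_def)
  have le: "norm (\<alpha> *\<^sub>R snd z + h0) * norm (g z) \<le> (\<bar>\<alpha>\<bar> + norm h0) * ((1 + norm (snd z)) * norm (g z))" for z
  proof -
    have "norm (\<alpha> *\<^sub>R snd z + h0) \<le> \<bar>\<alpha>\<bar> * norm (snd z) + norm h0"
      using norm_triangle_ineq[of "\<alpha> *\<^sub>R snd z" h0] by simp
    also have "\<dots> \<le> (\<bar>\<alpha>\<bar> + norm h0) * (1 + norm (snd z))"
      by (simp add: algebra_simps)
    finally show ?thesis by (simp add: mult.assoc[symmetric] mult_right_mono)
  qed
  have bi: "integrable lborel (\<lambda>z. (\<bar>\<alpha>\<bar> + norm h0) * ((1 + norm (snd z)) * norm (g z)))" using gi by simp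
  have i: "integrable lborel (\<lambda>z. norm (\<alpha> *\<^sub>R snd z + h0) * norm (g z))"
  proof (rule Bochner_Integration.integrable_bound[OF bi])
    have "(\<lambda>z::'a \<times> 'a. norm (\<alpha> *\<^sub>R snd z + h0)) \<in> borel_measurable borel"
      by (intro borel_measurable_continuous_onI continuous_intros)
    then show "(\<lambda>z. norm (\<alpha> *\<^sub>R snd z + h0) * norm (g z)) \<in> borel_measurable lborel"
      using gm by (simp add: borel_measurable_times)
    show "AE z in lborel. norm (norm (\<alpha> *\<^sub>R snd z + h0) * norm (g z))
        \<le> norm ((\<bar>\<alpha>\<bar> + norm h0) * ((1 + norm (snd z)) * norm (g z)))"
      using le by (intro AE_I2) (auto intro: order_trans[OF _ abs_ge_self])
  qed
  have "\<bar>(\<integral>z. h (fst z + (\<alpha> *\<^sub>R snd z + h0)) \<partial>\<mu> t) - (\<integral>z. h (fst z) \<partial>\<mu> t)\<bar>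
      \<le> (\<integral>z. norm (\<alpha> *\<^sub>R snd z + h0) * norm (g z) \<partial>lborel)"
    unfolding \<mu> by (rule shear_tv_bound[OF m _ wg i h]) (use prob_mu[OF t] \<mu> in simp)
  also have "\<dots> \<le> (\<integral>z. (\<bar>\<alpha>\<bar> + norm h0) * ((1 + norm (snd z)) * norm (g z)) \<partial>lborel)"
    by (rule integral_mono[OF i bi le])
  also have "\<dots> \<le> (\<bar>\<alpha>\<bar> + norm h0) * CG" using gb by (simp add: mult_left_mono)
  finally show ?thesis .
qed

lemma ac_coarse: "t \<in> {0..T} \<Longrightarrow> absolutely_continuous lborel (coarse t)"
proof -
  assume t: "t \<in> {0..T}"
  obtain m g where \<mu>: "\<mu> t = density lborel (\<lambda>z. ennreal (m z))" and wg: "weak_x_grad m g"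
    using dens[OF t] by blast
  have "(\<lambda>v::'a. (1 / \<gamma>) *\<^sub>R v) \<in> borel_measurable borel" by simp
  from absolutely_continuous_shear[OF this, of m] wg show ?thesis
    unfolding coarse_def \<mu> Y_def[abs_def] by (simp add: weak_x_grad_def)
qed

lemma coarse_xmarg_bound:
  assumes t: "t \<in> {0..T}" and h: "h \<in> borel_measurable borel" "\<And>x. \<bar>h x\<bar> \<le> (1::real)"
  shows "\<bar>(\<integral>z. h (Y z) \<partial>\<mu> t) - (\<integral>z. h (fst z) \<partial>\<mu> t)\<bar> \<le> CG / \<gamma>"
  using shear_bound[OF t h, of "1 / \<gamma>" 0] \<gamma> by (simp add: Y_def)

lemma DK_shift_measurable: "(\<lambda>y. DK (x - y)) \<in> borel_measurable borel"
  by (rule measurable_compose[OF _ DK_meas]) (intro borel_measurable_continuous_onI continuous_intros)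

text \<open>As \<open>DK\<close> has no modulus of continuity, the shift d = v / \<gamma> is
  transferred to the measure: DK (x - w) = DK (Y z - (w + d)), and translating the x-marginal by d
  costs |d| \<open>CG\<close> by \<open>shear_bound\<close> with \<alpha> = 0. The other two
  comparisons lead from the marginal to the coarse-grained law and from there to
  \<open>\<rho> t\<close>.\<close>

lemma drift_diff:
  assumes t: "t \<in> {0..T}"
  shows "norm (Fdrift DPhi DK (fst z) (xmarg (\<mu> t)) - Fdrift DPhi DK (Y z) (\<rho> t))
    \<le> (L + BK * CG) / \<gamma> * norm (snd z) + (BK * CG / \<gamma> + BK * gap t)"
proof -
  let ?x = "fst z" and ?d = "(1 / \<gamma>) *\<^sub>R snd z"
  have nd: "norm ?d = norm (snd z) / \<gamma>" using \<gamma> by simp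
  note pm = prob_mu[OF t] and Hm = DK_shift_measurable
  have Ym: "Y \<in> measurable (\<mu> t) borel" and Fm: "fst \<in> measurable (\<mu> t) borel"
    by (intro measurable_mu t Y_measurable borel_fst)+
  have Sm: "(\<lambda>w. fst w + ?d) \<in> measurable (\<mu> t) borel"
    by (intro measurable_mu t borel_measurable_continuous_onI continuous_intros)
  have 1: "norm ((\<integral>w. DK (Y z - (fst w + ?d)) \<partial>\<mu> t) - (\<integral>w. DK (Y z - fst w) \<partial>\<mu> t)) \<le> BK * (norm ?d * CG)"
    by (rule tv_bounded_vector[OF pm pm Sm Fm Hm DK_bound])
       (use shear_bound[OF t, of _ 0 ?d] in simp)
  have 2: "norm ((\<integral>w. DK (Y z - Y w) \<partial>\<mu> t) - (\<integral>w. DK (Y z - fst w) \<partial>\<mu> t)) \<le> BK * (CG / \<gamma>)"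
    by (rule tv_bounded_vector[OF pm pm Ym Fm Hm DK_bound coarse_xmarg_bound[OF t]])
  have 3: "norm ((\<integral>w. DK (Y z - w) \<partial>coarse t) - (\<integral>w. DK (Y z - w) \<partial>\<rho> t)) \<le> BK * gap t"
  proof (rule tv_bounded_vector[OF prob_coarse[OF t] prob_rho[OF t] _ _ Hm DK_bound, where F="\<lambda>w. w" and G="\<lambda>w. w"])
    show "(\<lambda>w. w) \<in> measurable (coarse t) borel" by (simp add: coarse_def)
    show "(\<lambda>w. w) \<in> measurable (\<rho> t) borel" by (rule measurable_ident_sets[OF sets_rho[OF t]])
  qed (unfold gap_def, rule tv_upper[OF prob_coarse[OF t] prob_rho[OF t]])
  have eq: "conv_drift DK (xmarg (\<mu> t)) ?x = (\<integral>w. DK (Y z - (fst w + ?d)) \<partial>\<mu> t)"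
    unfolding conv_drift_def integral_xmarg[OF t Hm] by (simp add: Y_def)
  have "conv_drift DK (\<rho> t) (Y z) - conv_drift DK (xmarg (\<mu> t)) ?x =
     ((\<integral>w. DK (Y z - Y w) \<partial>\<mu> t) - (\<integral>w. DK (Y z - fst w) \<partial>\<mu> t))
     - ((\<integral>w. DK (Y z - (fst w + ?d)) \<partial>\<mu> t) - (\<integral>w. DK (Y z - fst w) \<partial>\<mu> t))
     - ((\<integral>w. DK (Y z - w) \<partial>coarse t) - (\<integral>w. DK (Y z - w) \<partial>\<rho> t))"
    unfolding eq integral_coarse[OF t Hm] by (simp add: conv_drift_def)
  also have "norm \<dots> \<le> BK * (CG / \<gamma>) + BK * (norm ?d * CG) + BK * gap t"
    by (intro order_trans[OF norm_triangle_ineq4] add_mono 1 2 3)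
  finally have K: "norm (conv_drift DK (\<rho> t) (Y z) - conv_drift DK (xmarg (\<mu> t)) ?x)
      \<le> BK * (CG / \<gamma>) + BK * (norm ?d * CG) + BK * gap t" .
  have P: "norm (DPhi (Y z) - DPhi ?x) \<le> L * norm ?d"
    using DPhi_lip[of "Y z" ?x] by (simp add: Y_def)
  have "Fdrift DPhi DK ?x (xmarg (\<mu> t)) - Fdrift DPhi DK (Y z) (\<rho> t) =
     (DPhi (Y z) - DPhi ?x) + (conv_drift DK (\<rho> t) (Y z) - conv_drift DK (xmarg (\<mu> t)) ?x)"
    by (simp add: Fdrift_eq)
  also have "norm \<dots> \<le> L * norm ?d + (BK * (CG / \<gamma>) + BK * (norm ?d * CG) + BK * gap t)"
    by (intro order_trans[OF norm_triangle_ineq] add_mono P K)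
  also have "\<dots> = (L + BK * CG) / \<gamma> * norm (snd z) + (BK * CG / \<gamma> + BK * gap t)"
    unfolding nd by (simp add: field_simps add_divide_distrib)
  finally show ?thesis .
qed

text \<open>The intermediate term is the work of the drift of \<rho> under the coarse-grained law.
  Part \<open>A\<close> compares two drifts under one measure, using the first velocity moment; part
  \<open>B\<close> compares one bounded integrand under two measures.\<close>

lemma drift_work_diff:
  assumes hf: "heat_flow f a b" and t: "t \<in> {0..T}" and s: "s > 0"
  shows "\<bar>(\<integral>z. heat_flow.gradP f a b s (Y z) \<bullet> Fdrift DPhi DK (fst z) (xmarg (\<mu> t)) \<partial>\<mu> t)
      - (\<integral>y. heat_flow.gradP f a b s y \<bullet> Fdrift DPhi DK y (\<rho> t) \<partial>\<rho> t)\<bar>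
    \<le> flowC1 TYPE('a) / sqrt s * (\<kappa> * (1 / \<gamma> + gap t))"
proof -
  interpret heat_flow f a b by fact
  interpret mu: prob_space "\<mu> t" by (rule prob_mu[OF t])
  let ?g = "flowC1 TYPE('a) / sqrt s"
  have g0: "?g \<ge> 0" using flowC1_pos[where 'a='a] s by simp
  have gap0: "gap t \<ge> 0" unfolding gap_def by (rule tv_nonneg[OF prob_coarse[OF t] prob_rho[OF t]])
  have gm: "gradP s \<in> borel_measurable borel"
    by (rule borel_measurable_continuous_onI[OF continuous_on_gradP[OF s]])
  have sx: "sets (xmarg (\<mu> t)) = sets borel" by (simp add: xmarg_def)
  have F1m: "(\<lambda>z::'a \<times> 'a. Fdrift DPhi DK (fst z) (xmarg (\<mu> t))) \<in> borel_measurable borel"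
    using measurable_compose[OF borel_fst Fdrift_measurable[where DK=DK and DPhi=DPhi,
          OF prob_xmarg[OF t] sx DK_meas DPhi_measurable]] .
  have F2m: "(\<lambda>y. Fdrift DPhi DK y (\<rho> t)) \<in> borel_measurable borel"
    by (rule Fdrift_measurable[OF prob_rho[OF t] sets_rho[OF t] DK_meas DPhi_measurable])
  let ?k = "\<lambda>y. gradP s y \<bullet> Fdrift DPhi DK y (\<rho> t)"
  have km: "?k \<in> borel_measurable borel" by (rule borel_measurable_inner[OF gm F2m])
  have kb: "\<bar>?k y\<bar> \<le> ?g * (BP + BK)" for y
    by (rule order_trans[OF Cauchy_Schwarz_ineq2])
       (intro mult_mono norm_gradP[OF s] Fdrift_bound[where DK=DK and DPhi=DPhi, OF prob_rho[OF t] DK_bound DPhi_bound] g0 norm_ge_zero)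
  have gYm: "(\<lambda>z. gradP s (Y z)) \<in> borel_measurable borel"
    by (rule measurable_compose[OF Y_measurable gm])
  have i1: "integrable (\<mu> t) (\<lambda>z. gradP s (Y z) \<bullet> Fdrift DPhi DK (fst z) (xmarg (\<mu> t)))"
  proof (rule mu.integrable_const_bound[where B="?g * (BP + BK)"])
    show "AE z in \<mu> t. norm (gradP s (Y z) \<bullet> Fdrift DPhi DK (fst z) (xmarg (\<mu> t))) \<le> ?g * (BP + BK)"
      unfolding real_norm_def
      by (intro AE_I2 order_trans[OF Cauchy_Schwarz_ineq2] mult_mono norm_gradP[OF s]
          Fdrift_bound[where DK=DK and DPhi=DPhi, OF prob_xmarg[OF t] DK_bound DPhi_bound] g0 norm_ge_zero)
  qed (rule measurable_mu[OF t borel_measurable_inner[OF gYm F1m]])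
  have i2: "integrable (\<mu> t) (\<lambda>z. ?k (Y z))"
    by (rule mu.integrable_const_bound[where B="?g * (BP + BK)"])
       (use kb measurable_mu[OF t measurable_compose[OF Y_measurable km]] in auto)
  let ?b = "\<lambda>z. ?g * ((L + BK * CG) / \<gamma> * norm (snd z) + (BK * CG / \<gamma> + BK * gap t))"
  have bi: "integrable (\<mu> t) ?b" using mom[OF t] by simp
  have A: "\<bar>(\<integral>z. gradP s (Y z) \<bullet> Fdrift DPhi DK (fst z) (xmarg (\<mu> t)) \<partial>\<mu> t) - (\<integral>z. ?k (Y z) \<partial>\<mu> t)\<bar>
      \<le> ?g * ((L + BK * CG) / \<gamma> * M1 + (BK * CG / \<gamma> + BK * gap t))"
  proof -
    have e1: "(\<integral>z. gradP s (Y z) \<bullet> Fdrift DPhi DK (fst z) (xmarg (\<mu> t)) \<partial>\<mu> t) - (\<integral>z. ?k (Y z) \<partial>\<mu> t)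
      = (\<integral>z. gradP s (Y z) \<bullet> (Fdrift DPhi DK (fst z) (xmarg (\<mu> t)) - Fdrift DPhi DK (Y z) (\<rho> t)) \<partial>\<mu> t)"
      using i1 i2 by (simp add: inner_diff_right)
    have e2: "\<bar>\<integral>z. gradP s (Y z) \<bullet> (Fdrift DPhi DK (fst z) (xmarg (\<mu> t)) - Fdrift DPhi DK (Y z) (\<rho> t)) \<partial>\<mu> t\<bar>
        \<le> (\<integral>z. ?b z \<partial>\<mu> t)"
    proof (rule order_trans[OF integral_abs_bound integral_mono[OF _ bi]])
      show "integrable (\<mu> t) (\<lambda>z. \<bar>gradP s (Y z) \<bullet> (Fdrift DPhi DK (fst z) (xmarg (\<mu> t)) - Fdrift DPhi DK (Y z) (\<rho> t))\<bar>)"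
        unfolding inner_diff_right using i1 i2 by simp
      show "\<bar>gradP s (Y z) \<bullet> (Fdrift DPhi DK (fst z) (xmarg (\<mu> t)) - Fdrift DPhi DK (Y z) (\<rho> t))\<bar> \<le> ?b z" for z
        by (rule order_trans[OF Cauchy_Schwarz_ineq2])
           (intro mult_mono norm_gradP[OF s] drift_diff[OF t] g0 norm_ge_zero)
    qed
    have e3: "(\<integral>z. ?b z \<partial>\<mu> t) = ?g * ((L + BK * CG) / \<gamma> * (\<integral>z. norm (snd z) \<partial>\<mu> t) + (BK * CG / \<gamma> + BK * gap t))"
      using mom[OF t] by (simp add: mu.prob_space)
    have e4: "?g * ((L + BK * CG) / \<gamma> * (\<integral>z. norm (snd z) \<partial>\<mu> t) + (BK * CG / \<gamma> + BK * gap t))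
        \<le> ?g * ((L + BK * CG) / \<gamma> * M1 + (BK * CG / \<gamma> + BK * gap t))"
      using mom[OF t] g0 \<gamma> nonneg by (intro mult_left_mono add_right_mono) auto
    show ?thesis unfolding e1 by (rule order_trans[OF e2 ord_eq_le_trans[OF e3 e4]])
  qed
  have B: "\<bar>(\<integral>z. ?k (Y z) \<partial>\<mu> t) - (\<integral>y. ?k y \<partial>\<rho> t)\<bar> \<le> ?g * (BP + BK) * gap t"
    unfolding integral_coarse[OF t km, symmetric] gap_def
    by (rule tv_bounded_function[OF prob_coarse[OF t] prob_rho[OF t] km kb])
       (intro mult_nonneg_nonneg add_nonneg_nonneg g0 nonneg tv_upper[OF prob_coarse[OF t] prob_rho[OF t]])+
  have "(L + BK * CG) / \<gamma> * M1 + (BK * CG / \<gamma> + BK * gap t) + (BP + BK) * gap t \<le> \<kappa> * (1 / \<gamma> + gap t)"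
  proof -
    have "\<kappa> * (1 / \<gamma> + gap t) - ((L + BK * CG) / \<gamma> * M1 + (BK * CG / \<gamma> + BK * gap t) + (BP + BK) * gap t)
      = (L + BK + (BP + BK)) * (1 / \<gamma>) + (L + BK * CG) * (1 + M1) * gap t"
      by (simp add: \<kappa>_def algebra_simps add_divide_distrib)
    moreover have "(L + BK + (BP + BK)) * (1 / \<gamma>) + (L + BK * CG) * (1 + M1) * gap t \<ge> 0"
      using nonneg \<gamma> gap0 by simp
    ultimately show ?thesis by linarith
  qed
  note le = mult_left_mono[OF this g0]
  have "?g * ((L + BK * CG) / \<gamma> * M1 + (BK * CG / \<gamma> + BK * gap t) + (BP + BK) * gap t)
      = ?g * ((L + BK * CG) / \<gamma> * M1 + (BK * CG / \<gamma> + BK * gap t)) + ?g * (BP + BK) * gap t"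
    by (simp only: distrib_left[of ?g _ "(BP + BK) * gap t"] mult.assoc)
  with le A B show ?thesis by linarith
qed

text \<open>The flow time t1 + \<epsilon> - t is \<epsilon> at the end, so the flow stays regular up
  to \<open>t1\<close>; at time 0 the difference is at most \<open>gap 0\<close>. The assumed bound
  on \<open>gap\<close> supplies a continuous majorant, which makes the Volterra integral
  explicit.\<close>

lemma duhamel:
  assumes hf: "heat_flow f a b" and t1: "0 < t1" "t1 \<le> T" and \<epsilon>: "\<epsilon> > 0" and l: "l > 0" and W: "W \<ge> 0"
    and gap: "\<And>t. t \<in> {0..T} \<Longrightarrow> gap t \<le> exp (l * t) * W"
  shows "\<bar>(\<integral>z. heat_flow.P f a b \<epsilon> (Y z) \<partial>\<mu> t1) - (\<integral>y. heat_flow.P f a b \<epsilon> y \<partial>\<rho> t1)\<bar>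
    \<le> gap 0 + flowC1 TYPE('a) * \<kappa> * (2 * sqrt (t1 + \<epsilon>) / \<gamma> + W * (exp (l * (t1 + \<epsilon>)) * (pi / sqrt l)))"
proof -
  interpret heat_flow f a b by fact
  define \<tau> where "\<tau> = t1 + \<epsilon>"
  have \<tau>: "t1 < \<tau>" "0 < \<tau>" using \<epsilon> t1 by (auto simp: \<tau>_def)
  have \<gamma>0: "\<gamma> > 0" using \<gamma> by simp
  let ?A1 = "\<lambda>t. \<integral>z. P (\<tau> - t) (Y z) \<partial>\<mu> t" and ?A2 = "\<lambda>t. \<integral>y. P (\<tau> - t) y \<partial>\<rho> t"
  let ?B1 = "\<lambda>t. \<integral>z. gradP (\<tau> - t) (Y z) \<bullet> Fdrift DPhi DK (fst z) (xmarg (\<mu> t)) \<partial>\<mu> t"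
  let ?B2 = "\<lambda>t. \<integral>y. gradP (\<tau> - t) y \<bullet> Fdrift DPhi DK y (\<rho> t) \<partial>\<rho> t"
  let ?c = "flowC1 TYPE('a) * \<kappa>"
  let ?q = "\<lambda>t. ?c / \<gamma> * (1 / sqrt (\<tau> - t)) + ?c * W * (exp (l * t) / sqrt (\<tau> - t))"
  have c0: "?c \<ge> 0" using \<kappa>_nonneg flowC1_pos[where 'a='a] by simp
  have blY: "bounded_linear Y" unfolding Y_def[abs_def] by (intro bounded_linear_intros)
  have curve\<mu>: "P2_curve T \<mu>" using kin by (simp add: kinetic_weak_sol_def)
  have "\<bar>(?A1 t1 - ?A2 t1) - (?A1 0 - ?A2 0)\<bar> \<le> integral {0..t1} ?q"
  proof (rule weak_time_derivative_bound[OF t1, where B="\<lambda>t. ?B1 t - ?B2 t"])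
    show "continuous_on {0..t1} (\<lambda>t. ?A1 t - ?A2 t)"
      by (intro continuous_on_diff flow_along_curve_continuous[OF curve\<mu> blY t1(2) \<tau>(1)]
          flow_along_curve_continuous[OF curve bounded_linear_ident t1(2) \<tau>(1)])
    show "continuous_on {0..t1} ?q" using \<tau> by (intro continuous_intros) auto
    fix t assume t: "t \<in> {0<..<t1}"
    then have tT: "t \<in> {0..T}" and s: "\<tau> - t > 0" using t1 \<tau> by auto
    have "\<bar>?B1 t - ?B2 t\<bar> \<le> flowC1 TYPE('a) / sqrt (\<tau> - t) * (\<kappa> * (1 / \<gamma> + gap t))"
      by (rule drift_work_diff[OF hf tT s])
    also have "\<dots> \<le> flowC1 TYPE('a) / sqrt (\<tau> - t) * (\<kappa> * (1 / \<gamma> + exp (l * t) * W))"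
      using gap[OF tT] \<kappa>_nonneg flowC1_pos[where 'a='a] s by (intro mult_left_mono add_left_mono) auto
    also have "\<dots> = ?q t" using s by (simp add: field_simps)
    finally show "\<bar>?B1 t - ?B2 t\<bar> \<le> ?q t" .
  next
    fix \<eta> \<alpha> \<beta> assume \<eta>: "smooth_on UNIV \<eta>" and \<alpha>: "0 < \<alpha>" and \<beta>: "\<beta> < t1"
      and supp: "\<And>t. t \<notin> {\<alpha>..\<beta>} \<Longrightarrow> \<eta> t = 0"
    have \<beta>': "\<beta> < T" "\<beta> < \<tau>" using \<beta> t1 \<tau> by auto
    have mom': "integrable (\<mu> t) (\<lambda>z. norm (snd z)) \<and> (\<integral>z. norm (snd z) \<partial>\<mu> t) \<le> M1" if "t \<in> {0<..<T}" for t
      using mom that by auto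
    note k = kinetic_time_form[OF \<gamma>0 kin DK_meas DK_bound DPhi_measurable DPhi_bound mom' \<eta> \<alpha> \<beta>' supp,
        folded Y_def]
    note r = aggregation_diffusion_time_form[OF ad curve DK_meas DK_bound DPhi_measurable DPhi_bound \<eta> \<alpha> \<beta>' supp]
    have eq: "pd 1 \<eta> t * (?A1 t - ?A2 t) + \<eta> t * (?B1 t - ?B2 t)
        = (pd 1 \<eta> t * ?A1 t + \<eta> t * ?B1 t) - (pd 1 \<eta> t * ?A2 t + \<eta> t * ?B2 t)" for t
      by (simp add: algebra_simps)
    show "set_integrable lborel {0<..<T} (\<lambda>t. pd 1 \<eta> t * (?A1 t - ?A2 t) + \<eta> t * (?B1 t - ?B2 t)) \<and>
        (LINT t:{0<..<T}|lborel. pd 1 \<eta> t * (?A1 t - ?A2 t) + \<eta> t * (?B1 t - ?B2 t)) = 0"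
      unfolding eq using set_integral_diff[OF k(1) r(1)] k(2) r(2) by simp
  qed
  moreover have "\<bar>?A1 0 - ?A2 0\<bar> \<le> gap 0"
  proof -
    have 0: "0 \<in> {0..T}" using T by simp
    have Pm: "P (\<tau> - 0) \<in> borel_measurable borel"
      by (rule borel_measurable_continuous_onI[OF continuous_on_P]) (use \<tau> in simp)
    show ?thesis
      using tv_upper[OF prob_coarse[OF 0] prob_rho[OF 0] Pm P_bound] \<tau>
      unfolding gap_def integral_coarse[OF 0 Pm] by simp
  qed
  moreover have "integral {0..t1} ?q \<le> ?c * (2 * sqrt (t1 + \<epsilon>) / \<gamma> + W * (exp (l * (t1 + \<epsilon>)) * (pi / sqrt l)))"
  proof -
    have i1: "(\<lambda>t. 1 / sqrt (\<tau> - t)) integrable_on {0..t1}"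
      and i2: "(\<lambda>t. exp (l * t) / sqrt (\<tau> - t)) integrable_on {0..t1}"
      using \<tau> by (intro integrable_continuous_real continuous_intros; auto)+
    have "integral {0..t1} ?q = ?c / \<gamma> * integral {0..t1} (\<lambda>t. 1 / sqrt (\<tau> - t))
        + ?c * W * integral {0..t1} (\<lambda>t. exp (l * t) / sqrt (\<tau> - t))"
      by (subst Henstock_Kurzweil_Integration.integral_add)
         (intro integrable_on_mult_right i1 i2 | simp only: integral_mult_right)+
    also have "\<dots> \<le> ?c / \<gamma> * (2 * sqrt (t1 + \<epsilon>)) + ?c * W * (exp (l * (t1 + \<epsilon>)) * (pi / sqrt l))"
      unfolding \<tau>_def using c0 \<gamma>0 W t1 \<epsilon> l
      by (intro add_mono mult_left_mono singular_kernel_integral singular_kernel_integral_exp) auto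
    also have "\<dots> = ?c * (2 * sqrt (t1 + \<epsilon>) / \<gamma> + W * (exp (l * (t1 + \<epsilon>)) * (pi / sqrt l)))"
      by (simp add: algebra_simps)
    finally show ?thesis .
  qed
  moreover have "\<tau> - t1 = \<epsilon>" by (simp add: \<tau>_def)
  ultimately show ?thesis by simp
qed

text \<open>Letting \<epsilon> tend to 0 recovers \<open>f\<close> from its flow, and
  \<open>tv_bound_extend\<close> upgrades the estimate to total variation. The outcome is the
  Volterra inequality, with \<open>W\<close> standing for the weighted supremum of
  \<open>gap\<close>.\<close>

lemma gap_step:
  assumes t1: "t1 \<in> {0..T}" and l: "l > 0" and W: "W \<ge> 0"
    and gap: "\<And>t. t \<in> {0..T} \<Longrightarrow> gap t \<le> exp (l * t) * W"
  shows "gap t1 \<le> gap 0 + flowC1 TYPE('a) * \<kappa> * (2 * sqrt T / \<gamma> + W * (exp (l * t1) * (pi / sqrt l)))"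
proof (cases "t1 = 0")
  case True
  have "flowC1 TYPE('a) * \<kappa> * (2 * sqrt T / \<gamma> + W * (exp (l * t1) * (pi / sqrt l))) \<ge> 0"
    using \<kappa>_nonneg flowC1_pos[where 'a='a] W T \<gamma> l
    by (intro mult_nonneg_nonneg add_nonneg_nonneg divide_nonneg_nonneg) auto
  then show ?thesis using True by simp
next
  case False
  then have t1': "0 < t1" "t1 \<le> T" using t1 by auto
  let ?c = "flowC1 TYPE('a) * \<kappa>"
  let ?R = "\<lambda>\<epsilon>. gap 0 + ?c * (2 * sqrt (t1 + \<epsilon>) / \<gamma> + W * (exp (l * (t1 + \<epsilon>)) * (pi / sqrt l)))"
  have c0: "?c \<ge> 0" using \<kappa>_nonneg flowC1_pos[where 'a='a] by simp
  have bd: "\<bar>(\<integral>x. f x \<partial>coarse t1) - (\<integral>x. f x \<partial>\<rho> t1)\<bar> \<le> ?R 0" if hf: "heat_flow f a b" for f a b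
  proof -
    interpret heat_flow f a b by fact
    define \<epsilon> where "\<epsilon> n = 1 / real (Suc n)" for n
    have \<epsilon>: "\<epsilon> n > 0" for n by (simp add: \<epsilon>_def)
    have \<epsilon>0: "\<epsilon> \<longlonglongrightarrow> 0"
      unfolding \<epsilon>_def[abs_def] using LIMSEQ_inverse_real_of_nat by (simp add: inverse_eq_divide)
    have \<epsilon>r: "filterlim \<epsilon> (at_right 0) sequentially"
      unfolding filterlim_at using \<epsilon>0 \<epsilon> less_imp_neq[OF \<epsilon>, THEN not_sym] by auto
    have fm: "f \<in> borel_measurable borel" by (rule borel_measurable_continuous_onI[OF f_cont])
    have Pm: "P (\<epsilon> n) \<in> borel_measurable borel" for n
      by (rule borel_measurable_continuous_onI[OF continuous_on_P[OF \<epsilon>]])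
    have lim: "(\<lambda>n. \<integral>x. P (\<epsilon> n) x \<partial>\<nu>) \<longlonglongrightarrow> (\<integral>x. f x \<partial>\<nu>)"
      if \<nu>: "prob_space \<nu>" "sets \<nu> = sets borel" for \<nu> :: "'a measure"
    proof -
      interpret prob_space \<nu> by fact
      note cs = measurable_cong_sets[OF \<nu>(2) refl]
      show ?thesis
        by (rule integral_dominated_convergence[where w="\<lambda>_. 1"])
           (use fm Pm cs P_bound[OF \<epsilon>] filterlim_compose[OF P_tendsto \<epsilon>r] in auto)
    qed
    have sc: "sets (coarse t1) = sets borel" by (simp add: coarse_def)
    have 1: "(\<lambda>n. \<bar>(\<integral>x. P (\<epsilon> n) x \<partial>coarse t1) - (\<integral>x. P (\<epsilon> n) x \<partial>\<rho> t1)\<bar>)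
        \<longlonglongrightarrow> \<bar>(\<integral>x. f x \<partial>coarse t1) - (\<integral>x. f x \<partial>\<rho> t1)\<bar>"
      by (intro tendsto_rabs tendsto_diff lim prob_coarse[OF t1] sc prob_rho[OF t1] sets_rho[OF t1])
    have 2: "(\<lambda>n. ?R (\<epsilon> n)) \<longlonglongrightarrow> ?R 0"
      using \<gamma> by (intro tendsto_intros \<epsilon>0) auto
    have "\<bar>(\<integral>x. P (\<epsilon> n) x \<partial>coarse t1) - (\<integral>x. P (\<epsilon> n) x \<partial>\<rho> t1)\<bar> \<le> ?R (\<epsilon> n)" for n
      unfolding integral_coarse[OF t1 Pm] by (rule duhamel[OF hf t1' \<epsilon> l W gap])
    then show ?thesis by (intro LIMSEQ_le[OF 1 2] exI allI impI)
  qed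
  have sc: "sets (coarse t1) = sets borel" by (simp add: coarse_def)
  have "gap t1 \<le> ?R 0"
    unfolding gap_def[of t1]
    by (rule tv_least)
       (rule tv_bound_extend[OF prob_coarse[OF t1] sc ac_coarse[OF t1] prob_rho[OF t1] sets_rho[OF t1] ac[OF t1] bd])
  also have "?R 0 \<le> gap 0 + ?c * (2 * sqrt T / \<gamma> + W * (exp (l * t1) * (pi / sqrt l)))"
  proof -
    have "2 * sqrt t1 / \<gamma> \<le> 2 * sqrt T / \<gamma>" using t1' \<gamma> by (intro divide_right_mono) auto
    then show ?thesis unfolding add_0_right
      by (intro add_left_mono mult_left_mono[OF _ c0] add_right_mono)
  qed
  finally show ?thesis .
qed

definition rate :: real where
  "rate = (2 * flowC1 TYPE('a) * \<kappa> * pi + 1)\<^sup>2"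

text \<open>The rate is chosen such that the Volterra term in the weighted supremum is at most one half.\<close>

lemma gap_bound:
  assumes t: "t \<in> {0..T}"
  shows "gap t \<le> exp (rate * T) * (2 * gap 0 + 4 * flowC1 TYPE('a) * \<kappa> * sqrt T / \<gamma>)"
proof -
  let ?c = "flowC1 TYPE('a) * \<kappa>"
  have c0: "?c \<ge> 0" using \<kappa>_nonneg flowC1_pos[where 'a='a] by simp
  have root: "sqrt rate = 2 * ?c * pi + 1" unfolding rate_def using c0 by simp
  have r: "rate > 0" using root c0 by (metis real_sqrt_gt_0_iff add_nonneg_pos mult_nonneg_nonneg zero_le_numeral pi_ge_zero zero_less_one)
  define W where "W = (SUP t\<in>{0..T}. exp (- (rate * t)) * gap t)"
  have g: "0 \<le> gap t" "gap t \<le> 2" if "t \<in> {0..T}" for t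
    unfolding gap_def using tv_nonneg tv_le_2 prob_coarse[OF that] prob_rho[OF that] by blast+
  \<comment> \<open>The a priori bound 2 on \<open>gap\<close> makes \<open>W\<close> finite; only
    then can W / 2 be absorbed into the left-hand side below.\<close>
  have bdd: "bdd_above ((\<lambda>t. exp (- (rate * t)) * gap t) ` {0..T})"
  proof (rule bdd_aboveI2)
    fix t assume t: "t \<in> {0..T}"
    have "exp (- (rate * t)) * gap t \<le> 1 * 2" using g[OF t] t r by (intro mult_mono) auto
    then show "exp (- (rate * t)) * gap t \<le> 2" by simp
  qed
  have ne: "{0..T} \<noteq> {}" using T by simp
  have up: "exp (- (rate * t)) * gap t \<le> W" if "t \<in> {0..T}" for t
    unfolding W_def by (rule cSUP_upper[OF that bdd])
  have W0: "W \<ge> 0" using up[of 0] g(1)[of 0] T by simp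
  have le: "gap t \<le> exp (rate * t) * W" if "t \<in> {0..T}" for t
  proof -
    have "exp (rate * t) * (exp (- (rate * t)) * gap t) \<le> exp (rate * t) * W"
      using up[OF that] by (intro mult_left_mono) auto
    then show ?thesis by (simp add: mult.assoc[symmetric] exp_add[symmetric])
  qed
  have half: "?c * (pi / sqrt rate) \<le> 1 / 2"
  proof -
    have "x / (2 * x + 1) \<le> 1 / 2" if "x \<ge> 0" for x :: real
      using that by (simp add: field_simps)
    from this[OF mult_nonneg_nonneg[OF c0 pi_ge_zero]] show ?thesis
      unfolding root by (simp add: mult.assoc)
  qed
  let ?a = "gap 0 + ?c * (2 * sqrt T / \<gamma>)"
  have a0: "?a \<ge> 0" using g(1)[of 0] c0 T \<gamma> by simp
  have "W \<le> ?a + W / 2"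
    unfolding W_def
  proof (rule cSUP_least[OF ne], fold W_def)
    fix t assume t: "t \<in> {0..T}"
    have "gap t \<le> ?a + (?c * (pi / sqrt rate)) * (W * exp (rate * t))"
      using gap_step[OF t r W0 le] by (simp add: algebra_simps)
    also have "\<dots> \<le> ?a + 1 / 2 * (W * exp (rate * t))"
      using half W0 by (intro add_left_mono mult_right_mono) auto
    finally have "exp (- (rate * t)) * gap t \<le> exp (- (rate * t)) * (?a + 1 / 2 * (W * exp (rate * t)))"
      by (intro mult_left_mono) auto
    also have "\<dots> = exp (- (rate * t)) * ?a + W / 2 * (exp (- (rate * t)) * exp (rate * t))"
      by (simp add: algebra_simps)
    also have "exp (- (rate * t)) * exp (rate * t) = 1" by (simp add: exp_add[symmetric])
    also have "exp (- (rate * t)) * ?a \<le> 1 * ?a" using a0 r t by (intro mult_right_mono) auto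
    finally show "exp (- (rate * t)) * gap t \<le> ?a + W / 2" by simp
  qed
  then have "W \<le> 2 * ?a" by simp
  have "gap t \<le> exp (rate * t) * W" by (rule le[OF t])
  also have "\<dots> \<le> exp (rate * T) * (2 * ?a)"
    using \<open>W \<le> 2 * ?a\<close> W0 r t by (intro mult_mono) auto
  also have "2 * ?a = 2 * gap 0 + 4 * flowC1 TYPE('a) * \<kappa> * sqrt T / \<gamma>" by simp
  finally show ?thesis .
qed

text \<open>The triangle inequality through the coarse-grained law; the constant is enlarged so that
  all terms share the factor \<open>gap 0 + 1 / \<gamma>\<close>.\<close>

lemma marginal_bound:
  assumes t: "t \<in> {0..T}" and h: "h \<in> borel_measurable borel" "\<And>x. \<bar>h x\<bar> \<le> (1::real)"
  shows "\<bar>(\<integral>x. h x \<partial>xmarg (\<mu> t)) - (\<integral>x. h x \<partial>\<rho> t)\<bar>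
    \<le> (CG + exp (rate * T) * (2 + 4 * flowC1 TYPE('a) * \<kappa> * sqrt T)) * (gap 0 + 1 / \<gamma>)"
proof -
  let ?d = "4 * flowC1 TYPE('a) * \<kappa> * sqrt T"
  have d0: "?d \<ge> 0" using \<kappa>_nonneg flowC1_pos[where 'a='a] T by simp
  have g0: "gap 0 \<ge> 0" unfolding gap_def by (intro tv_nonneg prob_coarse prob_rho) (use T in auto)
  have "\<bar>(\<integral>x. h x \<partial>coarse t) - (\<integral>x. h x \<partial>xmarg (\<mu> t))\<bar> \<le> CG / \<gamma>"
    unfolding integral_coarse[OF t h(1)] integral_xmarg[OF t h(1)] by (rule coarse_xmarg_bound[OF t h])
  moreover have "\<bar>(\<integral>x. h x \<partial>coarse t) - (\<integral>x. h x \<partial>\<rho> t)\<bar> \<le> gap t"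
    unfolding gap_def by (rule tv_upper[OF prob_coarse[OF t] prob_rho[OF t] h])
  ultimately have "\<bar>(\<integral>x. h x \<partial>xmarg (\<mu> t)) - (\<integral>x. h x \<partial>\<rho> t)\<bar> \<le> CG / \<gamma> + gap t" by linarith
  also have "\<dots> \<le> CG * (gap 0 + 1 / \<gamma>) + exp (rate * T) * ((2 + ?d) * (gap 0 + 1 / \<gamma>))"
  proof (rule add_mono)
    show "CG / \<gamma> \<le> CG * (gap 0 + 1 / \<gamma>)" using nonneg g0 by (simp add: distrib_left)
    have eqx: "(2 + x) * (gap 0 + 1 / \<gamma>) = 2 * gap 0 + x / \<gamma> + (x * gap 0 + 2 / \<gamma>)" for x
      by (simp add: algebra_simps)
    have "?d * gap 0 + 2 / \<gamma> \<ge> 0"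
      using mult_nonneg_nonneg[OF d0 g0] \<gamma> by (intro add_nonneg_nonneg) auto
    then have "2 * gap 0 + ?d / \<gamma> \<le> (2 + ?d) * (gap 0 + 1 / \<gamma>)" unfolding eqx by linarith
    then show "gap t \<le> exp (rate * T) * ((2 + ?d) * (gap 0 + 1 / \<gamma>))"
      using gap_bound[OF t] by (meson exp_ge_zero mult_left_mono order_trans)
  qed
  finally show ?thesis by (simp only: distrib_right mult.assoc)
qed

end

text \<open>Outside the locale the order of quantifiers becomes explicit: the constant precedes
  \<gamma> and \<mu>. It is written with \<open>rate\<close> and \<kappa> expanded, and cut off at 0
  because the signs of the parameters are known only inside the locale.\<close>

lemma marginal_bound_uniform:
  "\<exists>K\<ge>0. \<forall>\<gamma> \<mu> t. \<forall>h\<in>borel_measurable borel. coarse_grained DPhi DK L BP BK CG M1 T \<gamma> \<mu> \<rho> \<longrightarrow> t \<in> {0..T} \<longrightarrow>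
     (\<forall>x. \<bar>h x\<bar> \<le> (1::real)) \<longrightarrow> \<bar>(\<integral>x. h x \<partial>xmarg (\<mu> t)) - (\<integral>x. h x \<partial>\<rho> t)\<bar>
       \<le> K * (tv (distr (\<mu> 0) borel (\<lambda>z::'a::euclidean_space \<times> 'a. fst z + (1 / \<gamma>) *\<^sub>R snd z)) (\<rho> 0) + 1 / \<gamma>)"
proof -
  define c where "c = CG + exp ((2 * flowC1 TYPE('a) * ((L + BK * CG) * (1 + M1) + BK + (BP + BK)) * pi + 1)\<^sup>2 * T) *
    (2 + 4 * flowC1 TYPE('a) * ((L + BK * CG) * (1 + M1) + BK + (BP + BK)) * sqrt T)"
  have "\<bar>(\<integral>x. h x \<partial>xmarg (\<mu> t)) - (\<integral>x. h x \<partial>\<rho> t)\<bar>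
       \<le> max c 0 * (tv (distr (\<mu> 0) borel (\<lambda>z::'a \<times> 'a. fst z + (1 / \<gamma>) *\<^sub>R snd z)) (\<rho> 0) + 1 / \<gamma>)"
    if "coarse_grained DPhi DK L BP BK CG M1 T \<gamma> \<mu> \<rho>" "t \<in> {0..T}"
      and h: "h \<in> borel_measurable borel" "\<And>x. \<bar>h x\<bar> \<le> 1" for \<gamma> \<mu> t and h :: "'a \<Rightarrow> real"
  proof -
    interpret coarse_grained DPhi DK L BP BK CG M1 T \<gamma> \<mu> \<rho> by fact
    have "0 \<in> {0..T}" using T by simp
    then have "gap 0 \<ge> 0" unfolding gap_def by (intro tv_nonneg prob_coarse prob_rho)
    then have "c * (gap 0 + 1 / \<gamma>) \<le> max c 0 * (gap 0 + 1 / \<gamma>)" using \<gamma> by (intro mult_right_mono) auto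
    with marginal_bound[OF that(2) h] show ?thesis
      unfolding gap_def coarse_def Y_def[abs_def] c_def rate_def \<kappa>_def by linarith
  qed
  then show ?thesis by (intro exI[of _ "max c 0"]) auto
qed

section \<open>Constants uniform in the friction parameter, and the entropy at time zero\<close>

theorem theorem1p5:
  fixes Phi :: "'a::euclidean_space \<Rightarrow> real" and DPhi :: "'a \<Rightarrow> 'a"
    and K :: "'a \<Rightarrow> real" and DK :: "'a \<Rightarrow> 'a"
    and c_Phi T :: real
    and mu :: "real \<Rightarrow> real \<Rightarrow> ('a \<times> 'a) measure"
    and rho :: "real \<Rightarrow> 'a measure" and rho0 :: "'a measure"
  assumes Phi_nonneg: "\<forall>x. 0 \<le> Phi x"
    and Phi_loc_lip: "\<forall>x. \<exists>e>0. \<exists>L. L-lipschitz_on (ball x e) Phi"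
    and Phi_grad: "\<forall>x. GDERIV Phi x :> DPhi x"
    and cPhi_pos: "c_Phi > 0"
    and A1_growth: "\<forall>x. norm (DPhi x) \<le> c_Phi * (1 + norm x)"
    and A1_lip: "c_Phi-lipschitz_on UNIV DPhi"
    and A2: "\<forall>r::real. r \<ge> 1 \<longrightarrow> (\<exists>B. \<forall>x. norm (DPhi x) powr r * exp (- Phi x) \<le> B)"
    and exp_Phi_L1: "integrable lborel (\<lambda>x. exp (- Phi x))"
    and K_grad: "weak_grad K DK"
    and DK_bounded: "\<exists>B. \<forall>x. norm (DK x) \<le> B"
    and T_pos: "T > 0"
    and kin_sol: "\<forall>\<gamma>\<ge>1. kinetic_weak_sol DPhi DK \<gamma> T (mu \<gamma>)"
    and unif_bound: "\<exists>M. \<forall>\<gamma>\<ge>1. \<forall>t\<in>{0..T}. \<exists>m g.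
        (\<forall>z. 0 \<le> m z) \<and> mu \<gamma> t = density lborel (\<lambda>z. ennreal (m z)) \<and> weak_x_grad m g \<and>
        (\<integral>\<^sup>+z. ennreal (norm (g z) ^ 2 * exp (Hamil Phi z)) \<partial>lborel) < \<infinity> \<and>
        sqrt (enn2real (\<integral>\<^sup>+z. ennreal (norm (g z) ^ 2 * exp (Hamil Phi z)) \<partial>lborel))
          + (\<integral>z. norm (snd z) ^ 2 \<partial>(mu \<gamma> t)) \<le> M"
    and rho_sol: "FER_sol Phi DPhi K DK T rho0 rho"
    and rho_unique: "\<forall>rho'. FER_sol Phi DPhi K DK T rho0 rho' \<longrightarrow> (\<forall>t\<in>{0..T}. rho' t = rho t)"
  shows "\<exists>C>0. \<forall>\<gamma>\<ge>1. \<forall>t\<in>{0..T}.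
           ereal ((dBL (xmarg (mu \<gamma> t)) (rho t))\<^sup>2)
             \<le> ereal C * (Ent (distr (mu \<gamma> 0) borel (pix \<circ> Gamma \<gamma>)) rho0 + ereal (1 / \<gamma>\<^sup>2))"
proof -
  obtain M where M: "\<And>\<gamma> t. \<gamma> \<ge> 1 \<Longrightarrow> t \<in> {0..T} \<Longrightarrow> \<exists>m g.
        (\<forall>z. 0 \<le> m z) \<and> mu \<gamma> t = density lborel (\<lambda>z. ennreal (m z)) \<and> weak_x_grad m g \<and>
        (\<integral>\<^sup>+z. ennreal (norm (g z) ^ 2 * exp (Hamil Phi z)) \<partial>lborel) < \<infinity> \<and>
        sqrt (enn2real (\<integral>\<^sup>+z. ennreal (norm (g z) ^ 2 * exp (Hamil Phi z)) \<partial>lborel))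
          + (\<integral>z. norm (snd z) ^ 2 \<partial>(mu \<gamma> t)) \<le> M"
    using unif_bound by blast
  obtain B0 where B0: "\<And>x. norm (DK x) \<le> B0" using DK_bounded by blast
  have B0_nonneg: "B0 \<ge> 0" using order_trans[OF norm_ge_zero B0] .
  have DKm: "DK \<in> borel_measurable borel" using K_grad by (simp add: weak_grad_def)
  have P2_rho0: "P2 rho0" and rho_0: "rho 0 = rho0" and curve: "P2_curve T rho"
    and fe: "\<exists>B. \<forall>t\<in>{0..T}. free_energy Phi K (rho t) \<le> ereal B"
    and Fb: "\<exists>B. \<forall>t\<in>{0..T}. AE x in lborel. norm (Fdrift DPhi DK x (rho t)) \<le> B"
    using rho_sol unfolding FER_sol_def by blast+
  have ad: "(let G = (\<lambda>t x. dt_ad \<psi> (t, x) + Fdrift DPhi DK x (rho t) \<bullet> grad_ad \<psi> (t, x) + lap_ad \<psi> (t, x))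
         in (\<forall>t\<in>{0<..<T}. integrable (rho t) (G t)) \<and>
            set_integrable lborel {0<..<T} (\<lambda>t. \<integral>x. G t x \<partial>rho t) \<and>
            (\<integral>t\<in>{0<..<T}. (\<integral>x. G t x \<partial>rho t) \<partial>lborel) = 0)"
    if "test_fun ({0<..<T} \<times> UNIV) \<psi>" for \<psi>
    using rho_sol that unfolding FER_sol_def by blast
  have "0 \<in> {0..T}" using T_pos by simp
  have Phi_cont: "continuous_on UNIV Phi"
  proof (intro continuous_at_imp_continuous_on ballI)
    show "isCont Phi x" for x
      using Phi_grad unfolding gderiv_def by (blast intro: has_derivative_continuous)
  qed
  have DPhi_cont: "continuous_on UNIV DPhi" using A1_lip by (rule lipschitz_on_continuous_on)
  \<comment> \<open>The drift bound at time 0 and the bound on the convolution control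
    \<open>DPhi\<close> almost everywhere. The set where the bound fails is open by continuity and
    null, hence empty.\<close>
  obtain BP where BP: "\<And>x. norm (DPhi x) \<le> BP"
  proof -
    obtain B where "AE x in lborel. norm (Fdrift DPhi DK x (rho 0)) \<le> B"
      using Fb \<open>0 \<in> {0..T}\<close> by blast
    moreover have "norm (DPhi x) \<le> norm (Fdrift DPhi DK x (rho 0)) + B0" for x
    proof -
      have p: "prob_space (rho 0)" using P2_rho0 by (simp add: rho_0 P2_def)
      have "DPhi x = - Fdrift DPhi DK x (rho 0) - conv_drift DK (rho 0) x" by (simp add: Fdrift_eq)
      then show ?thesis
        using norm_triangle_ineq4[of "- Fdrift DPhi DK x (rho 0)" "conv_drift DK (rho 0) x"]
          conv_drift_bound[where DK=DK and x=x, OF p B0] by simp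
    qed
    ultimately have "AE x in lborel. x \<notin> {x. B + B0 < norm (DPhi x)}"
      by (elim AE_mp) (intro AE_I2 impI, smt (verit) mem_Collect_eq)
    moreover have op: "open {x. B + B0 < norm (DPhi x)}"
      using DPhi_cont by (intro open_Collect_less continuous_intros)
    ultimately have "{x. B + B0 < norm (DPhi x)} \<in> null_sets lborel"
      using AE_iff_null_sets[of "{x. B + B0 < norm (DPhi x)}" lborel] borel_open[OF op] by simp
    then have "negligible {x. B + B0 < norm (DPhi x)}"
      by (simp add: negligible_iff_null_sets null_sets_completionI)
    then have "{x. B + B0 < norm (DPhi x)} = {}" using open_not_negligible[OF op] by blast
    then show thesis by (intro that[of "B + B0"]) (auto simp: not_less)
  qed
  have BP_nonneg: "BP \<ge> 0" using order_trans[OF norm_ge_zero BP] .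
  \<comment> \<open>Without absolute continuity the entropy, and with it the free energy, would be
    infinite.\<close>
  have ac: "absolutely_continuous lborel (rho t)" if t: "t \<in> {0..T}" for t
  proof (rule ccontr)
    assume n: "\<not> absolutely_continuous lborel (rho t)"
    have "free_energy Phi K (rho t) = \<infinity>" by (simp add: free_energy_def Ent_def n)
    moreover obtain B where "free_energy Phi K (rho t) \<le> ereal B" using fe t by blast
    ultimately show False by simp
  qed
  define Z where "Z = (\<integral>z. exp (- Phi (fst z)) * ((1 + norm (snd z))\<^sup>2 * exp (- ((norm (snd z :: 'a))\<^sup>2 / 2))) \<partial>lborel)"
  have Z: "Z \<ge> 0" unfolding Z_def by (intro Bochner_Integration.integral_nonneg) simp
  have M0: "M \<ge> 0"
  proof -
    obtain g :: "'a \<times> 'a \<Rightarrow> 'a" where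
      "sqrt (enn2real (\<integral>\<^sup>+z. ennreal (norm (g z) ^ 2 * exp (Hamil Phi z)) \<partial>lborel))
          + (\<integral>z. norm (snd z) ^ 2 \<partial>(mu 1 0)) \<le> M"
      using M[of 1 0] T_pos by auto
    moreover have "(\<integral>z. norm (snd z) ^ 2 \<partial>(mu 1 0)) \<ge> 0" by (intro Bochner_Integration.integral_nonneg) simp
    moreover have "sqrt (enn2real (\<integral>\<^sup>+z. ennreal (norm (g z) ^ 2 * exp (Hamil Phi z)) \<partial>lborel)) \<ge> 0" by simp
    ultimately show ?thesis by linarith
  qed
  \<comment> \<open>The gradient constant is that of \<open>weighted_gradient_L1\<close>, and 1 + M
    bounds the first velocity moment because |v| <= 1 + |v|^2. Neither depends on \<gamma>.\<close>
  have setting: "coarse_grained DPhi DK c_Phi BP B0 ((Z + M\<^sup>2) / 2) (1 + M) T \<gamma> (mu \<gamma>) rho" if \<gamma>: "\<gamma> \<ge> 1" for \<gamma>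
  proof
    show "norm (DPhi x - DPhi y) \<le> c_Phi * norm (x - y)" for x y
      using lipschitz_onD[OF A1_lip, of x y] by (simp add: dist_norm)
    show sol: "kinetic_weak_sol DPhi DK \<gamma> T (mu \<gamma>)" using kin_sol \<gamma> by blast
    fix t assume t: "t \<in> {0..T}"
    obtain m g where mg: "\<forall>z. 0 \<le> m z" "mu \<gamma> t = density lborel (\<lambda>z. ennreal (m z))" "weak_x_grad m g"
      and fin: "(\<integral>\<^sup>+z. ennreal (norm (g z) ^ 2 * exp (Hamil Phi z)) \<partial>lborel) < \<infinity>"
      and sum: "sqrt (enn2real (\<integral>\<^sup>+z. ennreal (norm (g z) ^ 2 * exp (Hamil Phi z)) \<partial>lborel))
          + (\<integral>z. norm (snd z) ^ 2 \<partial>(mu \<gamma> t)) \<le> M"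
      using M[OF \<gamma> t] by blast
    have n1: "(\<integral>z. norm (snd z) ^ 2 \<partial>(mu \<gamma> t)) \<ge> 0" by (intro Bochner_Integration.integral_nonneg) simp
    have n2: "sqrt (enn2real (\<integral>\<^sup>+z. ennreal (norm (g z) ^ 2 * exp (Hamil Phi z)) \<partial>lborel)) \<ge> 0" by simp
    have gb: "sqrt (enn2real (\<integral>\<^sup>+z. ennreal (norm (g z) ^ 2 * exp (Hamil Phi z)) \<partial>lborel)) \<le> M"
      and vb: "(\<integral>z. norm (snd z) ^ 2 \<partial>(mu \<gamma> t)) \<le> M" using sum n1 n2 by linarith+
    have gm: "g \<in> borel_measurable borel" using mg(3) by (simp add: weak_x_grad_def)
    note L1 = weighted_gradient_L1[OF exp_Phi_L1 borel_measurable_continuous_onI[OF Phi_cont] gm fin gb, folded Z_def]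
    show "\<exists>m g. (\<forall>z. 0 \<le> m z) \<and> mu \<gamma> t = density lborel (\<lambda>z. ennreal (m z)) \<and>
      weak_x_grad m g \<and> integrable lborel (\<lambda>z. (1 + norm (snd z)) * norm (g z)) \<and>
      (\<integral>z. (1 + norm (snd z)) * norm (g z) \<partial>lborel) \<le> (Z + M\<^sup>2) / 2"
      using mg L1 by blast
    have P2: "P2 (mu \<gamma> t)" using sol t by (simp add: kinetic_weak_sol_def P2_curve_def)
    then interpret prob_space "mu \<gamma> t" by (simp add: P2_def)
    have sets: "sets (mu \<gamma> t) = sets borel" using P2 by (simp add: P2_def)
    have sm: "f \<in> borel_measurable (mu \<gamma> t)" if "continuous_on UNIV f" for f :: "'a \<times> 'a \<Rightarrow> real"
      using borel_measurable_continuous_onI[OF that] measurable_cong_sets[OF sets refl] by blast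
    \<comment> \<open>Finiteness of the second moment is taken from \<open>P2\<close>: the bound on
      the Bochner integral of |v|^2 alone would not exclude the default value 0 of a non-integrable
      function.\<close>
    have z2: "integrable (mu \<gamma> t) (\<lambda>z. norm z ^ 2)"
      by (rule integrableI_nonneg) (use P2 in \<open>auto simp: P2_def intro!: sm continuous_intros\<close>)
    have v2: "integrable (mu \<gamma> t) (\<lambda>z. norm (snd z) ^ 2)"
      by (rule Bochner_Integration.integrable_bound[OF z2 sm])
         (auto intro!: continuous_intros AE_I2 power_mono norm_snd_le)
    have le: "norm v \<le> 1 + norm v ^ 2" for v :: 'a
      using sum_squares_bound[of 1 "norm v"] zero_le_power2[of "norm v"] norm_ge_zero[of v]
      unfolding one_power2 by linarith
    have b: "integrable (mu \<gamma> t) (\<lambda>z. 1 + norm (snd z) ^ 2)" using v2 by simp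
    have v1: "integrable (mu \<gamma> t) (\<lambda>z. norm (snd z))"
      by (rule Bochner_Integration.integrable_bound[OF b sm]) (auto intro!: continuous_intros AE_I2 le)
    have "(\<integral>z. norm (snd z) \<partial>mu \<gamma> t) \<le> (\<integral>z. 1 + norm (snd z) ^ 2 \<partial>mu \<gamma> t)"
      by (rule integral_mono[OF v1 b le])
    also have "\<dots> \<le> 1 + M" using v2 vb by (simp add: prob_space)
    finally show "integrable (mu \<gamma> t) (\<lambda>z. norm (snd z)) \<and> (\<integral>z. norm (snd z) \<partial>mu \<gamma> t) \<le> 1 + M"
      using v1 by simp
  qed (use \<gamma> T_pos cPhi_pos BP BP_nonneg B0 B0_nonneg Z M0 DKm curve ad ac in auto)
  obtain C where C0: "C \<ge> 0" and "\<forall>\<gamma> \<mu> t. \<forall>h\<in>borel_measurable borel.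
     coarse_grained DPhi DK c_Phi BP B0 ((Z + M\<^sup>2) / 2) (1 + M) T \<gamma> \<mu> rho \<longrightarrow> t \<in> {0..T} \<longrightarrow>
     (\<forall>x. \<bar>h x\<bar> \<le> (1::real)) \<longrightarrow> \<bar>(\<integral>x. h x \<partial>xmarg (\<mu> t)) - (\<integral>x. h x \<partial>rho t)\<bar>
       \<le> C * (tv (distr (\<mu> 0) borel (\<lambda>z. fst z + (1 / \<gamma>) *\<^sub>R snd z)) (rho 0) + 1 / \<gamma>)"
    using marginal_bound_uniform[of DPhi DK c_Phi BP B0 "(Z + M\<^sup>2) / 2" "1 + M" T rho] by (elim exE conjE)
  note C = C0 this(2)[rule_format, OF _ setting]
  show ?thesis
  \<comment> \<open>With u the total variation at time 0, 2 u^2 +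
    \<open>2 / \<gamma>\<^sup>2\<close> and the Pinsker bound u^2 <= 4 E give the factor 8; the
    summand 1 keeps the constant positive when C = 0.\<close>
  proof (intro exI[of _ "8 * C\<^sup>2 + 1"] conjI allI impI ballI)
    show "8 * C\<^sup>2 + 1 > 0" by (simp add: add_nonneg_pos)
    fix \<gamma> t :: real assume \<gamma>: "1 \<le> \<gamma>" and t: "t \<in> {0..T}"
    interpret coarse_grained DPhi DK c_Phi BP B0 "(Z + M\<^sup>2) / 2" "1 + M" T \<gamma> "mu \<gamma>" rho by (rule setting[OF \<gamma>])
    let ?\<nu> = "distr (mu \<gamma> 0) borel (pix \<circ> Gamma \<gamma>)" and ?d = "dBL (xmarg (mu \<gamma> t)) (rho t)"
    have "pix \<circ> Gamma \<gamma> = (\<lambda>z::'a \<times> 'a. fst z + (1 / \<gamma>) *\<^sub>R snd z)" by (auto simp: pix_def Gamma_def)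
    then have \<nu>: "?\<nu> = distr (mu \<gamma> 0) borel (\<lambda>z. fst z + (1 / \<gamma>) *\<^sub>R snd z)" by simp
    have pr: "prob_space ?\<nu>" "prob_space rho0"
      using prob_coarse[OF \<open>0 \<in> {0..T}\<close>] P2_rho0 unfolding coarse_def Y_def[abs_def] \<nu> by (auto simp: P2_def)
    let ?u = "tv ?\<nu> rho0"
    have u0: "?u \<ge> 0" by (rule tv_nonneg[OF pr])
    let ?S = "{\<bar>(\<integral>x. f x \<partial>xmarg (mu \<gamma> t)) - (\<integral>x. f x \<partial>rho t)\<bar> | f::'a \<Rightarrow> real. 1-lipschitz_on UNIV f \<and> (\<forall>x. \<bar>f x\<bar> \<le> 1)}"
    \<comment> \<open>Test functions for \<open>dBL\<close> are continuous and bounded by 1, hence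
      admissible for total variation.\<close>
    have Sb: "s \<le> C * (?u + 1 / \<gamma>)" if "s \<in> ?S" for s
    proof -
      obtain f where f: "s = \<bar>(\<integral>x. f x \<partial>xmarg (mu \<gamma> t)) - (\<integral>x. f x \<partial>rho t)\<bar>"
        "1-lipschitz_on UNIV f" "\<forall>x. \<bar>f x\<bar> \<le> 1" using \<open>s \<in> ?S\<close> by blast
      have "f \<in> borel_measurable borel"
        by (rule borel_measurable_continuous_onI[OF lipschitz_on_continuous_on[OF f(2)]])
      then show ?thesis unfolding f(1) \<nu> rho_0[symmetric] using C(2)[OF _ \<gamma> t] f(3) by blast
    qed
    \<comment> \<open>\<open>dBL\<close> is a supremum of real numbers; the value 0 of the zero
      function makes the set nonempty and the supremum nonnegative, which squaring requires.\<close>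
    have S0: "0 \<in> ?S" by (rule CollectI, rule exI[of _ "\<lambda>_. 0::real"]) (simp add: lipschitz_on_def)
    have d0: "0 \<le> ?d" unfolding dBL_def by (rule cSup_upper[OF S0 bdd_aboveI[OF Sb]])
    have d1: "?d \<le> C * (?u + 1 / \<gamma>)" unfolding dBL_def by (rule cSup_least[OF _ Sb]) (use S0 in blast)+
    have sets0: "sets ?\<nu> = sets rho0" using P2_rho0 by (simp add: P2_def)
    have pin: "ereal (((\<integral>x. h x \<partial>?\<nu>) - (\<integral>x. h x \<partial>rho0))\<^sup>2) \<le> 4 * Ent ?\<nu> rho0"
      if "h \<in> borel_measurable borel" "\<And>x. \<bar>h x\<bar> \<le> 1" for h
      by (rule pinsker[OF pr sets0]) (use that P2_rho0 measurable_cong_sets[of rho0 borel] in \<open>auto simp: P2_def\<close>)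
    show "ereal (?d\<^sup>2) \<le> ereal (8 * C\<^sup>2 + 1) * (Ent ?\<nu> rho0 + ereal (1 / \<gamma>\<^sup>2))"
    \<comment> \<open>Finite entropy is the substantial case. Infinite entropy makes the right-hand
      side infinite, and \<open>pin\<close> with the zero function excludes minus infinity.\<close>
    proof (cases "Ent ?\<nu> rho0")
      case (real E)
      have E0: "E \<ge> 0" using pin[of "\<lambda>_. 0"] by (simp add: real)
      have "?u \<le> 2 * sqrt E"
      proof (rule tv_least)
        fix h :: "'a \<Rightarrow> real" assume "h \<in> borel_measurable borel" "\<And>x. \<bar>h x\<bar> \<le> 1"
        from pin[OF this] have "((\<integral>x. h x \<partial>?\<nu>) - (\<integral>x. h x \<partial>rho0))\<^sup>2 \<le> 4 * E" by (simp add: real)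
        then have "sqrt (((\<integral>x. h x \<partial>?\<nu>) - (\<integral>x. h x \<partial>rho0))\<^sup>2) \<le> sqrt (4 * E)" by (rule real_sqrt_le_mono)
        then show "\<bar>(\<integral>x. h x \<partial>?\<nu>) - (\<integral>x. h x \<partial>rho0)\<bar> \<le> 2 * sqrt E" by (simp add: real_sqrt_mult)
      qed
      then have "?u\<^sup>2 \<le> (2 * sqrt E)\<^sup>2" using u0 by (intro power_mono)
      then have u2: "?u\<^sup>2 \<le> 4 * E" using E0 by (simp add: power_mult_distrib)
      have "?d\<^sup>2 \<le> (C * (?u + 1 / \<gamma>))\<^sup>2" by (rule power_mono[OF d1 d0])
      also have "\<dots> = C\<^sup>2 * (?u + 1 / \<gamma>)\<^sup>2" by (rule power_mult_distrib)
      also have "\<dots> \<le> C\<^sup>2 * (8 * (E + 1 / \<gamma>\<^sup>2))"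
      proof (rule mult_left_mono)
        have "(x + y)\<^sup>2 \<le> 2 * x\<^sup>2 + 2 * y\<^sup>2" for x y :: real
          using sum_squares_bound[of x y] by (simp add: power2_sum)
        from this[of ?u "1 / \<gamma>"] have "(?u + 1 / \<gamma>)\<^sup>2 \<le> 2 * ?u\<^sup>2 + 2 * (1 / \<gamma>\<^sup>2)"
          by (simp add: power_divide)
        moreover have "2 * v + 2 * w \<le> 8 * (e + w)" if "v \<le> 4 * e" "0 \<le> w" for v w e :: real
          using that by argo
        from this[OF u2, of "1 / \<gamma>\<^sup>2"]
        have "2 * ?u\<^sup>2 + 2 * (1 / \<gamma>\<^sup>2) \<le> 8 * (E + 1 / \<gamma>\<^sup>2)" by simp
        ultimately show "(?u + 1 / \<gamma>)\<^sup>2 \<le> 8 * (E + 1 / \<gamma>\<^sup>2)" by (rule order_trans)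
      qed simp
      also have "\<dots> \<le> (8 * C\<^sup>2 + 1) * (E + 1 / \<gamma>\<^sup>2)" using E0 by (simp add: algebra_simps)
      finally show ?thesis by (simp add: real)
    next
      case PInf
      have "8 * C\<^sup>2 + 1 > 0" by (simp add: add_nonneg_pos)
      then show ?thesis by (simp add: PInf)
    next
      case MInf
      then show ?thesis using pin[of "\<lambda>_. 0"] by simp
    qed
  qed
qed

end
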